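(* For every $n \geq 1$, the poset $\hat P_n$ (the uncrossing partial order $P_n$ on matchings of $2n$ points on a circle, with a minimum element $\hat 0$ adjoined) is an Eulerian poset: for every pair $x < y$ in $\hat P_n$, the number of elements of odd rank in the interval $[x,y]$ equals the number of elements of even rank in $[x,y]$.
   Context: Let $P_n$ be the set of perfect matchings of $2n$ points labeled $1,2,\ldots,2n$ in order around a circle. A matching $\tau$ is represented by medial graphs (strand diagrams): collections of $n$ curves (strands) drawn in the disk, each joining the two boundary points of a pair of $\tau$, meeting transversally in finitely many interior double points (crossings). A medial graph is lensless if any two strands intersect at most once. For $\tau \in P_n$, $c(\tau)$ is the number of crossings in a lensless medial graph representing $\tau$ (this equals the number of pairs of crossing chords of $\tau$). Resolving a crossing means replacing a crossing locally by one of its two non-crossing smoothings. Declare $\tau' \lessdot \tau$ if there is a lensless medial graph $G$ representing $\tau$ such that resolving one crossing of $G$ gives a lensless medial graph representing $\tau'$; $P_n$ is partially ordered by the transitive closure of these relations. $P_n$ is graded with rank function $c$, has a unique maximum, and has the non-crossing matchings as its minimal elements. $\hat P_n$ is $P_n$ with a new minimum element $\hat 0$ adjoined, with rank $c(\hat 0) = -1$. *)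

theory Defs
  imports "HOL-Analysis.Analysis" "HOL-Library.Disjoint_Sets"
begin

section \<open>Perfect matchings\<close>

type_synonym matching = "nat set set"

definition matchings :: "nat \<Rightarrow> matching set" where
  "matchings n = {\<tau>. partition_on {1..2*n} \<tau> \<and> (\<forall>e\<in>\<tau>. card e = 2)}"


section \<open>Medial graphs\<close>

text \<open>The disk is the closed unit disk of the complex plane. The labelled boundary points are
  the points \<open>cis (\<theta> i)\<close> for \<open>1 \<le> i \<le> 2 n\<close>. Their exact positions are part of the drawing;
  only their circular order is prescribed.\<close>

definition circular_labelling :: "nat \<Rightarrow> (nat \<Rightarrow> real) \<Rightarrow> bool" where
  "circular_labelling n \<theta> \<longleftrightarrow>
     strict_mono_on {1..2*n} \<theta> \<and> \<theta> (2*n) < \<theta> 1 + 2 * pi"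

text \<open>\<open>\<gamma> e\<close> is the strand that joins the two points of the pair \<open>e\<close>.\<close>

type_synonym strands = "nat set \<Rightarrow> real \<Rightarrow> complex"

definition strand :: "(nat \<Rightarrow> real) \<Rightarrow> nat set \<Rightarrow> (real \<Rightarrow> complex) \<Rightarrow> bool" where
  "strand \<theta> e c \<longleftrightarrow>
     arc c \<and>
     {pathstart c, pathfinish c} = (\<lambda>i. cis (\<theta> i)) ` e \<and>
     path_image c - {pathstart c, pathfinish c} \<subseteq> ball 0 1"

definition crossings :: "matching \<Rightarrow> strands \<Rightarrow> complex set" where
  "crossings \<tau> \<gamma> =
     {z. \<exists>e\<in>\<tau>. \<exists>f\<in>\<tau>. e \<noteq> f \<and> z \<in> path_image (\<gamma> e) \<and> z \<in> path_image (\<gamma> f)}"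

definition square :: "complex set" where
  "square = {w. \<bar>Re w\<bar> \<le> 1 \<and> \<bar>Im w\<bar> \<le> 1}"

text \<open>\<open>h\<close> is a local chart around the point \<open>h 0\<close>. Since \<open>square\<close> is compact, \<open>h\<close> is a
  homeomorphism onto its image. In this chart the strand of \<open>e\<close> is the horizontal axis, the strand
  of \<open>f\<close> is the vertical axis, and no other strand occurs. The existence of such a chart
  says that \<open>h 0\<close> is an interior double point at which the two strands cross transversally.\<close>

definition crossing_chart ::
    "matching \<Rightarrow> strands \<Rightarrow> (complex \<Rightarrow> complex) \<Rightarrow> nat set \<Rightarrow> nat set \<Rightarrow> bool" where
  "crossing_chart \<tau> \<gamma> h e f \<longleftrightarrow>
     continuous_on square h \<and> inj_on h square \<and> h ` square \<subseteq> ball 0 1 \<and>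
     e \<in> \<tau> \<and> f \<in> \<tau> \<and> e \<noteq> f \<and>
     {w \<in> square. h w \<in> path_image (\<gamma> e)} = {w \<in> square. Im w = 0} \<and>
     {w \<in> square. h w \<in> path_image (\<gamma> f)} = {w \<in> square. Re w = 0} \<and>
     (\<forall>g \<in> \<tau> - {e, f}. path_image (\<gamma> g) \<inter> h ` square = {})"

definition medial_graph :: "nat \<Rightarrow> (nat \<Rightarrow> real) \<Rightarrow> matching \<Rightarrow> strands \<Rightarrow> bool" where
  "medial_graph n \<theta> \<tau> \<gamma> \<longleftrightarrow>
     \<tau> \<in> matchings n \<and> circular_labelling n \<theta> \<and>
     (\<forall>e\<in>\<tau>. strand \<theta> e (\<gamma> e)) \<and>
     finite (crossings \<tau> \<gamma>) \<and>
     (\<forall>z\<in>crossings \<tau> \<gamma>. \<exists>h e f. h 0 = z \<and> crossing_chart \<tau> \<gamma> h e f)"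

definition lensless :: "matching \<Rightarrow> strands \<Rightarrow> bool" where
  "lensless \<tau> \<gamma> \<longleftrightarrow>
     (\<forall>e\<in>\<tau>. \<forall>f\<in>\<tau>. e \<noteq> f \<longrightarrow> (\<exists>\<^sub>\<le>\<^sub>1z. z \<in> path_image (\<gamma> e) \<and> z \<in> path_image (\<gamma> f)))"

definition lensless_medial_graph :: "nat \<Rightarrow> (nat \<Rightarrow> real) \<Rightarrow> matching \<Rightarrow> strands \<Rightarrow> bool" where
  "lensless_medial_graph n \<theta> \<tau> \<gamma> \<longleftrightarrow> medial_graph n \<theta> \<tau> \<gamma> \<and> lensless \<tau> \<gamma>"

text \<open>The well-definedness of this number (every matching has a lensless medial graph, and all of
  them have equally many crossings) is part of the theory of medial graphs.\<close>

definition crossing_number :: "nat \<Rightarrow> matching \<Rightarrow> nat" where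
  "crossing_number n \<tau> =
     (THE k. \<exists>\<theta> \<gamma>. lensless_medial_graph n \<theta> \<tau> \<gamma> \<and> k = card (crossings \<tau> \<gamma>))"


section \<open>Resolving a crossing\<close>

text \<open>The two non-crossing ways to join the four endpoints of the axes inside the square. Each of
  these sets consists of two disjoint segments.\<close>

definition smoothing1 :: "complex set" where
  "smoothing1 = {w \<in> square. \<bar>Re w - Im w\<bar> = 1}"

definition smoothing2 :: "complex set" where
  "smoothing2 = {w \<in> square. \<bar>Re w + Im w\<bar> = 1}"

text \<open>The strands \<open>e\<close> and \<open>f\<close> that cross at \<open>h 0\<close> are replaced by strands \<open>e'\<close> and \<open>f'\<close>
  that cover the same points outside the image of the chart and follow a smoothing inside.\<close>

definition resolves ::
    "matching \<Rightarrow> strands \<Rightarrow> matching \<Rightarrow> strands \<Rightarrow> bool" where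
  "resolves \<tau> \<gamma> \<tau>' \<gamma>' \<longleftrightarrow>
     (\<exists>h e f e' f'. crossing_chart \<tau> \<gamma> h e f \<and>
        \<tau>' = (\<tau> - {e, f}) \<union> {e', f'} \<and>
        (\<forall>g \<in> \<tau> - {e, f}. \<gamma>' g = \<gamma> g) \<and>
        (path_image (\<gamma>' e') \<union> path_image (\<gamma>' f')) - h ` square =
          (path_image (\<gamma> e) \<union> path_image (\<gamma> f)) - h ` square \<and>
        {w \<in> square. h w \<in> path_image (\<gamma>' e') \<union> path_image (\<gamma>' f')}
          \<in> {smoothing1, smoothing2})"


section \<open>The uncrossing order\<close>

definition uncrosses :: "nat \<Rightarrow> matching \<Rightarrow> matching \<Rightarrow> bool" where
  "uncrosses n \<tau>' \<tau> \<longleftrightarrow>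
     (\<exists>\<theta> \<gamma> \<gamma>'. lensless_medial_graph n \<theta> \<tau> \<gamma> \<and> lensless_medial_graph n \<theta> \<tau>' \<gamma>' \<and>
        resolves \<tau> \<gamma> \<tau>' \<gamma>')"

definition uncrossing_le :: "nat \<Rightarrow> matching \<Rightarrow> matching \<Rightarrow> bool" where
  "uncrossing_le n = (uncrosses n)\<^sup>*\<^sup>*"

text \<open>\<open>None\<close> is the adjoined minimum.\<close>

definition P_hat :: "nat \<Rightarrow> matching option set" where
  "P_hat n = insert None (Some ` matchings n)"

fun le_hat :: "nat \<Rightarrow> matching option \<Rightarrow> matching option \<Rightarrow> bool" where
  "le_hat n None y = True"
| "le_hat n (Some \<sigma>) None = False"
| "le_hat n (Some \<sigma>) (Some \<tau>) = uncrossing_le n \<sigma> \<tau>"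

definition order_hat :: "nat \<Rightarrow> matching option rel" where
  "order_hat n = {(x, y). x \<in> P_hat n \<and> y \<in> P_hat n \<and> le_hat n x y}"

fun rank_hat :: "nat \<Rightarrow> matching option \<Rightarrow> int" where
  "rank_hat n None = -1"
| "rank_hat n (Some \<tau>) = int (crossing_number n \<tau>)"


section \<open>Eulerian posets\<close>

definition covers :: "'a rel \<Rightarrow> 'a \<Rightarrow> 'a \<Rightarrow> bool" where
  "covers r x y \<longleftrightarrow>
     (x, y) \<in> r \<and> x \<noteq> y \<and> (\<forall>z. (x, z) \<in> r \<and> (z, y) \<in> r \<longrightarrow> z = x \<or> z = y)"

definition bounded_graded_poset :: "'a set \<Rightarrow> 'a rel \<Rightarrow> ('a \<Rightarrow> int) \<Rightarrow> bool" where
  "bounded_graded_poset A r \<rho> \<longleftrightarrow>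
     finite A \<and> partial_order_on A r \<and>
     (\<exists>b\<in>A. \<forall>x\<in>A. (b, x) \<in> r) \<and> (\<exists>t\<in>A. \<forall>x\<in>A. (x, t) \<in> r) \<and>
     (\<forall>x y. covers r x y \<longrightarrow> \<rho> y = \<rho> x + 1)"

definition interval :: "'a rel \<Rightarrow> 'a \<Rightarrow> 'a \<Rightarrow> 'a set" where
  "interval r x y = {z. (x, z) \<in> r \<and> (z, y) \<in> r}"

definition eulerian_poset :: "'a set \<Rightarrow> 'a rel \<Rightarrow> ('a \<Rightarrow> int) \<Rightarrow> bool" where
  "eulerian_poset A r \<rho> \<longleftrightarrow>
     bounded_graded_poset A r \<rho> \<and>
     (\<forall>x y. (x, y) \<in> r \<and> x \<noteq> y \<longrightarrow>
        card {z \<in> interval r x y. odd (\<rho> z)} = card {z \<in> interval r x y. even (\<rho> z)})"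

end

theory Submission
  imports Defs "HOL-Combinatorics.Transposition"
begin

text \<open>By the Fashoda meet theorem, disjoint strands never join interlaced pairs of boundary points.
  Applied to the two resolutions of a crossing, this shows that the strands of a lensless medial graph
  meet exactly if their chords cross, so the order is generated by the repairings
  \<open>{a, b}, {c, d} \<mapsto> {a, c}, {b, d}\<close> of crossing chords that lower the number of crossing pairs
  of chords by one; straight chords in general position realise all of them.

  Let \<open>s\<close> be the exchange of two adjacent points \<open>i, j\<close>. It changes the number of crossings of every
  matching without the chord \<open>{i, j}\<close> by one and satisfies the lifting property of Bruhat orders.
  A matching \<open>\<sigma>\<close> other than the maximum has adjacent points at which it is uncrossed. If \<open>\<tau>\<close> is crossed
  there, \<open>s\<close> is a sign reversing involution on \<open>[\<sigma>, \<tau>]\<close>; otherwise lifting gives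
  \<open>E \<sigma> (s \<tau>) - E \<sigma> \<tau> = E (s \<sigma>) (s \<tau>) - E (s \<sigma>) \<tau>\<close> for the alternating sums \<open>E\<close>, and all but \<open>E \<sigma> \<tau>\<close>
  vanish by induction from the top. Below \<open>\<tau>\<close>, where the new minimum is involved, \<open>s\<close> cancels
  everything except the matchings that contain \<open>{i, j}\<close>. For \<open>i, j\<close> at the start of an innermost arc of
  \<open>\<tau>\<close> these form a principal ideal, which reduces the claim to fewer points.\<close>

section \<open>Perfect matchings and crossing chords\<close>

text \<open>The obstacle is that exchanging \<open>i\<close> and \<open>j\<close> fixes every
  matching that contains the chord \<open>{i, j}\<close>, so it reverses no sign there. Nothing
  crosses such a chord, hence no resolution destroys it, and these matchings are closed downwards.
  An interval above a matching without the chord is therefore free of them, but a principal ideal is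
  not; this is why the adjoined minimum calls for an argument of its own. Its rank -1 is odd, so the
  alternating sum over a principal ideal of matchings has to be 1 instead of 0, and this 1 comes
  from the empty matching on no points. Deleting chords leaves gaps among the labels, so matchings
  live on arbitrary finite sets of numbers. On the topological side everything is reduced to
  counting: a drawing has at least one crossing for every interlaced pair of chords, and exactly as
  many if and only if it is lensless. This yields the well-definedness of the crossing number and
  spares any surgery on lenses.\<close>

definition perfect_matching :: "nat set \<Rightarrow> matching \<Rightarrow> bool" where
  "perfect_matching S \<tau> \<longleftrightarrow> finite S \<and> partition_on S \<tau> \<and> (\<forall>e\<in>\<tau>. card e = 2)"

text \<open>Oriented by which chord starts first, so that a sum over ordered pairs counts every
  crossing pair once.\<close>

definition cross_left :: "nat set \<Rightarrow> nat set \<Rightarrow> bool" where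
  "cross_left e f \<longleftrightarrow> Min e < Min f \<and> Min f < Max e \<and> Max e < Max f"

definition cross :: "nat set \<Rightarrow> nat set \<Rightarrow> bool" where
  "cross e f \<longleftrightarrow> cross_left e f \<or> cross_left f e"

definition cross_count :: "matching \<Rightarrow> nat" where
  "cross_count \<tau> = (\<Sum>e\<in>\<tau>. \<Sum>f\<in>\<tau>. of_bool (cross_left e f))"

text \<open>On the circle this tells on which side of the chord \<open>{a, b}\<close> the point
  \<open>x\<close> lies. Only comparisons of two such values are invariant under moving the starting
  point of the labelling.\<close>

definition separates :: "nat \<Rightarrow> nat \<Rightarrow> nat \<Rightarrow> bool" where
  "separates a b x \<longleftrightarrow> a < x \<and> x < b \<or> b < x \<and> x < a"

lemma cross_sym: "cross e f \<longleftrightarrow> cross f e"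
  by (auto simp: cross_def)

lemma not_cross_self [simp]: "\<not> cross e e"
  by (auto simp: cross_def cross_left_def)

text \<open>Frees the arguments about positions from ordering the ends: crossing means that one
  chord has the ends of the other on different sides, a condition that survives any renaming of
  ends.\<close>

lemma cross_pair:
  assumes "distinct [a, b, c, d]"
  shows "cross {a, b} {c, d} \<longleftrightarrow> (separates a b c \<noteq> separates a b d)"
  using assms unfolding cross_def cross_left_def separates_def
  by (simp add: min_def max_def, smt (verit) linorder_neqE_nat order_less_trans less_le)

lemma cross_count_insert:
  assumes "finite \<tau>" "e \<notin> \<tau>"
  shows "cross_count (insert e \<tau>) = cross_count \<tau> + (\<Sum>g\<in>\<tau>. of_bool (cross g e))"
proof -
  have *: "of_bool (cross g e) = of_bool (cross_left g e) + (of_bool (cross_left e g) :: nat)" for g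
    by (auto simp: cross_def cross_left_def)
  have "\<not> cross_left e e" by (simp add: cross_left_def)
  then show ?thesis
    using assms by (simp add: cross_count_def sum.distrib * del: sum_of_bool_eq)
qed

lemma perfect_matching_finite:
  assumes "perfect_matching S \<tau>" shows "finite S" "finite \<tau>"
  using assms finite_elements by (auto simp: perfect_matching_def)

lemma perfect_matching_Union: "perfect_matching S \<tau> \<Longrightarrow> \<Union>\<tau> = S"
  by (simp add: perfect_matching_def partition_on_def)

lemma perfect_matching_disjoint:
  "perfect_matching S \<tau> \<Longrightarrow> e \<in> \<tau> \<Longrightarrow> f \<in> \<tau> \<Longrightarrow> x \<in> e \<Longrightarrow> x \<in> f \<Longrightarrow> e = f"
  by (auto simp: perfect_matching_def partition_on_def disjoint_def)

lemma perfect_matching_empty [simp]: "perfect_matching {} \<tau> \<longleftrightarrow> \<tau> = {}"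
  by (auto simp: perfect_matching_def partition_on_def)

lemma perfect_matching_insert:
  assumes "perfect_matching S \<rho>" "a \<noteq> b" "a \<notin> S" "b \<notin> S"
  shows "perfect_matching (insert a (insert b S)) (insert {a, b} \<rho>)"
  using assms by (auto simp: perfect_matching_def partition_on_def disjoint_def)

lemma perfect_matching_remove:
  assumes "perfect_matching S \<tau>" "{a, b} \<in> \<tau>"
  shows "perfect_matching (S - {a, b}) (\<tau> - {{a, b}})"
  using assms by (fastforce simp: perfect_matching_def partition_on_def disjoint_def)

lemma perfect_matching_distinct:
  assumes "perfect_matching S \<tau>" "{a, b} \<in> \<tau>"
  shows "a \<noteq> b" "a \<in> S" "b \<in> S"
  using assms by (fastforce simp: perfect_matching_def partition_on_def)+

lemma perfect_matching_partner:
  assumes "perfect_matching S \<tau>" "i \<in> S"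
  obtains a where "{i, a} \<in> \<tau>" "a \<noteq> i" "a \<in> S"
proof -
  obtain e where e: "e \<in> \<tau>" "i \<in> e"
    using assms by (auto simp: perfect_matching_def partition_on_def)
  then have "card e = 2" using assms by (auto simp: perfect_matching_def)
  then obtain a where "e = {i, a}" using e(2) by (auto simp: card_2_iff)
  then show ?thesis using e that assms(1) perfect_matching_distinct by metis
qed

lemma perfect_matching_partner_unique:
  assumes "perfect_matching S \<tau>" "{i, a} \<in> \<tau>" "{i, b} \<in> \<tau>"
  shows "a = b"
  using perfect_matching_disjoint[OF assms(1,2,3), of i] by (auto simp: doubleton_eq_iff)

lemma perfect_matching_pair:
  assumes "perfect_matching S \<tau>" "e \<in> \<tau>"
  obtains a b where "e = {a, b}" "a < b"
proof -
  obtain a b where "e = {a, b}" "a \<noteq> b"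
    using assms by (auto simp: perfect_matching_def card_2_iff)
  then show ?thesis using that by (metis insert_commute linorder_neqE_nat)
qed

lemma perfect_matching_insert2:
  assumes "perfect_matching S \<rho>" "distinct [a, b, c, d]" "{a, b, c, d} \<inter> S = {}"
  shows "perfect_matching ({a, b, c, d} \<union> S) (insert {a, b} (insert {c, d} \<rho>))"
proof -
  have "perfect_matching (insert c (insert d S)) (insert {c, d} \<rho>)"
    using assms by (intro perfect_matching_insert) auto
  then have "perfect_matching (insert a (insert b (insert c (insert d S)))) (insert {a, b} (insert {c, d} \<rho>))"
    using assms by (intro perfect_matching_insert) auto
  then show ?thesis by simp
qed

lemma perfect_matching_split2:
  assumes "perfect_matching S \<tau>" "{a, b} \<in> \<tau>" "{c, d} \<in> \<tau>" "{a, b} \<noteq> {c, d}"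
  obtains \<rho> T where "\<tau> = insert {a, b} (insert {c, d} \<rho>)" "perfect_matching T \<rho>"
    "distinct [a, b, c, d]" "{a, b, c, d} \<inter> T = {}" "S = {a, b, c, d} \<union> T"
    "\<rho> = \<tau> - {{a, b}, {c, d}}"
proof -
  have "{a, b} \<inter> {c, d} = {}"
    using perfect_matching_disjoint[OF assms(1-3)] assms(4) by (metis disjoint_iff)
  moreover have "a \<noteq> b" "c \<noteq> d" using perfect_matching_distinct assms(1-3) by blast+
  ultimately have d: "distinct [a, b, c, d]" by simp
  have 1: "perfect_matching (S - {a, b}) (\<tau> - {{a, b}})"
    using perfect_matching_remove assms(1,2) by blast
  have "{c, d} \<in> \<tau> - {{a, b}}" using assms(3,4) by blast
  from perfect_matching_remove[OF 1 this]
  have 2: "perfect_matching (S - {a, b, c, d}) (\<tau> - {{a, b}, {c, d}})"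
    by (metis Diff_insert Diff_insert2 insert_is_Un)
  have 3: "{a, b, c, d} \<subseteq> S"
    using perfect_matching_distinct[OF assms(1,2)] perfect_matching_distinct[OF assms(1,3)] by simp
  show ?thesis
  proof (rule that)
    show "\<tau> = insert {a, b} (insert {c, d} (\<tau> - {{a, b}, {c, d}}))" using assms(2,3) by blast
    show "S = {a, b, c, d} \<union> (S - {a, b, c, d})" using 3 by blast
  qed (use d 2 in simp_all)
qed

lemma cross_count_insert2:
  assumes "finite \<rho>" "e \<notin> \<rho>" "f \<notin> \<rho>" "e \<noteq> f"
  shows "cross_count (insert e (insert f \<rho>)) =
    cross_count \<rho> + (\<Sum>g\<in>\<rho>. of_bool (cross g e) + of_bool (cross g f)) + of_bool (cross e f)"
  using assms by (simp add: cross_count_insert sum.distrib cross_sym[of f e])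

text \<open>The ends are unordered, so exchanging the names \<open>c\<close> and \<open>d\<close>
  gives the other smoothing. Crossings with chords of \<open>\<rho>\<close> may disappear as well,
  so a resolution need not be a cover.\<close>

definition resolution :: "matching \<Rightarrow> matching \<Rightarrow> bool" where
  "resolution \<tau> \<tau>' \<longleftrightarrow> (\<exists>a b c d \<rho> T. perfect_matching T \<rho> \<and> distinct [a, b, c, d] \<and>
     {a, b, c, d} \<inter> T = {} \<and> cross {a, b} {c, d} \<and>
     \<tau> = insert {a, b} (insert {c, d} \<rho>) \<and> \<tau>' = insert {a, c} (insert {b, d} \<rho>))"

lemma resolution_perfect_matching:
  assumes "resolution \<tau> \<tau>'"
  shows "perfect_matching S \<tau> \<longleftrightarrow> perfect_matching S \<tau>'"
proof -
  obtain a b c d \<rho> T where *: "perfect_matching T \<rho>" "distinct [a, b, c, d]"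
     "{a, b, c, d} \<inter> T = {}" "cross {a, b} {c, d}"
     "\<tau> = insert {a, b} (insert {c, d} \<rho>)" "\<tau>' = insert {a, c} (insert {b, d} \<rho>)"
    using assms unfolding resolution_def by blast
  have "perfect_matching ({a, b, c, d} \<union> T) \<tau>"
    using * perfect_matching_insert2 by auto
  moreover have "perfect_matching ({a, c, b, d} \<union> T) \<tau>'"
    unfolding * by (rule perfect_matching_insert2) (use * in auto)
  then have "perfect_matching ({a, b, c, d} \<union> T) \<tau>'" by (simp add: insert_commute)
  ultimately show ?thesis using perfect_matching_Union by metis
qed

text \<open>A chord \<open>{x, y}\<close> that met neither of two crossing chords and had them on
  different sides would keep them apart.\<close>

lemma cross_no_separation:
  assumes "distinct [a, b, c, d]" "x \<notin> {a, b, c, d}" "y \<notin> {a, b, c, d}" "cross {a, b} {c, d}"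
    "separates x y a = separates x y b" "separates x y c = separates x y d"
  shows "separates x y a = separates x y c"
proof -
  have "separates a b c \<noteq> separates a b d" using assms cross_pair by metis
  then show ?thesis
    using assms(1-3,5,6) unfolding separates_def by (simp, smt (verit) linorder_neqE_nat order_less_trans)
qed

text \<open>Only the sides of \<open>a\<close>, \<open>b\<close>, \<open>c\<close>, \<open>d\<close>
  relative to \<open>{x, y}\<close> matter. The one distribution that would gain crossings has
  \<open>a, b\<close> on one side and \<open>c, d\<close> on the other, and crossing chords exclude
  it.\<close>

lemma resolution_chord_le:
  assumes "distinct [a, b, c, d, x, y]" "cross {a, b} {c, d}"
  shows "of_bool (cross {x, y} {a, c}) + of_bool (cross {x, y} {b, d})
    \<le> (of_bool (cross {x, y} {a, b}) + of_bool (cross {x, y} {c, d}) :: nat)"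
proof -
  have "cross {x, y} {a, c} \<longleftrightarrow> (separates x y a \<noteq> separates x y c)"
    "cross {x, y} {b, d} \<longleftrightarrow> (separates x y b \<noteq> separates x y d)"
    "cross {x, y} {a, b} \<longleftrightarrow> (separates x y a \<noteq> separates x y b)"
    "cross {x, y} {c, d} \<longleftrightarrow> (separates x y c \<noteq> separates x y d)"
    using assms(1) by (auto simp: cross_pair)
  moreover have "separates x y a = separates x y c"
    if "separates x y a = separates x y b" "separates x y c = separates x y d"
    using that assms by (intro cross_no_separation[of a b c d]) auto
  ultimately show ?thesis
    by (cases "separates x y a"; cases "separates x y b"; cases "separates x y c"; cases "separates x y d") simp_all
qed

section \<open>Resolutions and the uncrossing order\<close>

lemma separates_sym: "separates b a x = separates a b x"
  by (auto simp: separates_def)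

text \<open>Trichotomy and transitivity for three points, spelled out as propositions. Their
  instances for the points involved turn statements about circular position into tautologies that
  \<open>satx\<close> decides.\<close>

lemma triple_order:
  assumes "a \<noteq> b" "a \<noteq> c" "b \<noteq> c"
  shows "(b < a \<longleftrightarrow> \<not> a < b) \<and> (c < a \<longleftrightarrow> \<not> a < c) \<and> (c < b \<longleftrightarrow> \<not> b < c) \<and>
    (a < b \<and> b < c \<longrightarrow> a < c) \<and> (a < c \<and> c < b \<longrightarrow> a < b) \<and> (b < a \<and> a < c \<longrightarrow> b < c) \<and>
    (b < c \<and> c < a \<longrightarrow> b < a) \<and> (c < a \<and> a < b \<longrightarrow> c < b) \<and> (c < b \<and> b < a \<longrightarrow> c < (a::nat))"
  using assms by (intro conjI impI) auto

lemma separates_exchange: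
  assumes "distinct [a, b, c, d]"
  shows "separates a b c \<noteq> separates a b d \<longleftrightarrow> separates c d a \<noteq> separates c d b"
proof -
  note triples = triple_order[of a b c] triple_order[of a b d] triple_order[of a c d] triple_order[of b c d]
  have "a \<noteq> b" "a \<noteq> c" "a \<noteq> d" "b \<noteq> c" "b \<noteq> d" "c \<noteq> d" using assms by auto
  then show ?thesis using triples unfolding separates_def by satx
qed

text \<open>Four points on a circle have three pairings, exactly one of which is interlaced. This is
  the uniqueness half; \<open>separates_some_pairing\<close> is the existence half.\<close>

lemma separates_disjoint_pairings:
  assumes "distinct [a, b, c, d]" "separates a b c \<noteq> separates a b d"
  shows "separates a c b = separates a c d"
proof -
  note triples = triple_order[of a b c] triple_order[of a b d] triple_order[of a c d] triple_order[of b c d]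
  have "a \<noteq> b" "a \<noteq> c" "a \<noteq> d" "b \<noteq> c" "b \<noteq> d" "c \<noteq> d" using assms by auto
  then show ?thesis using triples assms(2) unfolding separates_def by satx
qed

lemma separates_some_pairing:
  assumes "distinct [a, b, c, d]" "separates a b c = separates a b d" "separates a c b = separates a c d"
  shows "separates a d b \<noteq> separates a d c"
proof -
  note triples = triple_order[of a b c] triple_order[of a b d] triple_order[of a c d] triple_order[of b c d]
  have "a \<noteq> b" "a \<noteq> c" "a \<noteq> d" "b \<noteq> c" "b \<noteq> d" "c \<noteq> d" using assms by auto
  then show ?thesis using triples assms(2-) unfolding separates_def by satx
qed

text \<open>One of the two open arcs between \<open>c\<close> and \<open>d\<close> contains
  \<open>x\<close> and \<open>b\<close>, the other contains \<open>y\<close>. The former misses both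
  \<open>y\<close> and \<open>d\<close>, so the chord \<open>{y, d}\<close> does not cut it.\<close>

lemma separates_transfer:
  assumes "distinct [c, d, x, b, y]"
    "separates c d x = separates c d b" "separates c d y \<noteq> separates c d x"
  shows "separates y d x = separates y d b"
proof -
  note triples = triple_order[of b c d] triple_order[of b c x] triple_order[of b c y] triple_order[of b d x] triple_order[of b d y] triple_order[of b x y] triple_order[of c d x] triple_order[of c d y] triple_order[of c x y] triple_order[of d x y]
  have "b \<noteq> c" "b \<noteq> d" "b \<noteq> x" "b \<noteq> y" "c \<noteq> d" "c \<noteq> x" "c \<noteq> y" "d \<noteq> x" "d \<noteq> y" "x \<noteq> y"
    using assms by auto
  then show ?thesis using triples assms(2-) unfolding separates_def by satx
qed

lemma cross_imp_not_cross_repaired: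
  assumes "distinct [a, b, c, d]" "cross {a, b} {c, d}"
  shows "\<not> cross {a, c} {b, d}"
proof -
  have "cross {a, c} {b, d} \<longleftrightarrow> (separates a c b \<noteq> separates a c d)"
    by (rule cross_pair) (use assms in auto)
  then show ?thesis
    using separates_disjoint_pairings assms cross_pair by metis
qed

text \<open>The \<open>Suc\<close> stands for the resolved crossing, which the new pair does not
  have. Any further loss is a loss of crossings with chords of \<open>\<rho>\<close>, and by the
  third claim each of these contributes a nonnegative amount.\<close>

lemma resolution_cross_count:
  assumes "perfect_matching T \<rho>" "distinct [a, b, c, d]" "{a, b, c, d} \<inter> T = {}" "cross {a, b} {c, d}"
  shows "cross_count (insert {a, b} (insert {c, d} \<rho>)) = Suc (cross_count \<rho> +
      (\<Sum>g\<in>\<rho>. of_bool (cross g {a, b}) + of_bool (cross g {c, d})))"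
    and "cross_count (insert {a, c} (insert {b, d} \<rho>)) = cross_count \<rho> +
      (\<Sum>g\<in>\<rho>. of_bool (cross g {a, c}) + of_bool (cross g {b, d}))"
    and "g \<in> \<rho> \<Longrightarrow> of_bool (cross g {a, c}) + of_bool (cross g {b, d})
      \<le> (of_bool (cross g {a, b}) + of_bool (cross g {c, d}) :: nat)"
proof -
  have fin: "finite \<rho>" using assms perfect_matching_finite by blast
  have "\<Union>\<rho> = T" using assms perfect_matching_Union by blast
  then have notin: "{u, v} \<notin> \<rho>" if "u \<in> {a, b, c, d}" for u v using that assms(3) by auto
  have "{a, b} \<noteq> {c, d}" "{a, c} \<noteq> {b, d}" using assms(2) by (auto simp: doubleton_eq_iff)
  then show "cross_count (insert {a, b} (insert {c, d} \<rho>)) = Suc (cross_count \<rho> +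
      (\<Sum>g\<in>\<rho>. of_bool (cross g {a, b}) + of_bool (cross g {c, d})))"
    "cross_count (insert {a, c} (insert {b, d} \<rho>)) = cross_count \<rho> +
      (\<Sum>g\<in>\<rho>. of_bool (cross g {a, c}) + of_bool (cross g {b, d}))"
    using cross_imp_not_cross_repaired[OF assms(2,4)] assms(4) notin
    by (subst cross_count_insert2[OF fin]; simp)+
  assume g: "g \<in> \<rho>"
  then obtain x y where xy: "g = {x, y}" "x < y" using assms(1) perfect_matching_pair by blast
  then have "x \<in> T" "y \<in> T" using g assms(1) perfect_matching_distinct by blast+
  then show "of_bool (cross g {a, c}) + of_bool (cross g {b, d})
      \<le> (of_bool (cross g {a, b}) + of_bool (cross g {c, d}) :: nat)"
    unfolding xy using assms xy by (intro resolution_chord_le) auto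
qed

lemma resolution_cross_count_less:
  assumes "resolution \<tau> \<tau>'"
  shows "cross_count \<tau>' < cross_count \<tau>"
proof -
  obtain a b c d \<rho> T where *: "perfect_matching T \<rho>" "distinct [a, b, c, d]"
     "{a, b, c, d} \<inter> T = {}" "cross {a, b} {c, d}"
     "\<tau> = insert {a, b} (insert {c, d} \<rho>)" "\<tau>' = insert {a, c} (insert {b, d} \<rho>)"
    using assms unfolding resolution_def by blast
  show ?thesis
    unfolding *(5,6) resolution_cross_count(1,2)[OF *(1-4)]
    using sum_mono[OF resolution_cross_count(3)[OF *(1-4)]] by (simp add: less_Suc_eq_le)
qed

text \<open>The condition on the counts singles out the resolutions that can be drawn without
  lenses.\<close>

definition uncross_cover :: "matching \<Rightarrow> matching \<Rightarrow> bool" where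
  "uncross_cover \<tau>' \<tau> \<longleftrightarrow> resolution \<tau> \<tau>' \<and> cross_count \<tau> = Suc (cross_count \<tau>')"

definition uncross_le :: "matching \<Rightarrow> matching \<Rightarrow> bool" where
  "uncross_le = uncross_cover\<^sup>*\<^sup>*"

lemma uncross_le_refl [simp]: "uncross_le \<tau> \<tau>"
  by (simp add: uncross_le_def)

lemma uncross_le_trans [trans]: "uncross_le \<rho> \<sigma> \<Longrightarrow> uncross_le \<sigma> \<tau> \<Longrightarrow> uncross_le \<rho> \<tau>"
  by (simp add: uncross_le_def)

lemma uncross_cover_imp_le: "uncross_cover \<tau>' \<tau> \<Longrightarrow> uncross_le \<tau>' \<tau>"
  by (simp add: uncross_le_def)

lemma resolutionI:
  assumes "perfect_matching T \<rho>" "distinct [a, b, c, d]" "{a, b, c, d} \<inter> T = {}" "cross {a, b} {c, d}"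
    "\<tau> = insert {a, b} (insert {c, d} \<rho>)" "\<tau>' = insert {a, c} (insert {b, d} \<rho>)"
  shows "resolution \<tau> \<tau>'"
  using assms unfolding resolution_def by blast

text \<open>Here \<open>{x, y}\<close> crosses both resolved chords and neither of the new ones. Its
  ends are on different sides of \<open>{c, d}\<close>, so precisely one of them can take over the
  role of \<open>b\<close> in the crossing with \<open>{c, d}\<close>. That end is used for the
  detour in \<open>resolution_imp_le\<close>, and the second claim is the crossing resolved last
  there.\<close>

lemma separating_chord_crosses:
  assumes "distinct [a, b, c, d, x, y]" "cross {a, b} {c, d}"
    "separates x y a = separates x y c" "separates x y b = separates x y d"
    "separates x y a \<noteq> separates x y b"
  shows "cross {a, x} {c, d} \<noteq> cross {a, y} {c, d}"
    "cross {a, x} {c, d} \<Longrightarrow> cross {x, d} {y, b}"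
proof -
  have 1: "separates a b c \<noteq> separates a b d" using assms cross_pair[of a b c d] by auto
  have 2: "cross {a, x} {c, d} \<longleftrightarrow> (separates c d a \<noteq> separates c d x)"
    "cross {a, y} {c, d} \<longleftrightarrow> (separates c d a \<noteq> separates c d y)"
    "cross {x, d} {y, b} \<longleftrightarrow> (separates y b x \<noteq> separates y b d)"
    using assms(1) by (auto simp: cross_pair cross_sym[of "{a, x}"] cross_sym[of "{a, y}"] cross_sym[of "{x, d}"])
  have 3: "separates c d x \<noteq> separates c d y"
    using separates_exchange[of x y c d] assms by auto
  then show "cross {a, x} {c, d} \<noteq> cross {a, y} {c, d}" unfolding 2 by blast
  assume "cross {a, x} {c, d}"
  moreover have "separates c d a \<noteq> separates c d b"
    using separates_exchange[of a b c d] 1 assms(1) by auto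
  ultimately have "separates c d x = separates c d b" using 2 by blast
  moreover have "distinct [c, d, x, b, y]" using assms(1) by auto
  ultimately have "separates y d x = separates y d b"
    using 3 separates_transfer[of c d x b y] by metis
  moreover have "separates y x d = separates y x b"
    using assms(4) by (simp add: separates_sym[of y x])
  moreover have "distinct [y, d, x, b]" using assms(1) by auto
  ultimately have "separates y b d \<noteq> separates y b x"
    using separates_some_pairing by metis
  then show "cross {x, d} {y, b}" unfolding 2 by blast
qed

text \<open>If a resolution removes more than one crossing, some chord \<open>{x, y}\<close> crosses both resolved
  chords but neither of the new ones; then it splits into three resolutions, which first involve
  \<open>{x, y}\<close> and finally restore it.\<close>

lemma resolution_imp_le:
  assumes "resolution \<tau> \<tau>'"
  shows "uncross_le \<tau>' \<tau>"
  using assms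
proof (induction "cross_count \<tau> - cross_count \<tau>'" arbitrary: \<tau> \<tau>' rule: less_induct)
  case less
  obtain a b c d \<rho> T where *: "perfect_matching T \<rho>" "distinct [a, b, c, d]"
     "{a, b, c, d} \<inter> T = {}" "cross {a, b} {c, d}"
     "\<tau> = insert {a, b} (insert {c, d} \<rho>)" "\<tau>' = insert {a, c} (insert {b, d} \<rho>)"
    using less.prems unfolding resolution_def by blast
  let ?f = "\<lambda>g. of_bool (cross g {a, b}) + of_bool (cross g {c, d}) :: nat"
  let ?f' = "\<lambda>g. of_bool (cross g {a, c}) + of_bool (cross g {b, d}) :: nat"
  show ?case
  proof (cases "\<forall>g\<in>\<rho>. ?f g = ?f' g")
    case True
    then have "(\<Sum>g\<in>\<rho>. ?f g) = (\<Sum>g\<in>\<rho>. ?f' g)" by (intro sum.cong) blast+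
    then have "cross_count \<tau> = Suc (cross_count \<tau>')"
      unfolding *(5,6) resolution_cross_count(1,2)[OF *(1-4)] by simp
    then show ?thesis
      using less.prems by (simp add: uncross_cover_imp_le uncross_cover_def)
  next
    case False
    then obtain g where g: "g \<in> \<rho>" "?f g \<noteq> ?f' g" by blast
    then have lt: "?f' g < ?f g"
      using resolution_cross_count(3)[OF *(1-4) g(1)] by linarith
    obtain x0 y0 where xy0: "g = {x0, y0}" "x0 < y0"
      using g(1) *(1) perfect_matching_pair by blast
    then have "x0 \<in> T" "y0 \<in> T" using g *(1) perfect_matching_distinct by blast+
    then have d0: "distinct [a, b, c, d, x0, y0]" using *(2,3) xy0 by auto
    have dd: "distinct [x0, y0, a, b]" "distinct [x0, y0, c, d]" "distinct [x0, y0, a, c]" "distinct [x0, y0, b, d]"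
      using d0 by auto
    note sep = dd[THEN cross_pair]
    \<comment> \<open>With the sides of \<open>a\<close>, \<open>b\<close>, \<open>c\<close>,
      \<open>d\<close> as \<open>p\<close>, \<open>q\<close>, \<open>r\<close>, \<open>s\<close>: a
      strict loss is possible only if \<open>{x0, y0}\<close> separates \<open>{a, c}\<close> from
      \<open>{b, d}\<close>, so that two crossings disappear.\<close>
    have bools: "p = r \<and> q = s \<and> p \<noteq> q"
      if "of_bool (p \<noteq> r) + of_bool (q \<noteq> s) < (of_bool (p \<noteq> q) + of_bool (r \<noteq> s) :: nat)" for p q r s :: bool
      using that by (cases p; cases q; cases r; cases s; simp)
    have sep0: "separates x0 y0 a = separates x0 y0 c" "separates x0 y0 b = separates x0 y0 d"
      "separates x0 y0 a \<noteq> separates x0 y0 b"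
      using bools lt unfolding xy0 sep by blast+
    obtain x y where xy: "g = {x, y}" "distinct [a, b, c, d, x, y]"
      "separates x y a = separates x y c" "separates x y b = separates x y d"
      "separates x y a \<noteq> separates x y b" "cross {a, x} {c, d}"
    proof (cases "cross {a, x0} {c, d}")
      case True
      then show ?thesis using that xy0 d0 sep0 by blast
    next
      case False
      then have "cross {a, y0} {c, d}" using separating_chord_crosses(1)[OF d0 *(4)] sep0 by blast
      moreover have "separates y0 x0 u = separates x0 y0 u" for u by (auto simp: separates_def)
      moreover have "distinct [a, b, c, d, y0, x0]" using d0 by auto
      ultimately show ?thesis
        by (intro that[of y0 x0]) (use xy0 sep0 in \<open>auto simp: insert_commute\<close>)
    qed
    have c1: "cross {a, b} {x, y}"
      using xy cross_pair[of x y a b] cross_sym[of "{a, b}"] by auto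
    have c3: "cross {x, d} {y, b}"
      using separating_chord_crosses(2)[OF xy(2) *(4) xy(3-5)] xy(6) by blast
    define \<sigma> where "\<sigma> = \<rho> - {{x, y}}"
    have \<sigma>: "perfect_matching (T - {x, y}) \<sigma>"
      unfolding \<sigma>_def using *(1) g(1) xy(1) by (intro perfect_matching_remove) auto
    have \<rho>: "\<rho> = insert {x, y} \<sigma>" using g xy(1) by (auto simp: \<sigma>_def)
    have T: "x \<in> T" "y \<in> T" using g xy(1) *(1) perfect_matching_distinct by blast+
    \<comment> \<open>The detour: \<open>{a, b}, {x, y}\<close> becomes
      \<open>{a, x}, {b, y}\<close>, then \<open>{a, x}, {c, d}\<close> becomes
      \<open>{a, c}, {x, d}\<close>, and finally \<open>{x, d}, {y, b}\<close> becomes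
      \<open>{x, y}, {d, b}\<close>. All three steps lower the count, so each of them lowers it by
      less than the whole.\<close>
    define \<tau>1 where "\<tau>1 = insert {a, x} (insert {b, y} (insert {c, d} \<sigma>))"
    define \<tau>2 where "\<tau>2 = insert {a, c} (insert {x, d} (insert {b, y} \<sigma>))"
    have r1: "resolution \<tau> \<tau>1"
    proof (rule resolutionI)
      show "perfect_matching (insert c (insert d (T - {x, y}))) (insert {c, d} \<sigma>)"
        using \<sigma> *(2,3) by (intro perfect_matching_insert) auto
    qed (use c1 xy(2) *(3) T in \<open>auto simp: *(5) \<rho> \<tau>1_def\<close>)
    have r2: "resolution \<tau>1 \<tau>2"
    proof (rule resolutionI)
      show "perfect_matching (insert b (insert y (T - {x, y}))) (insert {b, y} \<sigma>)"
        using \<sigma> xy(2) *(3) by (intro perfect_matching_insert) auto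
    qed (use xy(2,6) *(3) T in \<open>auto simp: \<tau>1_def \<tau>2_def\<close>)
    have r3: "resolution \<tau>2 \<tau>'"
    proof (rule resolutionI)
      show "perfect_matching (insert a (insert c (T - {x, y}))) (insert {a, c} \<sigma>)"
        using \<sigma> xy(2) *(3) by (intro perfect_matching_insert) auto
    qed (use c3 xy(2) *(3) T in \<open>auto simp: \<tau>2_def *(6) \<rho> insert_commute\<close>)
    note lts = r1[THEN resolution_cross_count_less] r2[THEN resolution_cross_count_less]
      r3[THEN resolution_cross_count_less]
    have "uncross_le \<tau>1 \<tau>" by (rule less.hyps[OF _ r1]) (use lts in linarith)
    moreover have "uncross_le \<tau>2 \<tau>1" by (rule less.hyps[OF _ r2]) (use lts in linarith)
    moreover have "uncross_le \<tau>' \<tau>2" by (rule less.hyps[OF _ r3]) (use lts in linarith)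
    ultimately show ?thesis by (meson uncross_le_trans)
  qed
qed

lemma uncross_le_cases:
  assumes "uncross_le \<sigma> \<tau>" "\<sigma> \<noteq> \<tau>"
  obtains \<tau>' where "uncross_le \<sigma> \<tau>'" "uncross_cover \<tau>' \<tau>"
  using assms unfolding uncross_le_def by (metis rtranclp.cases)

lemma uncross_le_cross_count:
  assumes "uncross_le \<sigma> \<tau>"
  shows "cross_count \<sigma> \<le> cross_count \<tau>" "\<sigma> \<noteq> \<tau> \<Longrightarrow> cross_count \<sigma> < cross_count \<tau>"
proof -
  have "\<sigma> = \<tau> \<or> cross_count \<sigma> < cross_count \<tau>"
    using assms unfolding uncross_le_def
    by (induction rule: rtranclp_induct) (auto simp: uncross_cover_def)
  then show "cross_count \<sigma> \<le> cross_count \<tau>" "\<sigma> \<noteq> \<tau> \<Longrightarrow> cross_count \<sigma> < cross_count \<tau>"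
    by auto
qed

lemma uncross_le_antisym: "uncross_le \<sigma> \<tau> \<Longrightarrow> uncross_le \<tau> \<sigma> \<Longrightarrow> \<sigma> = \<tau>"
  using uncross_le_cross_count by fastforce

lemma uncross_cover_perfect_matching:
  "uncross_cover \<sigma> \<tau> \<Longrightarrow> perfect_matching S \<sigma> \<longleftrightarrow> perfect_matching S \<tau>"
  using resolution_perfect_matching by (auto simp: uncross_cover_def)

lemma uncross_le_perfect_matching:
  "uncross_le \<sigma> \<tau> \<Longrightarrow> perfect_matching S \<sigma> \<longleftrightarrow> perfect_matching S \<tau>"
  unfolding uncross_le_def
  by (induction rule: rtranclp_induct) (auto simp: uncross_cover_perfect_matching)

section \<open>Swapping adjacent points\<close>

definition adjacent :: "nat set \<Rightarrow> nat \<Rightarrow> nat \<Rightarrow> bool" where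
  "adjacent S i j \<longleftrightarrow> i \<in> S \<and> j \<in> S \<and> i < j \<and> (\<forall>k\<in>S. \<not> (i < k \<and> k < j))"

definition swap :: "nat \<Rightarrow> nat \<Rightarrow> matching \<Rightarrow> matching" where
  "swap i j \<tau> = (\<lambda>e. Transposition.transpose i j ` e) ` \<tau>"

definition crossed :: "nat \<Rightarrow> nat \<Rightarrow> matching \<Rightarrow> bool" where
  "crossed i j \<tau> \<longleftrightarrow> (\<exists>a b. {i, a} \<in> \<tau> \<and> {j, b} \<in> \<tau> \<and> cross {i, a} {j, b})"

text \<open>The chord \<open>{i, j}\<close> itself is excluded, which leaves three classes of
  matchings: crossed, uncrossed, and those containing \<open>{i, j}\<close>. Exchanging
  \<open>i\<close> and \<open>j\<close> interchanges the first two and fixes the members of the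
  third.\<close>

definition uncrossed :: "nat \<Rightarrow> nat \<Rightarrow> matching \<Rightarrow> bool" where
  "uncrossed i j \<tau> \<longleftrightarrow> {i, j} \<notin> \<tau> \<and> \<not> crossed i j \<tau>"

lemma adjacent_position:
  assumes "adjacent S i j" "k \<in> S"
  shows "k = i \<or> k = j \<or> k < i \<and> k < j \<or> i < k \<and> j < k"
  using assms unfolding adjacent_def by (metis linorder_neqE_nat order_less_trans)

lemma adjacent_separates:
  assumes "adjacent S i j" "x \<in> S" "y \<in> S" "x \<notin> {i, j}" "y \<notin> {i, j}"
  shows "separates x y i = separates x y j"
  using adjacent_position[OF assms(1,2)] adjacent_position[OF assms(1,3)] assms(4,5)
  unfolding separates_def by auto

lemma adjacent_separates_left:
  assumes "adjacent S i j" "x \<in> S" "y \<in> S" "x \<notin> {i, j}" "y \<notin> {i, j}"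
  shows "separates i x y = separates j x y"
  using adjacent_position[OF assms(1,2)] adjacent_position[OF assms(1,3)] assms(4,5)
  unfolding separates_def by auto

lemma adjacent_not_separates:
  assumes "adjacent S i j" "x \<in> S"
  shows "\<not> separates i j x"
  using assms unfolding separates_def adjacent_def by auto

lemma adjacent_not_cross:
  assumes "adjacent S i j" "c \<in> S" "d \<in> S" "distinct [i, j, c, d]"
  shows "\<not> cross {i, j} {c, d}"
  using adjacent_not_separates[OF assms(1)] assms cross_pair by metis

lemma adjacent_cross_flip:
  assumes "adjacent S i j" "a \<in> S" "b \<in> S" "distinct [i, a, j, b]"
  shows "cross {j, a} {i, b} \<longleftrightarrow> \<not> cross {i, a} {j, b}"
proof -
  have "distinct [j, a, i, b]" using assms(4) by auto
  moreover have "separates i a b = separates j a b"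
    using adjacent_separates_left assms by simp
  moreover have "separates i a j \<longleftrightarrow> \<not> separates j a i"
    using adjacent_position[OF assms(1,2)] assms(1,4) unfolding separates_def adjacent_def by auto
  ultimately show ?thesis using cross_pair assms(4) by metis
qed

text \<open>Exchanging neighbours preserves all comparisons with other points; the last hypothesis
  rules out comparing \<open>i\<close> with \<open>j\<close>.\<close>

lemma adjacent_separates_transpose:
  assumes "adjacent S i j" "a \<in> S" "b \<in> S" "x \<in> S"
    "x \<notin> {i, j} \<or> a \<notin> {i, j} \<and> b \<notin> {i, j}"
  shows "separates (Transposition.transpose i j a) (Transposition.transpose i j b) (Transposition.transpose i j x) = separates a b x"
proof -
  consider "x \<notin> {i, j}" "a \<notin> {i, j}" "b \<notin> {i, j}" | "x \<notin> {i, j}" "a \<in> {i, j}" "b \<notin> {i, j}"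
    | "x \<notin> {i, j}" "a \<notin> {i, j}" "b \<in> {i, j}" | "x \<notin> {i, j}" "a \<in> {i, j}" "b \<in> {i, j}"
    | "x \<in> {i, j}" "a \<notin> {i, j}" "b \<notin> {i, j}"
    using assms(5) by blast
  then show ?thesis
  proof cases
    case 1
    then show ?thesis by simp
  next
    case 2
    then show ?thesis using adjacent_separates_left[OF assms(1,3,4)] by auto
  next
    case 3
    then have "separates i a x = separates j a x" using adjacent_separates_left[OF assms(1,2,4)] by auto
    then show ?thesis using 3 by (auto simp: separates_sym[of i] separates_sym[of j])
  next
    case 4
    then show ?thesis by (auto simp: separates_def)
  next
    case 5
    then show ?thesis using adjacent_separates[OF assms(1,2,3)] by auto
  qed
qed

lemma adjacent_cross_transpose:
  assumes "adjacent S i j" "{a, b, c, d} \<subseteq> S" "distinct [a, b, c, d]"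
    "{a, b} \<inter> {i, j} = {} \<or> {c, d} \<inter> {i, j} = {}"
  shows "cross {Transposition.transpose i j a, Transposition.transpose i j b} {Transposition.transpose i j c, Transposition.transpose i j d} \<longleftrightarrow>
    cross {a, b} {c, d}"
proof -
  let ?t = "Transposition.transpose i j"
  have inS: "a \<in> S" "b \<in> S" "c \<in> S" "d \<in> S" using assms(2) by auto
  have "distinct [?t a, ?t b, ?t c, ?t d]" using assms(3) by (auto simp: inj_eq[OF inj_on_transpose])
  moreover have "separates (?t a) (?t b) (?t c) = separates a b c"
    using assms(4) by (intro adjacent_separates_transpose[OF assms(1) inS(1,2,3)]) auto
  moreover have "separates (?t a) (?t b) (?t d) = separates a b d"
    using assms(4) by (intro adjacent_separates_transpose[OF assms(1) inS(1,2,4)]) auto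
  ultimately show ?thesis using assms(3) cross_pair by metis
qed

lemma perfect_matching_image:
  assumes "perfect_matching S \<tau>" "inj f"
  shows "perfect_matching (f ` S) ((`) f ` \<tau>)"
proof -
  have "f ` d \<inter> f ` e = {}" if "d \<in> \<tau>" "e \<in> \<tau>" "f ` d \<noteq> f ` e" for d e
    using perfect_matching_disjoint[OF assms(1) that(1,2)] that(3) image_Int[OF assms(2), of d e]
    by blast
  then have "disjoint ((`) f ` \<tau>)"
    unfolding disjoint_def by blast
  moreover have "card (f ` e) = card e" for e using assms(2) by (simp add: card_image inj_on_subset)
  ultimately show ?thesis
    using assms(1) unfolding perfect_matching_def partition_on_def by (auto simp: image_iff)
qed

lemma swap_insert: "swap i j (insert {a, b} \<tau>) = insert {Transposition.transpose i j a, Transposition.transpose i j b} (swap i j \<tau>)"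
  by (simp add: swap_def)

lemma swap_swap [simp]: "swap i j (swap i j \<tau>) = \<tau>"
  by (simp add: swap_def image_image)

lemma swap_inject [simp]: "swap i j \<sigma> = swap i j \<tau> \<longleftrightarrow> \<sigma> = \<tau>"
  by (metis swap_swap)

lemma swap_fixed:
  assumes "perfect_matching T \<rho>" "i \<notin> T" "j \<notin> T"
  shows "swap i j \<rho> = \<rho>"
proof -
  have "Transposition.transpose i j ` e = e" if "e \<in> \<rho>" for e
  proof -
    have "e \<subseteq> T" using that perfect_matching_Union[OF assms(1)] by auto
    then have "x \<noteq> i" "x \<noteq> j" if "x \<in> e" for x using assms that by auto
    then have "Transposition.transpose i j x = x" if "x \<in> e" for x using that by simp
    then show ?thesis by simp
  qed
  then show ?thesis by (simp add: swap_def)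
qed

lemma perfect_matching_swap:
  assumes "perfect_matching S \<tau>" "i \<in> S" "j \<in> S"
  shows "perfect_matching S (swap i j \<tau>)"
  using perfect_matching_image[OF assms(1), of "Transposition.transpose i j"] assms by (simp add: swap_def)

lemma swap_pairs:
  assumes "perfect_matching T \<rho>" "{i, j} \<inter> T = {}" "distinct [i, a, j, b]"
  shows "swap i j (insert {i, a} (insert {j, b} \<rho>)) = insert {j, a} (insert {i, b} \<rho>)"
  using assms swap_fixed[OF assms(1), of i j] by (auto simp: swap_insert)

lemma not_cup_cases:
  assumes "perfect_matching S \<tau>" "{i, j} \<notin> \<tau>" "i \<in> S" "j \<in> S" "i \<noteq> j"
  obtains a b \<rho> T where "\<tau> = insert {i, a} (insert {j, b} \<rho>)" "perfect_matching T \<rho>"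
    "distinct [i, a, j, b]" "{i, a, j, b} \<inter> T = {}" "S = {i, a, j, b} \<union> T"
    "crossed i j \<tau> \<longleftrightarrow> cross {i, a} {j, b}"
proof -
  obtain a where a: "{i, a} \<in> \<tau>" using perfect_matching_partner assms(1,3) by metis
  obtain b where b: "{j, b} \<in> \<tau>" using perfect_matching_partner assms(1,4) by metis
  have "{i, a} \<noteq> {j, b}" using a assms(2,5) by (auto simp: doubleton_eq_iff)
  then obtain \<rho> T where "\<tau> = insert {i, a} (insert {j, b} \<rho>)" "perfect_matching T \<rho>"
    "distinct [i, a, j, b]" "{i, a, j, b} \<inter> T = {}" "S = {i, a, j, b} \<union> T"
    using perfect_matching_split2[OF assms(1) a b] by metis
  moreover have "u = a \<and> v = b" if "{i, u} \<in> \<tau>" "{j, v} \<in> \<tau>" for u v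
    using perfect_matching_partner_unique[OF assms(1) that(1) a]
      perfect_matching_partner_unique[OF assms(1) that(2) b] by blast
  then have "crossed i j \<tau> \<longleftrightarrow> cross {i, a} {j, b}"
    using a b unfolding crossed_def by blast
  ultimately show ?thesis using that by blast
qed

lemma adjacentD:
  assumes "adjacent S i j" shows "i \<in> S" "j \<in> S" "i \<noteq> j" "i < j"
  using assms by (auto simp: adjacent_def)

lemma crossed_not_cup:
  assumes "perfect_matching S \<tau>" "crossed i j \<tau>" shows "{i, j} \<notin> \<tau>"
proof
  assume "{i, j} \<in> \<tau>"
  moreover obtain a b where ab: "{i, a} \<in> \<tau>" "{j, b} \<in> \<tau>" "cross {i, a} {j, b}"
    using assms(2) unfolding crossed_def by blast
  ultimately have "a = j" "b = i"
    using perfect_matching_partner_unique[OF assms(1)] by (metis insert_commute)+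
  then show False using ab(3) by (simp add: insert_commute)
qed

lemma crossed_swap:
  assumes "perfect_matching S \<tau>" "adjacent S i j" "{i, j} \<notin> \<tau>"
  shows "crossed i j (swap i j \<tau>) \<longleftrightarrow> \<not> crossed i j \<tau>" "{i, j} \<notin> swap i j \<tau>"
proof -
  note ij = adjacentD[OF assms(2)]
  obtain a b \<rho> T where *: "\<tau> = insert {i, a} (insert {j, b} \<rho>)" "perfect_matching T \<rho>"
    "distinct [i, a, j, b]" "{i, a, j, b} \<inter> T = {}" "S = {i, a, j, b} \<union> T"
    "crossed i j \<tau> \<longleftrightarrow> cross {i, a} {j, b}"
    using not_cup_cases[OF assms(1,3) ij(1-3)] by metis
  have sw: "swap i j \<tau> = insert {j, a} (insert {i, b} \<rho>)"
    unfolding *(1) using * by (intro swap_pairs) auto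
  have pm: "perfect_matching S (swap i j \<tau>)" using perfect_matching_swap assms(1) ij by blast
  have in_sw: "{i, b} \<in> swap i j \<tau>" "{j, a} \<in> swap i j \<tau>" using sw by simp_all
  have "u = b \<and> v = a" if "{i, u} \<in> swap i j \<tau>" "{j, v} \<in> swap i j \<tau>" for u v
    using perfect_matching_partner_unique[OF pm that(1) in_sw(1)]
      perfect_matching_partner_unique[OF pm that(2) in_sw(2)] by blast
  then have "crossed i j (swap i j \<tau>) \<longleftrightarrow> cross {i, b} {j, a}"
    using in_sw unfolding crossed_def by blast
  also have "\<dots> \<longleftrightarrow> \<not> cross {i, a} {j, b}"
    using adjacent_cross_flip[OF assms(2), of a b] *(3,5) cross_sym[of "{i, b}"] by simp
  finally show "crossed i j (swap i j \<tau>) \<longleftrightarrow> \<not> crossed i j \<tau>" using * by simp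
  have "{i, b} \<in> swap i j \<tau>" using sw by simp
  then show "{i, j} \<notin> swap i j \<tau>"
    using perfect_matching_partner_unique[OF pm, of i b j] *(3) by auto
qed

lemma crossed_imp_uncrossed_swap:
  assumes "perfect_matching S \<tau>" "adjacent S i j" "crossed i j \<tau>"
  shows "uncrossed i j (swap i j \<tau>)"
  using crossed_swap[OF assms(1,2)] crossed_not_cup[OF assms(1,3)] assms by (auto simp: uncrossed_def)

lemma uncrossed_imp_crossed_swap:
  assumes "perfect_matching S \<tau>" "adjacent S i j" "uncrossed i j \<tau>"
  shows "crossed i j (swap i j \<tau>)"
  using crossed_swap[OF assms(1,2)] assms by (auto simp: uncrossed_def)

text \<open>For crossing chords \<open>{i, a}\<close> and \<open>{j, b}\<close> the exchange of
  \<open>i\<close> and \<open>j\<close> is one of the two resolutions. A third chord has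
  \<open>i\<close> and \<open>j\<close> on the same side, so the number of its crossings with the
  two chords does not change.\<close>

lemma crossed_imp_cover_swap:
  assumes "perfect_matching S \<tau>" "adjacent S i j" "crossed i j \<tau>"
  shows "uncross_cover (swap i j \<tau>) \<tau>"
proof -
  note ij = adjacentD[OF assms(2)]
  obtain a b \<rho> T where *: "\<tau> = insert {i, a} (insert {j, b} \<rho>)" "perfect_matching T \<rho>"
    "distinct [i, a, j, b]" "{i, a, j, b} \<inter> T = {}" "S = {i, a, j, b} \<union> T"
    "crossed i j \<tau> \<longleftrightarrow> cross {i, a} {j, b}"
    using not_cup_cases[OF assms(1) crossed_not_cup[OF assms(1,3)] ij(1-3)] by metis
  have sw: "swap i j \<tau> = insert {i, b} (insert {a, j} \<rho>)"
    unfolding *(1) using * by (subst swap_pairs) (auto simp: insert_commute)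
  have \<tau>: "\<tau> = insert {i, a} (insert {b, j} \<rho>)" using *(1) by (simp add: insert_commute)
  have d: "distinct [i, a, b, j]" "{i, a, b, j} \<inter> T = {}" "cross {i, a} {b, j}"
    using * assms(3) by (auto simp: insert_commute)
  have "resolution \<tau> (swap i j \<tau>)" by (rule resolutionI[OF *(2) d \<tau> sw])
  moreover have "(of_bool (cross g {i, b}) + of_bool (cross g {a, j}) :: nat) =
      of_bool (cross g {i, a}) + of_bool (cross g {b, j})" if g: "g \<in> \<rho>" for g
  proof -
    obtain x y where xy: "g = {x, y}" "x < y" using g *(2) perfect_matching_pair by blast
    then have T: "x \<in> T" "y \<in> T" using g *(2) perfect_matching_distinct by blast+
    then have "distinct [x, y, i, b]" "distinct [x, y, a, j]" "distinct [x, y, i, a]" "distinct [x, y, b, j]"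
      using d xy by auto
    note c = this[THEN cross_pair]
    have "separates x y i = separates x y j"
      using T *(5,4) adjacent_separates[OF assms(2), of x y] by auto
    then show ?thesis unfolding xy c by auto
  qed
  then have "cross_count (insert {i, a} (insert {b, j} \<rho>)) = Suc (cross_count (insert {i, b} (insert {a, j} \<rho>)))"
    unfolding resolution_cross_count(1,2)[OF *(2) d] by simp
  then have "cross_count \<tau> = Suc (cross_count (swap i j \<tau>))" by (metis \<tau> sw)
  ultimately show ?thesis by (simp add: uncross_cover_def)
qed

lemma uncrossed_imp_cover_swap:
  assumes "perfect_matching S \<tau>" "adjacent S i j" "uncrossed i j \<tau>"
  shows "uncross_cover \<tau> (swap i j \<tau>)"
  using crossed_imp_cover_swap[OF perfect_matching_swap assms(2) uncrossed_imp_crossed_swap[OF assms]]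
    adjacentD[OF assms(2)] assms(1) by simp

text \<open>A resolution acts on two crossing chords, and no chord crosses one that joins
  neighbours.\<close>

lemma cup_le:
  assumes "uncross_le \<sigma> \<tau>" "perfect_matching S \<tau>" "adjacent S i j" "{i, j} \<in> \<tau>"
  shows "{i, j} \<in> \<sigma>"
  using assms(1,4,2) unfolding uncross_le_def
proof (induction rule: converse_rtranclp_induct)
  case (step \<sigma>' \<sigma>)
  then have cup: "{i, j} \<in> \<sigma>" and pm: "perfect_matching S \<sigma>"
    using uncross_le_perfect_matching unfolding uncross_le_def by blast+
  obtain a b c d \<rho> T where *: "perfect_matching T \<rho>" "distinct [a, b, c, d]"
     "{a, b, c, d} \<inter> T = {}" "cross {a, b} {c, d}"
     "\<sigma> = insert {a, b} (insert {c, d} \<rho>)" "\<sigma>' = insert {a, c} (insert {b, d} \<rho>)"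
    using step(1) unfolding uncross_cover_def resolution_def by blast
  have S: "a \<in> S" "b \<in> S" "c \<in> S" "d \<in> S"
    using perfect_matching_distinct[OF pm] *(5) by blast+
  have "{i, j} \<noteq> {a, b}"
  proof
    assume eq: "{i, j} = {a, b}"
    then have "\<not> cross {i, j} {c, d}"
      by (intro adjacent_not_cross[OF assms(3) S(3,4)]) (use *(2) in \<open>auto simp: doubleton_eq_iff\<close>)
    then show False using *(4) eq by simp
  qed
  moreover have "{i, j} \<noteq> {c, d}"
  proof
    assume eq: "{i, j} = {c, d}"
    then have "\<not> cross {i, j} {a, b}"
      by (intro adjacent_not_cross[OF assms(3) S(1,2)]) (use *(2) in \<open>auto simp: doubleton_eq_iff\<close>)
    then show False using *(4) eq cross_sym by simp
  qed
  ultimately show ?case using cup *(5,6) by auto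
qed

text \<open>A resolution can be transported along the exchange unless one of its chords ends in
  \<open>i\<close> and the other in \<open>j\<close>, because only the mutual position of such
  chords depends on the order of \<open>i\<close> and \<open>j\<close>. In the exceptional case the
  crossing at \<open>i, j\<close> is the one being resolved; one of its smoothings is the exchange,
  the other creates \<open>{i, j}\<close>.\<close>

lemma resolution_swap:
  assumes "resolution \<tau> \<tau>'" "perfect_matching S \<tau>" "adjacent S i j"
  shows "resolution (swap i j \<tau>) (swap i j \<tau>') \<or> crossed i j \<tau> \<and> (\<tau>' = swap i j \<tau> \<or> {i, j} \<in> \<tau>')"
proof -
  obtain a b c d \<rho> T where *: "perfect_matching T \<rho>" "distinct [a, b, c, d]"
     "{a, b, c, d} \<inter> T = {}" "cross {a, b} {c, d}"
     "\<tau> = insert {a, b} (insert {c, d} \<rho>)" "\<tau>' = insert {a, c} (insert {b, d} \<rho>)"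
    using assms(1) unfolding resolution_def by blast
  have S: "{a, b, c, d} \<subseteq> S"
    using perfect_matching_distinct[OF assms(2)] *(5) by blast
  show ?thesis
  proof (cases "{a, b} \<inter> {i, j} = {} \<or> {c, d} \<inter> {i, j} = {}")
    case True
    let ?t = "Transposition.transpose i j"
    have "perfect_matching (?t ` T) (swap i j \<rho>)"
      using perfect_matching_image[OF *(1), of ?t] by (simp add: swap_def)
    moreover have "distinct [?t a, ?t b, ?t c, ?t d]" using *(2) by (auto simp: inj_eq[OF inj_on_transpose])
    moreover have "?t ` {a, b, c, d} \<inter> ?t ` T = {}"
      using *(3) by (subst image_Int[symmetric]) auto
    moreover have "cross {?t a, ?t b} {?t c, ?t d}"
      using adjacent_cross_transpose[OF assms(3) S *(2) True] *(4) by simp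
    ultimately have "resolution (swap i j \<tau>) (swap i j \<tau>')"
      unfolding *(5,6) by (intro resolutionI[of "?t ` T" "swap i j \<rho>" "?t a" "?t b" "?t c" "?t d"])
        (simp_all add: swap_insert)
    then show ?thesis ..
  next
    case False
    have sw: "\<tau>' = swap i j \<tau>"
      if "\<tau> = insert {i, p} (insert {j, q} \<rho>)" "\<tau>' = insert {j, p} (insert {i, q} \<rho>)" "{i, p, j, q} = {a, b, c, d}"
         "distinct [i, p, j, q]"
      for p q
    proof -
      have "{i, p, j, q} \<inter> T = {}" using *(3) that(3) by (simp only:)
      then have "{i, j} \<inter> T = {}" by blast
      from swap_pairs[OF *(1) this that(4)] show ?thesis by (simp only: that(1,2))
    qed
    have crs: "crossed i j \<tau>" if "{i, p} \<in> \<tau>" "{j, q} \<in> \<tau>" "cross {i, p} {j, q}" for p q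
      using that unfolding crossed_def by blast
    have ij: "i \<noteq> j" using adjacentD[OF assms(3)] by blast
    \<comment> \<open>The new chords are \<open>{a, c}\<close> and \<open>{b, d}\<close>:
      \<open>i\<close> and \<open>j\<close> get joined in the cases 1, 4, 5 and 8, and the other
      four are the exchange.\<close>
    consider "a = i" "c = j" | "a = i" "d = j" | "b = i" "c = j" | "b = i" "d = j"
      | "a = j" "c = i" | "a = j" "d = i" | "b = j" "c = i" | "b = j" "d = i"
      using False *(2) ij by auto
    then have "crossed i j \<tau> \<and> (\<tau>' = swap i j \<tau> \<or> {i, j} \<in> \<tau>')"
    proof cases
      case 1
      then show ?thesis using crs[of b d] * by (auto simp: insert_commute)
    next
      case 2
      then show ?thesis using crs[of b c] sw[of b c] * by (auto simp: insert_commute)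
    next
      case 3
      then show ?thesis using crs[of a d] sw[of a d] * by (auto simp: insert_commute)
    next
      case 4
      then show ?thesis using crs[of a c] * by (auto simp: insert_commute)
    next
      case 5
      then show ?thesis using crs[of d b] * by (auto simp: insert_commute cross_sym)
    next
      case 6
      then show ?thesis using crs[of c b] sw[of c b] * by (auto simp: insert_commute cross_sym)
    next
      case 7
      then show ?thesis using crs[of d a] sw[of d a] * by (auto simp: insert_commute cross_sym)
    next
      case 8
      then show ?thesis using crs[of c a] * by (auto simp: insert_commute cross_sym)
    qed
    then show ?thesis ..
  qed
qed

section \<open>Alternating sums over intervals\<close>

lemma uncross_le_swap_crossed:
  assumes "perfect_matching S \<tau>" "adjacent S i j" "crossed i j \<tau>"
  shows "uncross_le (swap i j \<tau>) \<tau>"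
  using crossed_imp_cover_swap[OF assms] uncross_cover_imp_le by blast

lemma uncross_le_swap_uncrossed:
  assumes "perfect_matching S \<tau>" "adjacent S i j" "uncrossed i j \<tau>"
  shows "uncross_le \<tau> (swap i j \<tau>)"
  using uncrossed_imp_cover_swap[OF assms] uncross_cover_imp_le by blast

text \<open>The analogue of the lifting property of Bruhat order, by induction on a chain of covers
  from \<open>\<sigma>\<close> to \<open>\<tau>\<close>. Since \<open>\<sigma>\<close> lacks
  \<open>{i, j}\<close>, so does every matching before the last one, and each cover either commutes
  with the exchange or is the exchange. The claims about \<open>swap i j \<sigma>\<close> are
  intertwined: each of them refers to the other at the previous matching.\<close>

lemma swap_le_lift:
  assumes "uncross_le \<sigma> \<tau>" "perfect_matching S \<tau>" "adjacent S i j" "uncrossed i j \<sigma>"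
  shows "(crossed i j \<tau> \<longrightarrow> uncross_le \<sigma> (swap i j \<tau>) \<and> uncross_le (swap i j \<sigma>) \<tau>) \<and>
    (uncrossed i j \<tau> \<longrightarrow> uncross_le (swap i j \<sigma>) (swap i j \<tau>))"
  using assms(1,2) unfolding uncross_le_def
proof (induction rule: rtranclp_induct)
  case base
  then show ?case using assms(4) by (auto simp: uncrossed_def)
next
  case (step \<tau>' \<tau>)
  note pm = step.prems
  have pm': "perfect_matching S \<tau>'" using step(2) pm uncross_cover_perfect_matching by blast
  have le: "uncross_le \<sigma> \<tau>'" "uncross_le \<tau>' \<tau>"
    using step(1,2) uncross_cover_imp_le by (auto simp: uncross_le_def)
  then have not_cup: "{i, j} \<notin> \<tau>'" using cup_le[OF _ pm' assms(3)] assms(4) by (auto simp: uncrossed_def)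
  have IH: "crossed i j \<tau>' \<Longrightarrow> uncross_le \<sigma> (swap i j \<tau>')" "crossed i j \<tau>' \<Longrightarrow> uncross_le (swap i j \<sigma>) \<tau>'"
    "uncrossed i j \<tau>' \<Longrightarrow> uncross_le (swap i j \<sigma>) (swap i j \<tau>')"
    using step.IH[OF pm'] by (auto simp: uncross_le_def)
  have res: "resolution \<tau> \<tau>'" and count: "cross_count \<tau> = Suc (cross_count \<tau>')"
    using step(2) by (auto simp: uncross_cover_def)
  have sw: "uncross_le (swap i j \<tau>') (swap i j \<tau>) \<or> crossed i j \<tau> \<and> \<tau>' = swap i j \<tau>"
    using resolution_swap[OF res pm assms(3)] not_cup resolution_imp_le by blast
  show ?case unfolding uncross_le_def[symmetric]
  proof (intro conjI impI)
    assume cr: "crossed i j \<tau>"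
    note c1 = crossed_imp_cover_swap[OF pm assms(3) cr]
    show "uncross_le \<sigma> (swap i j \<tau>)"
    proof (cases "crossed i j \<tau>'")
      case True
      then show ?thesis
        using sw IH(1) uncross_le_trans le(1) by blast
    next
      case False
      then have un: "uncrossed i j \<tau>'" using not_cup by (simp add: uncrossed_def)
      note c2 = uncrossed_imp_cover_swap[OF pm' assms(3) un]
      \<comment> \<open>Exchanging raises \<open>\<tau>'\<close> and lowers \<open>\<tau>\<close> by
        one, while \<open>\<tau>\<close> has just one crossing more than \<open>\<tau>'\<close>.
        Then \<open>swap i j \<tau>'\<close> has more crossings than \<open>swap i j \<tau>\<close>,
        so this cover must be the exchange itself.\<close>
      have "\<not> uncross_le (swap i j \<tau>') (swap i j \<tau>)"
        using uncross_le_cross_count(1)[of "swap i j \<tau>'" "swap i j \<tau>"] c1 c2 count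
        by (auto simp: uncross_cover_def)
      then show ?thesis using sw le(1) by blast
    qed
    show "uncross_le (swap i j \<sigma>) \<tau>"
    proof (cases "crossed i j \<tau>'")
      case True
      then show ?thesis using IH(2) le(2) uncross_le_trans by blast
    next
      case False
      then have un: "uncrossed i j \<tau>'" using not_cup by (simp add: uncrossed_def)
      note c2 = uncrossed_imp_cover_swap[OF pm' assms(3) un]
      have "\<not> uncross_le (swap i j \<tau>') (swap i j \<tau>)"
        using uncross_le_cross_count(1)[of "swap i j \<tau>'" "swap i j \<tau>"] c1 c2 count
        by (auto simp: uncross_cover_def)
      then have "\<tau>' = swap i j \<tau>" using sw by blast
      then show ?thesis using IH(3)[OF un] by simp
    qed
  next
    assume un: "uncrossed i j \<tau>"
    then have le2: "uncross_le (swap i j \<tau>') (swap i j \<tau>)" using sw by (auto simp: uncrossed_def)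
    show "uncross_le (swap i j \<sigma>) (swap i j \<tau>)"
    proof (cases "crossed i j \<tau>'")
      case True
      then show ?thesis
        using IH(2) le(2) uncross_le_swap_uncrossed[OF pm assms(3) un] uncross_le_trans by blast
    next
      case False
      then show ?thesis using IH(3) not_cup le2 uncross_le_trans by (auto simp: uncrossed_def)
    qed
  qed
qed

lemmas uncrossed_le_swap = swap_le_lift[THEN conjunct1, rule_format, THEN conjunct1]
  and swap_uncrossed_le = swap_le_lift[THEN conjunct1, rule_format, THEN conjunct2]
  and swap_mono = swap_le_lift[THEN conjunct2, rule_format]

lemma finite_perfect_matchings: "finite {\<tau>. perfect_matching S \<tau>}"
proof (cases "finite S")
  case True
  have "{\<tau>. perfect_matching S \<tau>} \<subseteq> Pow (Pow S)"
    by (auto simp: perfect_matching_def partition_on_def)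
  then show ?thesis using True finite_subset by blast
qed (simp add: perfect_matching_def)

definition sign_sum :: "matching set \<Rightarrow> int" where
  "sign_sum Z = (\<Sum>z\<in>Z. (-1) ^ cross_count z)"

definition closed_interval :: "matching \<Rightarrow> matching \<Rightarrow> matching set" where
  "closed_interval \<sigma> \<tau> = {z. uncross_le \<sigma> z \<and> uncross_le z \<tau>}"

lemma closed_interval_perfect_matching:
  "perfect_matching S \<tau> \<Longrightarrow> z \<in> closed_interval \<sigma> \<tau> \<Longrightarrow> perfect_matching S z"
  unfolding closed_interval_def using uncross_le_perfect_matching by blast

lemma finite_closed_interval: "perfect_matching S \<tau> \<Longrightarrow> finite (closed_interval \<sigma> \<tau>)"
  by (rule finite_subset[OF _ finite_perfect_matchings[of S]])
    (auto dest: closed_interval_perfect_matching)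

lemma cross_count_swap_parity:
  assumes "perfect_matching S z" "adjacent S i j" "{i, j} \<notin> z"
  shows "(-1 :: int) ^ cross_count (swap i j z) = - ((-1) ^ cross_count z)"
proof (cases "crossed i j z")
  case True
  then show ?thesis using crossed_imp_cover_swap[OF assms(1,2)] by (simp add: uncross_cover_def)
next
  case False
  then show ?thesis using uncrossed_imp_cover_swap[OF assms(1,2)] assms(3)
    by (simp add: uncross_cover_def uncrossed_def)
qed

lemma sign_sum_swap_closed:
  assumes "adjacent S i j" "\<And>z. z \<in> Z \<Longrightarrow> perfect_matching S z" "\<And>z. z \<in> Z \<Longrightarrow> {i, j} \<notin> z"
    "\<And>z. z \<in> Z \<Longrightarrow> swap i j z \<in> Z"
  shows "sign_sum Z = 0"
proof -
  have "sign_sum Z = (\<Sum>z\<in>Z. (-1) ^ cross_count (swap i j z))"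
    unfolding sign_sum_def
    by (rule sum.reindex_bij_witness[of _ "swap i j" "swap i j"]) (use assms in auto)
  also have "\<dots> = (\<Sum>z\<in>Z. - ((-1) ^ cross_count z))"
    by (intro sum.cong refl cross_count_swap_parity[OF assms(2,1,3)])
  also have "\<dots> = - sign_sum Z" by (simp add: sign_sum_def sum_negf)
  finally show ?thesis by simp
qed

text \<open>The exchange maps the interval to itself. If \<open>z\<close> is crossed, its image is
  lower and stays above the uncrossed \<open>\<sigma>\<close>; if \<open>z\<close> is uncrossed, its
  image is higher and stays below the crossed \<open>\<tau>\<close>. Both are instances of
  lifting.\<close>

lemma sign_sum_interval_crossed:
  assumes "perfect_matching S \<tau>" "adjacent S i j" "uncrossed i j \<sigma>" "crossed i j \<tau>"
  shows "sign_sum (closed_interval \<sigma> \<tau>) = 0"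
proof (rule sign_sum_swap_closed[OF assms(2)])
  fix z assume z: "z \<in> closed_interval \<sigma> \<tau>"
  then show pm: "perfect_matching S z" using closed_interval_perfect_matching assms(1) by blast
  have le: "uncross_le \<sigma> z" "uncross_le z \<tau>" using z by (auto simp: closed_interval_def)
  show not_cup: "{i, j} \<notin> z"
    using cup_le[OF le(1) pm assms(2)] assms(3) by (auto simp: uncrossed_def)
  show "swap i j z \<in> closed_interval \<sigma> \<tau>"
  proof (cases "crossed i j z")
    case True
    show ?thesis
      using uncrossed_le_swap[OF le(1) pm assms(2,3) True]
        uncross_le_trans[OF uncross_le_swap_crossed[OF pm assms(2) True] le(2)]
      by (simp add: closed_interval_def)
  next
    case False
    then have un: "uncrossed i j z" using not_cup by (simp add: uncrossed_def)
    show ?thesis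
      using swap_uncrossed_le[OF le(2) assms(1,2) un assms(4)]
        uncross_le_trans[OF le(1) uncross_le_swap_uncrossed[OF pm assms(2) un]]
      by (simp add: closed_interval_def)
  qed
qed

section \<open>The maximum and the vanishing of alternating sums\<close>

definition crossing_matching :: "nat \<Rightarrow> matching" where
  "crossing_matching n = (\<lambda>i. {i, i + n}) ` {1..n}"

lemma perfect_matching_crossing_matching: "perfect_matching {1..2 * n} (crossing_matching n)"
proof -
  have "\<Union>(crossing_matching n) = {1..2 * n}"
  proof
    show "{1..2 * n} \<subseteq> \<Union>(crossing_matching n)"
    proof
      fix x assume x: "x \<in> {1..2 * n}"
      show "x \<in> \<Union>(crossing_matching n)"
      proof (cases "x \<le> n")
        case True
        then show ?thesis using x by (auto simp: crossing_matching_def)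
      next
        case False
        then have "x - n \<in> {1..n}" "x \<in> {x - n, x - n + n}" using x by auto
        then show ?thesis unfolding crossing_matching_def by blast
      qed
    qed
  qed (auto simp: crossing_matching_def)
  moreover have "disjoint (crossing_matching n)"
    by (auto simp: disjoint_def crossing_matching_def)
  ultimately show ?thesis
    unfolding perfect_matching_def partition_on_def
    by (auto simp: crossing_matching_def card_insert_if)
qed

text \<open>Any two neighbours are joined or have crossing chords. So once a point is joined to the
  left, all later ones are, and while points are joined to the right, their partners increase. The
  left ends therefore form an initial segment, of length \<open>n\<close> by counting, and their
  partners run through the remaining points in increasing order.\<close>

lemma no_uncrossed_imp_crossing_matching:
  assumes pm: "perfect_matching {1..2 * n} \<tau>"
    and no: "\<And>i j. adjacent {1..2 * n} i j \<Longrightarrow> \<not> uncrossed i j \<tau>"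
  shows "\<tau> = crossing_matching n"
proof -
  define S where "S = {1..2 * n}"
  have "\<exists>a. {i, a} \<in> \<tau>" if "i \<in> S" for i
    using perfect_matching_partner[OF pm, of i] that unfolding S_def by blast
  then obtain p where p: "\<And>i. i \<in> S \<Longrightarrow> {i, p i} \<in> \<tau>" by metis
  have pS: "p i \<in> S" "p i \<noteq> i" if "i \<in> S" for i
    using perfect_matching_distinct[OF pm p[OF that]] unfolding S_def by auto
  have pp: "p (p i) = i" if "i \<in> S" for i
    using perfect_matching_partner_unique[OF pm p[OF pS(1)[OF that]], of i] p[OF that]
    by (simp add: insert_commute)
  have nxt: "{i, Suc i} \<in> \<tau> \<or> cross {i, p i} {Suc i, p (Suc i)}"
    if "i \<in> S" "Suc i \<in> S" for i
  proof -
    have "adjacent {1..2 * n} i (Suc i)" using that by (auto simp: adjacent_def S_def)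
    then have "\<not> uncrossed i (Suc i) \<tau>" using no by blast
    then consider "{i, Suc i} \<in> \<tau>" | "crossed i (Suc i) \<tau>" by (auto simp: uncrossed_def)
    then show ?thesis
    proof cases
      case 2
      then obtain a b where ab: "{i, a} \<in> \<tau>" "{Suc i, b} \<in> \<tau>" "cross {i, a} {Suc i, b}"
        unfolding crossed_def by blast
      then have "a = p i" "b = p (Suc i)"
        using p[OF that(1)] p[OF that(2)] perfect_matching_partner_unique[OF pm] by blast+
      then show ?thesis using ab by blast
    qed simp
  qed
  have step: "(p i > i \<longrightarrow> (p (Suc i) < Suc i \<or> p i < p (Suc i))) \<and>
      (p i < i \<longrightarrow> p (Suc i) < Suc i)"
    if "i \<in> S" "Suc i \<in> S" for i
    using nxt[OF that]
  proof
    assume "{i, Suc i} \<in> \<tau>"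
    then have "p i = Suc i" "p (Suc i) = i"
      using p[OF that(1)] p[OF that(2)] perfect_matching_partner_unique[OF pm]
      by (metis insert_commute)+
    then show ?thesis by auto
  next
    assume cr: "cross {i, p i} {Suc i, p (Suc i)}"
    show ?thesis
    proof (cases "distinct [i, p i, Suc i, p (Suc i)]")
      case True
      then have "separates i (p i) (Suc i) \<noteq> separates i (p i) (p (Suc i))"
        using cr cross_pair by blast
      then show ?thesis using True unfolding separates_def by auto
    next
      case False
      then have "p i = Suc i \<or> p i = p (Suc i) \<or> p (Suc i) = i"
        using pS[OF that(1)] pS[OF that(2)] by auto
      then have "{i, p i} = {Suc i, p (Suc i)}"
        using pp[OF that(1)] pp[OF that(2)] by (metis insert_commute n_not_Suc_n)
      then show ?thesis using cr by simp
    qed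
  qed
  have up: "p i < i \<Longrightarrow> i \<in> S \<Longrightarrow> i + k \<in> S \<Longrightarrow> p (i + k) < i + k" for i k
  proof (induction k)
    case (Suc k)
    then have "i + k \<in> S" by (auto simp: S_def)
    then show ?case using Suc step[of "i + k"] by auto
  qed simp
  \<comment> \<open>Left and right ends of chords, exchanged by the partner map and hence equally
    many.\<close>
  define A where "A = {i\<in>S. i < p i}"
  define B where "B = {i\<in>S. p i < i}"
  have AB: "S = A \<union> B" "A \<inter> B = {}" using pS unfolding A_def B_def by fastforce+
  have fin: "finite A" "finite B" by (auto simp: A_def B_def S_def)
  have "bij_betw p A B"
    by (rule bij_betw_byWitness[of _ p]) (use pp pS in \<open>auto simp: A_def B_def\<close>)
  then have "card A = card B" by (rule bij_betw_same_card)
  moreover have "card S = 2 * n" by (simp add: S_def)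
  then have "card A + card B = 2 * n" using card_Un_disjoint[OF fin AB(2)] AB(1) by metis
  ultimately have cardA: "card A = n" by simp
  have less: "a < b" if "a \<in> A" "b \<in> B" for a b
  proof (rule ccontr)
    assume "\<not> a < b"
    then have "p (b + (a - b)) < b + (a - b)"
      using that up[of b "a - b"] by (auto simp: A_def B_def)
    then show False using \<open>\<not> a < b\<close> that by (auto simp: A_def)
  qed
  have A_eq: "A = {1..n}"
  proof -
    have down: "x \<in> A" if "a \<in> A" "x \<le> a" "1 \<le> x" for a x
    proof -
      have "x \<in> S" using that by (auto simp: A_def S_def)
      then show ?thesis using less[OF that(1)] that(2) AB by fastforce
    qed
    have "a \<le> n" if "a \<in> A" for a
    proof -
      have "{1..a} \<subseteq> A" using down[OF that] by auto
      then have "card {1..a} \<le> card A" by (rule card_mono[OF fin(1)])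
      then show ?thesis using cardA by simp
    qed
    then have "A \<subseteq> {1..n}" by (auto simp: A_def S_def)
    then show ?thesis using cardA by (intro card_subset_eq) auto
  qed
  have mono: "p i < p (Suc i)" if "1 \<le> i" "Suc i \<le> n" for i
  proof -
    have "i \<in> A" "Suc i \<in> A" using that A_eq by auto
    then show ?thesis using step[of i] by (auto simp: A_def)
  qed
  have pB: "p i \<in> {n+1..2*n}" if "i \<in> {1..n}" for i
  proof -
    have "i \<in> A" using that A_eq by simp
    then have "p i \<in> S" "p i \<notin> A" using pS pp by (auto simp: A_def)
    then show ?thesis using A_eq by (auto simp: S_def)
  qed
  \<comment> \<open>A strictly increasing map from \<open>{1..n}\<close> into
    \<open>{n+1..2*n}\<close> can only be the translation by \<open>n\<close>; the two bounds start
    from opposite ends of the range.\<close>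
  have lower: "Suc i \<le> n \<Longrightarrow> n + Suc i \<le> p (Suc i)" for i
  proof (induction i)
    case 0
    then show ?case using pB[of 1] by auto
  next
    case (Suc i)
    then show ?case using mono[of "Suc i"] by auto
  qed
  have upper: "i < n \<Longrightarrow> p (n - i) + i \<le> 2 * n" for i
  proof (induction i)
    case 0
    then show ?case using pB[of n] by auto
  next
    case (Suc i)
    then have "p (n - Suc i) < p (Suc (n - Suc i))" by (intro mono) auto
    moreover have "Suc (n - Suc i) = n - i" using Suc by auto
    ultimately show ?case using Suc by auto
  qed
  have p_eq: "p i = i + n" if "i \<in> {1..n}" for i
    using lower[of "i - 1"] upper[of "n - i"] that by auto
  have "{i, i + n} \<in> \<tau>" if "i \<in> {1..n}" for i
    using p[of i] p_eq[OF that] that by (simp add: S_def)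
  then have sub: "crossing_matching n \<subseteq> \<tau>"
    unfolding crossing_matching_def by blast
  have "\<tau> \<subseteq> crossing_matching n"
  proof
    fix e assume e: "e \<in> \<tau>"
    then obtain a b where ab: "e = {a, b}" "a < b" using perfect_matching_pair pm by blast
    then have "a \<in> S" using perfect_matching_distinct pm e unfolding S_def by blast
    then have "b = p a" using p perfect_matching_partner_unique[OF pm] e ab by blast
    then have "a \<in> A" using ab \<open>a \<in> S\<close> by (simp add: A_def)
    then show "e \<in> crossing_matching n"
      using ab \<open>b = p a\<close> p_eq A_eq unfolding crossing_matching_def by auto
  qed
  then show ?thesis using sub by blast
qed

text \<open>Makes inductions from the top possible, with the distance from \<open>K\<close> as
  measure.\<close>

lemma cross_count_bounded:
  obtains K where "\<And>\<tau>. perfect_matching S \<tau> \<Longrightarrow> cross_count \<tau> \<le> K"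
proof -
  have "finite (cross_count ` {\<tau>. perfect_matching S \<tau>})" using finite_perfect_matchings by blast
  then show ?thesis using that[of "Max (cross_count ` {\<tau>. perfect_matching S \<tau>})"] by auto
qed

text \<open>A matching other than the diameters is uncrossed at some neighbours, and the exchange
  there leads upwards.\<close>

lemma uncross_le_crossing_matching:
  assumes "perfect_matching {1..2 * n} \<tau>"
  shows "uncross_le \<tau> (crossing_matching n)"
proof -
  obtain K where K: "\<And>\<tau>. perfect_matching {1..2 * n} \<tau> \<Longrightarrow> cross_count \<tau> \<le> K"
    using cross_count_bounded by blast
  show ?thesis
    using assms
  proof (induction "K - cross_count \<tau>" arbitrary: \<tau> rule: less_induct)
    case less
    show ?case
    proof (cases "\<tau> = crossing_matching n")
      case False
      then obtain i j where ij: "adjacent {1..2 * n} i j" "uncrossed i j \<tau>"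
        using no_uncrossed_imp_crossing_matching less.prems by blast
      note c = uncrossed_imp_cover_swap[OF less.prems ij]
      have pm: "perfect_matching {1..2 * n} (swap i j \<tau>)"
        using perfect_matching_swap less.prems adjacentD[OF ij(1)] by blast
      then have "uncross_le (swap i j \<tau>) (crossing_matching n)"
        using less.hyps[of "swap i j \<tau>"] c K[OF pm] by (auto simp: uncross_cover_def)
      then show ?thesis using c uncross_cover_imp_le uncross_le_trans by blast
    qed simp
  qed
qed

text \<open>Downward induction on the bottom \<open>\<sigma>\<close>: lying strictly below
  \<open>\<tau>\<close> it is not the maximum, so it is uncrossed at some neighbours, and its
  exchange is closer to the top. The top varies in the induction, as two different tops occur for
  the raised bottom.\<close>

lemma sign_sum_closed_interval:
  assumes "perfect_matching {1..2 * n} \<tau>" "uncross_le \<sigma> \<tau>" "\<sigma> \<noteq> \<tau>"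
  shows "sign_sum (closed_interval \<sigma> \<tau>) = 0"
proof -
  obtain K where K: "\<And>\<tau>. perfect_matching {1..2 * n} \<tau> \<Longrightarrow> cross_count \<tau> \<le> K"
    using cross_count_bounded by blast
  show ?thesis
    using assms
  proof (induction "K - cross_count \<sigma>" arbitrary: \<sigma> \<tau> rule: less_induct)
    case less
    note pm = less.prems(1)
    have pm\<sigma>: "perfect_matching {1..2 * n} \<sigma>"
      using less.prems uncross_le_perfect_matching by blast
    have "\<sigma> \<noteq> crossing_matching n"
      using uncross_le_antisym[OF less.prems(2)] uncross_le_crossing_matching[OF pm] less.prems(3) by blast
    then obtain i j where ij: "adjacent {1..2 * n} i j" "uncrossed i j \<sigma>"
      using no_uncrossed_imp_crossing_matching pm\<sigma> by blast
    note c\<sigma> = uncrossed_imp_cover_swap[OF pm\<sigma> ij]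
    have less_c: "K - cross_count (swap i j \<sigma>) < K - cross_count \<sigma>"
      using c\<sigma> K[of "swap i j \<sigma>"] perfect_matching_swap[OF pm\<sigma>] adjacentD[OF ij(1)]
      by (auto simp: uncross_cover_def)
    have not_cup: "{i, j} \<notin> \<tau>"
      using cup_le[OF less.prems(2) pm ij(1)] ij(2) by (auto simp: uncrossed_def)
    show ?case
    proof (cases "crossed i j \<tau>")
      case True
      then show ?thesis using sign_sum_interval_crossed[OF pm ij] by simp
    next
      case False
      then have un: "uncrossed i j \<tau>" using not_cup by (simp add: uncrossed_def)
      let ?\<sigma> = "swap i j \<sigma>" and ?\<tau> = "swap i j \<tau>"
      have pm': "perfect_matching {1..2 * n} ?\<tau>"
        using perfect_matching_swap[OF pm] adjacentD[OF ij(1)] by blast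
      have cr: "crossed i j ?\<tau>" by (rule uncrossed_imp_crossed_swap[OF pm ij(1) un])
      have le_\<tau>: "uncross_le \<tau> ?\<tau>" and le_\<sigma>: "uncross_le \<sigma> ?\<sigma>"
        using uncross_le_swap_uncrossed pm pm\<sigma> ij un by blast+
      have 1: "sign_sum (closed_interval \<sigma> ?\<tau>) = 0"
        by (rule sign_sum_interval_crossed[OF pm' ij cr])
      have 2: "sign_sum (closed_interval ?\<sigma> ?\<tau>) = 0"
        using less.hyps[OF less_c pm' swap_mono[OF less.prems(2) pm ij un]] less.prems(3) by simp
      \<comment> \<open>This interval may be empty; if it is not, its bottom is crossed and its top
        uncrossed, so they differ.\<close>
      have 3: "sign_sum (closed_interval ?\<sigma> \<tau>) = 0"
      proof (cases "uncross_le ?\<sigma> \<tau>")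
        case True
        have "?\<sigma> \<noteq> \<tau>"
          using uncrossed_imp_crossed_swap[OF pm\<sigma> ij] un by (auto simp: uncrossed_def)
        then show ?thesis using less.hyps[OF less_c pm True] by simp
      next
        case False
        then have "closed_interval ?\<sigma> \<tau> = {}"
          unfolding closed_interval_def using uncross_le_trans by blast
        then show ?thesis by (simp add: sign_sum_def)
      qed
      have sub: "closed_interval \<sigma> \<tau> \<subseteq> closed_interval \<sigma> ?\<tau>"
        "closed_interval ?\<sigma> \<tau> \<subseteq> closed_interval ?\<sigma> ?\<tau>"
        using le_\<tau> uncross_le_trans unfolding closed_interval_def by blast+
      \<comment> \<open>What the interval gains when its top rises from \<open>\<tau>\<close> to
        \<open>?\<tau>\<close> is crossed at \<open>i, j\<close>, because an uncrossed element would
        already lie below \<open>\<tau>\<close> by lifting; and crossed elements lie above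
        \<open>?\<sigma>\<close>. So the gain is the same for the bottoms \<open>\<sigma>\<close>
        and \<open>?\<sigma>\<close>.\<close>
      have "uncross_le ?\<sigma> z" if z: "uncross_le \<sigma> z" "uncross_le z ?\<tau>" "\<not> uncross_le z \<tau>" for z
      proof -
        have pmz: "perfect_matching {1..2 * n} z" using z(2) pm' uncross_le_perfect_matching by blast
        have "{i, j} \<notin> z" using cup_le[OF z(1) pmz ij(1)] ij(2) by (auto simp: uncrossed_def)
        moreover have "\<not> uncrossed i j z"
          using uncrossed_le_swap[OF z(2) pm' ij(1) _ cr] z(3) by auto
        ultimately have "crossed i j z" by (simp add: uncrossed_def)
        then show ?thesis using swap_uncrossed_le[OF z(1) pmz ij] by blast
      qed
      then have diff: "closed_interval \<sigma> ?\<tau> - closed_interval \<sigma> \<tau> =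
          closed_interval ?\<sigma> ?\<tau> - closed_interval ?\<sigma> \<tau>"
        using le_\<sigma> uncross_le_trans unfolding closed_interval_def by blast
      have "sign_sum (closed_interval \<sigma> ?\<tau>) - sign_sum (closed_interval \<sigma> \<tau>) =
          sign_sum (closed_interval ?\<sigma> ?\<tau>) - sign_sum (closed_interval ?\<sigma> \<tau>)"
        using diff sum_diff[OF finite_closed_interval[OF pm'] sub(1)]
          sum_diff[OF finite_closed_interval[OF pm'] sub(2)]
        by (metis sign_sum_def)
      then show ?thesis using 1 2 3 by simp
    qed
  qed
qed

section \<open>Alternating sums over principal ideals\<close>

text \<open>Closing off \<open>i\<close> and \<open>j\<close> by a chord and joining the two loose
  ends. The chords \<open>{i, a}\<close> and \<open>{j, b}\<close> may cross or not, so that a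
  matching and its exchange have the same capping (see \<open>capped_swap\<close>).\<close>

definition capped :: "nat \<Rightarrow> nat \<Rightarrow> matching \<Rightarrow> matching \<Rightarrow> bool" where
  "capped i j z' z \<longleftrightarrow> (\<exists>a b \<rho> T. perfect_matching T \<rho> \<and> distinct [i, a, j, b] \<and> {i, a, j, b} \<inter> T = {} \<and>
     z' = insert {i, a} (insert {j, b} \<rho>) \<and> z = insert {i, j} (insert {a, b} \<rho>))"

lemma cappedI:
  assumes "perfect_matching T \<rho>" "distinct [i, a, j, b]" "{i, a, j, b} \<inter> T = {}"
    "z' = insert {i, a} (insert {j, b} \<rho>)" "z = insert {i, j} (insert {a, b} \<rho>)"
  shows "capped i j z' z"
  using assms unfolding capped_def by blast

lemma capped_swap:
  assumes "capped i j z' z"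
  shows "capped i j (swap i j z') z"
proof -
  obtain a b \<rho> T where *: "perfect_matching T \<rho>" "distinct [i, a, j, b]" "{i, a, j, b} \<inter> T = {}"
    "z' = insert {i, a} (insert {j, b} \<rho>)" "z = insert {i, j} (insert {a, b} \<rho>)"
    using assms unfolding capped_def by blast
  show ?thesis
  proof (rule cappedI)
    show "swap i j z' = insert {i, b} (insert {j, a} \<rho>)"
      unfolding *(4) using swap_pairs[OF *(1) _ *(2)] *(3) by (auto simp: insert_commute)
    show "z = insert {i, j} (insert {b, a} \<rho>)" unfolding *(5) by (simp add: insert_commute)
  qed (use * in auto)
qed

text \<open>If the chords at \<open>i\<close> and \<open>j\<close> cross, capping is one of the two
  resolutions of their crossing.\<close>

lemma capped_le_crossed:
  assumes "capped i j z' z" "perfect_matching S z'" "crossed i j z'"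
  shows "uncross_le z z'"
proof -
  obtain a b \<rho> T where *: "perfect_matching T \<rho>" "distinct [i, a, j, b]" "{i, a, j, b} \<inter> T = {}"
    "z' = insert {i, a} (insert {j, b} \<rho>)" "z = insert {i, j} (insert {a, b} \<rho>)"
    using assms(1) unfolding capped_def by blast
  obtain u v where uv: "{i, u} \<in> z'" "{j, v} \<in> z'" "cross {i, u} {j, v}"
    using assms(3) unfolding crossed_def by blast
  have "u = a" "v = b"
    using perfect_matching_partner_unique[OF assms(2) uv(1), of a]
      perfect_matching_partner_unique[OF assms(2) uv(2), of b] *(4) by simp_all
  then have "resolution z' z"
    using resolutionI[OF *(1,2,3) _ *(4,5)] uv(3) by blast
  then show ?thesis by (rule resolution_imp_le)
qed

lemma cup_resolution_cases:
  assumes "resolution z z1" "perfect_matching S z" "adjacent S i j" "{i, j} \<in> z"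
  obtains a b c d \<sigma> T where "perfect_matching T \<sigma>" "distinct [i, j, a, b, c, d]" "{i, j, a, b, c, d} \<inter> T = {}"
    "cross {a, b} {c, d}" "z = insert {i, j} (insert {a, b} (insert {c, d} \<sigma>))"
    "z1 = insert {i, j} (insert {a, c} (insert {b, d} \<sigma>))"
proof -
  obtain a b c d \<rho> T where *: "perfect_matching T \<rho>" "distinct [a, b, c, d]"
     "{a, b, c, d} \<inter> T = {}" "cross {a, b} {c, d}"
     "z = insert {a, b} (insert {c, d} \<rho>)" "z1 = insert {a, c} (insert {b, d} \<rho>)"
    using assms(1) unfolding resolution_def by blast
  have "{i, j} \<in> z1"
    using cup_le[OF resolution_imp_le[OF assms(1)] assms(2,3,4)] .
  have ij: "{i, j} \<in> \<rho>"
  proof (rule ccontr)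
    assume "{i, j} \<notin> \<rho>"
    then have "{i, j} = {a, b} \<or> {i, j} = {c, d}" "{i, j} = {a, c} \<or> {i, j} = {b, d}"
      using assms(4) \<open>{i, j} \<in> z1\<close> *(5,6) by auto
    then show False using *(2) by (auto simp: doubleton_eq_iff)
  qed
  have "perfect_matching (T - {i, j}) (\<rho> - {{i, j}})" using perfect_matching_remove[OF *(1) ij] .
  moreover have "i \<in> T" "j \<in> T" "i \<noteq> j" using perfect_matching_distinct[OF *(1) ij] by auto
  moreover have "\<rho> = insert {i, j} (\<rho> - {{i, j}})" using ij by blast
  ultimately show ?thesis
    by (intro that[of "T - {i, j}" "\<rho> - {{i, j}}" a b c d]) (use * in \<open>auto simp: insert_commute\<close>)
qed

text \<open>A resolution of \<open>z\<close> that leaves the joined chord \<open>{a, b}\<close>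
  alone is carried out in \<open>z'\<close> as it stands. If \<open>{a, b}\<close> is resolved with
  a chord \<open>{p, q}\<close>, then \<open>{a, b}\<close> stands for the route \<open>a\<close>,
  \<open>i\<close>, \<open>j\<close>, \<open>b\<close> of \<open>z'\<close>, and
  \<open>{p, q}\<close> must cross one of its pieces \<open>{i, a}\<close> and
  \<open>{j, b}\<close>; resolving that crossing gives a matching with the required capping.\<close>

lemma capped_lift:
  assumes "capped i j z' z" "resolution z z1" "perfect_matching S z" "adjacent S i j"
  shows "\<exists>z1'. uncross_le z1' z' \<and> capped i j z1' z1"
proof -
  obtain a b \<rho> T where *: "perfect_matching T \<rho>" "distinct [i, a, j, b]" "{i, a, j, b} \<inter> T = {}"
    "z' = insert {i, a} (insert {j, b} \<rho>)" "z = insert {i, j} (insert {a, b} \<rho>)"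
    using assms(1) unfolding capped_def by blast
  obtain c d e f \<sigma> U where **: "perfect_matching U \<sigma>" "distinct [i, j, c, d, e, f]"
    "{i, j, c, d, e, f} \<inter> U = {}" "cross {c, d} {e, f}"
    "z = insert {i, j} (insert {c, d} (insert {e, f} \<sigma>))"
    "z1 = insert {i, j} (insert {c, e} (insert {d, f} \<sigma>))"
    by (rule cup_resolution_cases[OF assms(2,3,4)]) (use *(5) in auto)
  have notin: "{i, j} \<notin> insert {a, b} \<rho>" "{i, j} \<notin> insert {c, d} (insert {e, f} \<sigma>)"
    using *(2,3) **(2,3) perfect_matching_distinct[OF *(1)] perfect_matching_distinct[OF **(1)]
    by (auto simp: doubleton_eq_iff)
  have eq: "insert {a, b} \<rho> = insert {c, d} (insert {e, f} \<sigma>)"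
    using *(5) **(5) notin by (metis insert_ident)
  have ab: "{a, b} \<notin> \<rho>" using *(3) perfect_matching_distinct[OF *(1)] by blast
  have S: "S = {i, j, c, d, e, f} \<union> U"
    unfolding perfect_matching_Union[OF assms(3), symmetric] perfect_matching_Union[OF **(1), symmetric] **(5)
    by (simp add: insert_commute)
  show ?thesis
  proof (cases "{a, b} \<in> \<sigma>")
    case True
    define \<sigma>' where "\<sigma>' = \<sigma> - {{a, b}}"
    have \<sigma>': "perfect_matching (U - {a, b}) \<sigma>'"
      unfolding \<sigma>'_def using perfect_matching_remove[OF **(1) True] .
    have abU: "a \<in> U" "b \<in> U" using perfect_matching_distinct[OF **(1) True] by auto
    have "{c, d} \<noteq> {a, b}" "{e, f} \<noteq> {a, b}" using abU **(3) by auto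
    moreover have "\<rho> = insert {c, d} (insert {e, f} \<sigma>) - {{a, b}}" unfolding eq[symmetric] using ab by (rule Diff_insert_absorb[symmetric])
    ultimately have \<rho>: "\<rho> = insert {c, d} (insert {e, f} \<sigma>')"
      by (simp add: \<sigma>'_def insert_Diff_if)
    let ?\<rho>1 = "insert {c, e} (insert {d, f} \<sigma>')"
    have pm1: "perfect_matching ({c, e, d, f} \<union> (U - {a, b})) ?\<rho>1"
      by (rule perfect_matching_insert2[OF \<sigma>']) (use **(2,3) in auto)
    have "capped i j (insert {i, a} (insert {j, b} ?\<rho>1)) z1"
    proof (rule cappedI[OF pm1])
      have "\<sigma> = insert {a, b} \<sigma>'" using True by (auto simp: \<sigma>'_def)
      then show "z1 = insert {i, j} (insert {a, b} ?\<rho>1)"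
        unfolding **(6) by (simp add: insert_commute)
      show "{i, a, j, b} \<inter> ({c, e, d, f} \<union> (U - {a, b})) = {}"
        using **(2,3) abU by auto
    qed (use *(2) in auto)
    moreover have "resolution z' (insert {i, a} (insert {j, b} ?\<rho>1))"
    proof (rule resolutionI[OF _ _ _ **(4)])
      show "perfect_matching ({i, a, j, b} \<union> (U - {a, b})) (insert {i, a} (insert {j, b} \<sigma>'))"
        by (rule perfect_matching_insert2[OF \<sigma>' *(2)]) (use **(3) in auto)
      show "distinct [c, d, e, f]" using **(2) by auto
      show "{c, d, e, f} \<inter> ({i, a, j, b} \<union> (U - {a, b})) = {}"
        using **(2,3) abU by auto
      show "z' = insert {c, d} (insert {e, f} (insert {i, a} (insert {j, b} \<sigma>')))"
        unfolding *(4) \<rho> by blast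
    qed blast
    ultimately show ?thesis using resolution_imp_le by blast
  next
    case False
    moreover have "{a, b} \<in> insert {c, d} (insert {e, f} \<sigma>)" unfolding eq[symmetric] by simp
    ultimately have "{a, b} = {c, d} \<or> {a, b} = {e, f}" by (simp only: insert_iff simp_thms)
    \<comment> \<open>The chord \<open>{a, b}\<close> may be either of the resolved chords, in
      either direction; in each case it is resolved with \<open>{p, q}\<close> into
      \<open>{a, p}\<close> and \<open>{b, q}\<close>.\<close>
    then have "(a = c \<and> b = d \<or> a = d \<and> b = c) \<or> (a = e \<and> b = f \<or> a = f \<and> b = e)"
      by (simp add: doubleton_eq_iff)
    then obtain p q where pq: "distinct [i, j, a, b, p, q]" "cross {a, b} {p, q}" "{i, j, a, b, p, q} \<inter> U = {}"
      "insert {c, d} (insert {e, f} \<sigma>) = insert {a, b} (insert {p, q} \<sigma>)"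
      "z1 = insert {i, j} (insert {a, p} (insert {b, q} \<sigma>))" "S = {i, j, a, b, p, q} \<union> U"
    proof (elim disjE conjE)
      assume [simp]: "a = c" "b = d"
      show ?thesis by (rule that[of e f]) (use **(2,3,4,6) S in auto)
    next
      assume [simp]: "a = d" "b = c"
      show ?thesis by (rule that[of f e]) (use **(2,3,4,6) S in \<open>auto simp: insert_commute\<close>)
    next
      assume [simp]: "a = e" "b = f"
      show ?thesis
        by (rule that[of c d]) (use **(2,3,4,6) S in \<open>auto simp: insert_commute cross_sym[of "{e, f}"]\<close>)
    next
      assume [simp]: "a = f" "b = e"
      show ?thesis
        by (rule that[of d c]) (use **(2,3,4,6) S in \<open>auto simp: insert_commute cross_sym[of "{e, f}"]\<close>)
    qed
    have "{p, q} \<noteq> {a, b}" "{a, b} \<notin> \<sigma>" "{p, q} \<notin> \<sigma>"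
      using pq(1,3) perfect_matching_distinct[OF **(1)] by (auto simp: doubleton_eq_iff)
    then have \<rho>: "\<rho> = insert {p, q} \<sigma>"
      using eq ab unfolding pq(4) by (metis insert_ident insert_iff)
    have z': "z' = insert {i, a} (insert {j, b} (insert {p, q} \<sigma>))" unfolding *(4) \<rho> ..
    have d: "distinct [p, q, a, b]" "distinct [p, q, i, a]" "distinct [p, q, j, b]" using pq(1) by auto
    note c = d[THEN cross_pair]
    \<comment> \<open>\<open>{p, q}\<close> separates \<open>a\<close> from \<open>b\<close> but not
      the neighbours \<open>i\<close> and \<open>j\<close>.\<close>
    have "separates p q i = separates p q j"
      using adjacent_separates[OF assms(4), of p q] pq(1,6) by auto
    then have "cross {p, q} {i, a} \<or> cross {p, q} {j, b}"
      using pq(2) cross_sym[of "{a, b}"] c by auto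
    then show ?thesis
    proof
      assume cr: "cross {p, q} {i, a}"
      let ?z = "insert {i, q} (insert {j, b} (insert {a, p} \<sigma>))"
      have "resolution z' ?z"
      proof (rule resolutionI)
        show "perfect_matching (insert j (insert b U)) (insert {j, b} \<sigma>)"
          by (rule perfect_matching_insert[OF **(1)]) (use pq(1,3) in auto)
        show "cross {a, i} {p, q}" using cr cross_sym by (simp add: insert_commute)
        show "distinct [a, i, p, q]" using pq(1) by auto
        show "{a, i, p, q} \<inter> insert j (insert b U) = {}" using pq(1,3) by auto
        show "z' = insert {a, i} (insert {p, q} (insert {j, b} \<sigma>))"
          unfolding z' by (simp add: insert_commute)
        show "?z = insert {a, p} (insert {i, q} (insert {j, b} \<sigma>))"
          by (simp add: insert_commute)
      qed
      moreover have "capped i j ?z z1"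
      proof (rule cappedI)
        show "perfect_matching (insert a (insert p U)) (insert {a, p} \<sigma>)"
          by (rule perfect_matching_insert[OF **(1)]) (use pq(1,3) in auto)
        show "distinct [i, q, j, b]" using pq(1) by auto
        show "{i, q, j, b} \<inter> insert a (insert p U) = {}" using pq(1,3) by auto
        show "z1 = insert {i, j} (insert {q, b} (insert {a, p} \<sigma>))"
          unfolding pq(5) by (simp add: insert_commute)
      qed simp
      ultimately show ?thesis using resolution_imp_le by blast
    next
      assume cr: "cross {p, q} {j, b}"
      let ?z = "insert {i, a} (insert {j, p} (insert {b, q} \<sigma>))"
      have "resolution z' ?z"
      proof (rule resolutionI)
        show "perfect_matching (insert i (insert a U)) (insert {i, a} \<sigma>)"
          by (rule perfect_matching_insert[OF **(1)]) (use pq(1,3) in auto)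
        show "cross {j, b} {p, q}" using cr cross_sym by blast
        show "distinct [j, b, p, q]" using pq(1) by auto
        show "{j, b, p, q} \<inter> insert i (insert a U) = {}" using pq(1,3) by auto
        show "z' = insert {j, b} (insert {p, q} (insert {i, a} \<sigma>))"
          unfolding z' by (simp add: insert_commute)
        show "?z = insert {j, p} (insert {b, q} (insert {i, a} \<sigma>))"
          by (simp add: insert_commute)
      qed
      moreover have "capped i j ?z z1"
      proof (rule cappedI)
        show "perfect_matching (insert b (insert q U)) (insert {b, q} \<sigma>)"
          by (rule perfect_matching_insert[OF **(1)]) (use pq(1,3) in auto)
        show "distinct [i, a, j, p]" using pq(1) by auto
        show "{i, a, j, p} \<inter> insert b (insert q U) = {}" using pq(1,3) by auto
        show "z1 = insert {i, j} (insert {a, p} (insert {b, q} \<sigma>))" by (rule pq(5))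
      qed simp
      ultimately show ?thesis using resolution_imp_le by blast
    qed
  qed
qed

lemma cup_created_capped:
  assumes "resolution z z1" "{i, j} \<notin> z" "{i, j} \<in> z1"
  shows "capped i j z z1"
proof -
  obtain a b c d \<rho> T where *: "perfect_matching T \<rho>" "distinct [a, b, c, d]"
     "{a, b, c, d} \<inter> T = {}" "cross {a, b} {c, d}"
     "z = insert {a, b} (insert {c, d} \<rho>)" "z1 = insert {a, c} (insert {b, d} \<rho>)"
    using assms(1) unfolding resolution_def by blast
  have "{i, j} = {a, c} \<or> {i, j} = {b, d}" using assms(2,3) *(5,6) by auto
  then have "(i = a \<and> j = c \<or> i = c \<and> j = a) \<or> (i = b \<and> j = d \<or> i = d \<and> j = b)"
    by (simp add: doubleton_eq_iff)
  then show ?thesis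
  proof (elim disjE conjE)
    assume "i = a" "j = c"
    then show ?thesis by (intro cappedI[OF *(1), of i b j d]) (use * in auto)
  next
    assume "i = c" "j = a"
    then show ?thesis by (intro cappedI[OF *(1), of i d j b]) (use * in \<open>auto simp: insert_commute\<close>)
  next
    assume "i = b" "j = d"
    then show ?thesis by (intro cappedI[OF *(1), of i a j c]) (use * in \<open>auto simp: insert_commute\<close>)
  next
    assume "i = d" "j = b"
    then show ?thesis by (intro cappedI[OF *(1), of i c j a]) (use * in \<open>auto simp: insert_commute\<close>)
  qed
qed

text \<open>On a chain from \<open>\<tau>\<close> down to \<open>z\<close> the chord
  \<open>{i, j}\<close> appears at some point and then stays. The resolution that creates it is a
  capping, and \<open>capped_lift\<close> follows the later ones.\<close>

lemma cup_le_imp_capped: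
  assumes "uncross_le z \<tau>" "perfect_matching S \<tau>" "adjacent S i j" "{i, j} \<notin> \<tau>" "{i, j} \<in> z"
  shows "\<exists>z'. uncross_le z' \<tau> \<and> capped i j z' z"
  using assms(1,5) unfolding uncross_le_def
proof (induction rule: converse_rtranclp_induct)
  case base
  then show ?case using assms(4) by blast
next
  case (step z1 z)
  have res: "resolution z z1" using step(1) by (simp add: uncross_cover_def)
  have le: "uncross_le z \<tau>" using step(2) by (simp add: uncross_le_def)
  have pm: "perfect_matching S z" using le assms(2) uncross_le_perfect_matching by blast
  show ?case unfolding uncross_le_def[symmetric]
  proof (cases "{i, j} \<in> z")
    case True
    then obtain z' where "uncross_le z' \<tau>" "capped i j z' z" 
      using step.IH unfolding uncross_le_def by blast
    then show "\<exists>z'. uncross_le z' \<tau> \<and> capped i j z' z1"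
      using capped_lift[OF _ res pm assms(3)] uncross_le_trans by blast
  next
    case False
    then show "\<exists>z'. uncross_le z' \<tau> \<and> capped i j z' z1"
      using cup_created_capped[OF res False step.prems] le by blast
  qed
qed

lemma capped_perfect_matching:
  assumes "capped i j z' z" "perfect_matching S z'"
  shows "{i, j} \<notin> z'"
proof -
  obtain a b \<rho> T where *: "perfect_matching T \<rho>" "distinct [i, a, j, b]"
    "z' = insert {i, a} (insert {j, b} \<rho>)"
    using assms(1) unfolding capped_def by blast
  then show ?thesis
    using perfect_matching_partner_unique[OF assms(2), of i a j] by auto
qed

text \<open>Of \<open>z'\<close> and its exchange one is uncrossed and below \<open>\<tau>\<close>,
  and both cap to \<open>z\<close>. By lifting, an uncrossed matching below the crossed
  \<open>\<tau>\<close> is already below the exchange of \<open>\<tau>\<close>.\<close>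

lemma cup_le_crossed:
  assumes "uncross_le z \<tau>" "perfect_matching S \<tau>" "adjacent S i j" "crossed i j \<tau>" "{i, j} \<in> z"
  obtains z' where "uncrossed i j z'" "uncross_le z' (swap i j \<tau>)" "capped i j z' z"
proof -
  obtain z' where z': "uncross_le z' \<tau>" "capped i j z' z"
    using cup_le_imp_capped[OF assms(1-3) crossed_not_cup[OF assms(2,4)] assms(5)] by blast
  have pm: "perfect_matching S z'" using z'(1) assms(2) uncross_le_perfect_matching by blast
  show ?thesis
  proof (cases "crossed i j z'")
    case True
    have "uncrossed i j (swap i j z')" by (rule crossed_imp_uncrossed_swap[OF pm assms(3) True])
    moreover have "uncross_le (swap i j z') \<tau>"
      using uncross_le_swap_crossed[OF pm assms(3) True] z'(1) uncross_le_trans by blast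
    ultimately show ?thesis
      using that uncrossed_le_swap[OF _ assms(2,3) _ assms(4)] capped_swap[OF z'(2)] by blast
  next
    case False
    then have "uncrossed i j z'" using capped_perfect_matching[OF z'(2) pm] by (simp add: uncrossed_def)
    then show ?thesis using that uncrossed_le_swap[OF z'(1) assms(2,3) _ assms(4)] z'(2) by blast
  qed
qed

lemma crossedI:
  assumes "{i, a} \<in> \<tau>" "{j, b} \<in> \<tau>" "cross {i, a} {j, b}"
  shows "crossed i j \<tau>"
  using assms unfolding crossed_def by blast

lemma in_swap_iff: "e \<in> swap i j \<tau> \<longleftrightarrow> Transposition.transpose i j ` e \<in> \<tau>"
proof
  assume "e \<in> swap i j \<tau>"
  then show "Transposition.transpose i j ` e \<in> \<tau>" by (auto simp: swap_def image_image)
next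
  assume "Transposition.transpose i j ` e \<in> \<tau>"
  then have "Transposition.transpose i j ` Transposition.transpose i j ` e \<in> swap i j \<tau>"
    unfolding swap_def by blast
  then show "e \<in> swap i j \<tau>" by (simp add: image_image)
qed

text \<open>Induction on the number of points inside the arc: moving the end \<open>q\<close> past its neighbour \<open>s\<close>
  removes one of the crossings with \<open>{p, q}\<close>.\<close>

lemma max_cup_below:
  assumes "perfect_matching S \<tau>" "{p, q} \<in> \<tau>" "p < q"
    "r \<in> S" "p < r" "r < q" "adjacent S p r"
    "\<And>x. x \<in> S \<Longrightarrow> p < x \<Longrightarrow> x < q \<Longrightarrow> \<exists>b. {x, b} \<in> \<tau> \<and> (b < p \<or> q < b)"
  shows "\<exists>v. {p, r} \<in> v \<and> uncross_le v \<tau> \<and> (\<forall>z. {p, r} \<in> z \<and> uncross_le z \<tau> \<longrightarrow> uncross_le z v)"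
  using assms
proof (induction "card {x\<in>S. p < x \<and> x < q}" arbitrary: q \<tau> rule: less_induct)
  case less
  note pm = less.prems(1) and pq = less.prems(2,3) and r = less.prems(4,5,6)
    and adj_pr = less.prems(7) and out = less.prems(8)
  have S: "p \<in> S" "q \<in> S" using perfect_matching_distinct[OF pm pq(1)] by auto
  define I where "I = {x\<in>S. p < x \<and> x < q}"
  have finI: "finite I" using perfect_matching_finite(1)[OF pm] by (simp add: I_def)
  have rI: "r \<in> I" using r by (simp add: I_def)
  \<comment> \<open>The last point inside the arc, hence the neighbour of \<open>q\<close>.\<close>
  define s where "s = Max I"
  have "s \<in> I" unfolding s_def using finI rI by (intro Max_in) auto
  then have s: "s \<in> S" "p < s" "s < q" by (auto simp: I_def)
  have s_max: "x \<le> s" if "x \<in> S" "p < x" "x < q" for x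
    unfolding s_def using finI that by (intro Max_ge) (auto simp: I_def)
  have adj_sq: "adjacent S s q"
    using s S s_max unfolding adjacent_def by fastforce
  obtain c where c: "{s, c} \<in> \<tau>" "c < p \<or> q < c" using out[OF s] by blast
  have cS: "c \<in> S" using perfect_matching_distinct[OF pm c(1)] by auto
  have qp: "{q, p} \<in> \<tau>" using pq by (simp add: insert_commute)
  have "distinct [s, c, q, p]" using c(2) s by auto
  then have "cross {s, c} {q, p}" using cross_pair c(2) s by (auto simp: separates_def)
  then have cr: "crossed s q \<tau>" by (rule crossedI[OF c(1) qp])
  define w where "w = swap s q \<tau>"
  have pmw: "perfect_matching S w" unfolding w_def using perfect_matching_swap pm s S by blast
  have le_w: "uncross_le w \<tau>" unfolding w_def by (rule uncross_le_swap_crossed[OF pm adj_sq cr])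
  have rs: "r \<le> s" using s_max r by blast
  have z_uncrossed: "uncross_le z w" if "uncross_le z \<tau>" "uncrossed s q z" for z
    unfolding w_def by (rule uncrossed_le_swap[OF that(1) pm adj_sq that(2) cr])
  show ?case
  proof (cases "r = s")
    case True
    \<comment> \<open>With \<open>r = s\<close> the exchange turns \<open>{p, q}\<close> into
      \<open>{p, r}\<close>, and \<open>w\<close> itself is the maximum: a matching containing
      \<open>{p, r}\<close> cannot be crossed at \<open>s, q\<close>, as nothing crosses
      \<open>{p, r}\<close>.\<close>
    have "{p, r} \<in> w"
      unfolding w_def in_swap_iff using True pq s by simp
    moreover have "uncross_le z w" if z: "{p, r} \<in> z" "uncross_le z \<tau>" for z
    proof (rule z_uncrossed[OF z(2)])
      have pmz: "perfect_matching S z" using z(2) pm uncross_le_perfect_matching by blast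
      have rp: "{r, p} \<in> z" using z by (simp add: insert_commute)
      have "{s, q} \<notin> z"
        using perfect_matching_partner_unique[OF pmz rp, of q] True pq(2) by auto
      moreover have "\<not> crossed s q z"
      proof
        assume "crossed s q z"
        then obtain a b where ab: "{s, a} \<in> z" "{q, b} \<in> z" "cross {s, a} {q, b}"
          unfolding crossed_def by blast
        have "a = p" using perfect_matching_partner_unique[OF pmz rp] ab(1) True by blast
        then have c2: "cross {p, r} {q, b}" using ab(3) True by (simp add: insert_commute)
        have neq: "{q, b} \<noteq> {p, r}" using c2 by auto
        have b: "b \<in> S" "b \<noteq> q" using perfect_matching_distinct[OF pmz ab(2)] by auto
        have "b \<notin> {p, r}" using perfect_matching_disjoint[OF pmz ab(2) z(1), of b] neq by auto
        then have "distinct [p, r, q, b]" using b r pq(2) by auto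
        then show False using adjacent_not_cross[OF adj_pr S(2) b(1)] c2 by blast
      qed
      ultimately show "uncrossed s q z" by (simp add: uncrossed_def)
    qed
    ultimately show ?thesis using le_w by blast
  next
    case False
    then have r_s: "r < s" using rs by simp
    have keep: "{p, r} \<in> swap s q x \<longleftrightarrow> {p, r} \<in> x" for x
      unfolding in_swap_iff using r r_s s by simp
    have ps_w: "{p, s} \<in> w" unfolding w_def in_swap_iff using s pq by simp
    have out_w: "\<exists>b. {x, b} \<in> w \<and> (b < p \<or> q < b)" if x: "x \<in> S" "p < x" "x < s" for x
    proof -
      obtain b where b: "{x, b} \<in> \<tau>" "b < p \<or> q < b" using out[OF x(1,2)] x(3) s(3) by auto
      then have "Transposition.transpose s q x = x" "Transposition.transpose s q b = b"
        using x s by auto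
      then have "{x, b} \<in> w" unfolding w_def in_swap_iff using b by simp
      then show ?thesis using b by blast
    qed
    have "\<exists>v. {p, r} \<in> v \<and> uncross_le v w \<and> (\<forall>z. {p, r} \<in> z \<and> uncross_le z w \<longrightarrow> uncross_le z v)"
    proof (rule less.hyps[OF _ pmw ps_w s(2) r(1,2) r_s adj_pr])
      have "{x\<in>S. p < x \<and> x < s} \<subset> I" using s by (auto simp: I_def)
      then show "card {x\<in>S. p < x \<and> x < s} < card {x\<in>S. p < x \<and> x < q}"
        using finI unfolding I_def by (intro psubset_card_mono)
      show "\<And>x. x \<in> S \<Longrightarrow> p < x \<Longrightarrow> x < s \<Longrightarrow> \<exists>b. {x, b} \<in> w \<and> (b < p \<or> s < b)"
        using out_w s(3) by (meson less_trans)
    qed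
    then obtain v' where v': "{p, r} \<in> v'" "uncross_le v' w"
      and v'_max: "\<And>z. {p, r} \<in> z \<Longrightarrow> uncross_le z w \<Longrightarrow> uncross_le z v'" by blast
    have v'_le: "uncross_le v' \<tau>" using v'(2) le_w uncross_le_trans by blast
    have pmv': "perfect_matching S v'" using v'_le pm uncross_le_perfect_matching by blast
    \<comment> \<open>The maximum below \<open>w\<close> dominates only what lies below
      \<open>w\<close>. If exchanging \<open>s\<close> and \<open>q\<close> raises it, the result is
      still below \<open>\<tau>\<close> and also dominates the matchings that are crossed at
      \<open>s, q\<close>.\<close>
    define v where "v = (if uncrossed s q v' then swap s q v' else v')"
    have v: "{p, r} \<in> v" using v' keep by (simp add: v_def)
    have v_le: "uncross_le v \<tau>"
      unfolding v_def using v'_le swap_uncrossed_le[OF v'_le pm adj_sq _ cr] by simp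
    have v'_v: "uncross_le v' v"
      unfolding v_def using uncross_le_swap_uncrossed[OF pmv' adj_sq] by simp
    have swap_v: "uncross_le (swap s q x) v" if x: "{p, r} \<in> x" "uncrossed s q x" "uncross_le x w" for x
    proof -
      have le: "uncross_le x v'" by (rule v'_max[OF x(1,3)])
      have "perfect_matching S x" using x(3) pmw uncross_le_perfect_matching by blast
      then have "{s, q} \<notin> v'" using cup_le[OF le pmv' adj_sq] x(2) by (auto simp: uncrossed_def)
      then show ?thesis
        using swap_mono[OF le pmv' adj_sq x(2)] swap_uncrossed_le[OF le pmv' adj_sq x(2)]
        unfolding v_def by (auto simp: uncrossed_def)
    qed
    have "uncross_le z v" if z: "{p, r} \<in> z" "uncross_le z \<tau>" for z
    proof -
      have pmz: "perfect_matching S z" using z(2) pm uncross_le_perfect_matching by blast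
      consider "uncrossed s q z" | "crossed s q z" | "{s, q} \<in> z"
        by (auto simp: uncrossed_def)
      then show ?thesis
      proof cases
        case 1
        then show ?thesis using v'_max[OF z(1) z_uncrossed[OF z(2)]] v'_v uncross_le_trans by blast
      next
        case 2
        have un: "uncrossed s q (swap s q z)" by (rule crossed_imp_uncrossed_swap[OF pmz adj_sq 2])
        have "uncross_le (swap s q z) \<tau>"
          using uncross_le_swap_crossed[OF pmz adj_sq 2] z(2) uncross_le_trans by blast
        then have "uncross_le (swap s q z) w" using z_uncrossed un by blast
        then show ?thesis using swap_v[of "swap s q z"] un z(1) keep by simp
      next
        case 3
        \<comment> \<open>The exchange of \<open>s\<close> and \<open>q\<close> does not move
          \<open>z\<close>, which contains \<open>{s, q}\<close>; instead \<open>z\<close> is the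
          capping of an uncrossed matching below \<open>w\<close>.\<close>
        obtain z' where z': "uncrossed s q z'" "uncross_le z' w" "capped s q z' z"
          using cup_le_crossed[OF z(2) pm adj_sq cr 3] unfolding w_def by blast
        have pmz': "perfect_matching S z'" using z'(2) pmw uncross_le_perfect_matching by blast
        show ?thesis
        proof (cases "{p, r} \<in> z'")
          case True
          have "perfect_matching S (swap s q z')" using perfect_matching_swap pmz' s S by blast
          then have "uncross_le z (swap s q z')"
            using capped_le_crossed[OF capped_swap[OF z'(3)]] uncrossed_imp_crossed_swap[OF pmz' adj_sq z'(1)]
            by blast
          then show ?thesis using swap_v[OF True z'(1,2)] uncross_le_trans by blast
        next
          case False
          obtain a b \<rho> T where *: "perfect_matching T \<rho>" "distinct [s, a, q, b]" "{s, a, q, b} \<inter> T = {}"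
            "z' = insert {s, a} (insert {q, b} \<rho>)" "z = insert {s, q} (insert {a, b} \<rho>)"
            using z'(3) unfolding capped_def by blast
          \<comment> \<open>The chord \<open>{p, r}\<close> has only been produced by capping at
            \<open>s, q\<close>, so in \<open>z'\<close> the points \<open>p\<close> and
            \<open>r\<close> are the partners of \<open>s\<close> and \<open>q\<close>, in one order
            or the other.\<close>
          have "{p, r} \<noteq> {s, q}" using r_s s by (auto simp: doubleton_eq_iff)
          moreover have "{p, r} \<notin> \<rho>" using False *(4) by blast
          ultimately have "{p, r} = {a, b}" using z(1) *(5) by blast
          then have "a = p \<and> b = r \<or> a = r \<and> b = p" by (auto simp: doubleton_eq_iff)
          then show ?thesis
          proof
            assume [simp]: "a = p \<and> b = r"
            have "cross {s, p} {q, r}"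
              using cross_pair[of s p q r] r r_s s by (auto simp: separates_def)
            then have "crossed s q z'" using *(4) unfolding crossed_def by auto
            then show ?thesis using z'(1) by (simp add: uncrossed_def)
          next
            assume ab: "a = r \<and> b = p"
            then have z'_eq: "z' = insert {p, q} (insert {r, s} \<rho>)"
              using *(4) by (simp add: insert_commute)
            have T: "{p, q} \<inter> T = {}" "{r, s} \<inter> T = {}" "{p, r} \<inter> T = {}" using *(3) ab by auto
            \<comment> \<open>Since \<open>p < r < s < q\<close>, the chords \<open>{p, q}\<close>
              and \<open>{r, s}\<close> are nested. Exchanging \<open>p\<close> and \<open>r\<close>
              makes them cross without leaving the ideal of \<open>w\<close>, and resolving that
              crossing gives \<open>z\<close>.\<close>
            have "\<not> crossed p r z'"
            proof
              assume "crossed p r z'"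
              then obtain u v where uv: "{p, u} \<in> z'" "{r, v} \<in> z'" "cross {p, u} {r, v}"
                unfolding crossed_def by blast
              have "u = q" using perfect_matching_partner_unique[OF pmz' uv(1), of q] z'_eq by blast
              moreover have "v = s" using perfect_matching_partner_unique[OF pmz' uv(2), of s] z'_eq by blast
              ultimately show False
                using uv(3) cross_pair[of p q r s] r r_s s by (auto simp: separates_def)
            qed
            then have un: "uncrossed p r z'" using False by (simp add: uncrossed_def)
            obtain br where br: "{r, br} \<in> w" "br < p \<or> q < br" using out_w[OF r(1,2) r_s] by blast
            have "distinct [p, s, r, br]" using br(2) r r_s s by auto
            then have "cross {p, s} {r, br}"
              using cross_pair br(2) r r_s s by (auto simp: separates_def)
            then have cr_w: "crossed p r w" by (rule crossedI[OF ps_w br(1)])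
            have le1: "uncross_le (swap p r z') w"
              by (rule swap_uncrossed_le[OF z'(2) pmw adj_pr un cr_w])
            have "swap p r z' = insert {r, q} (insert {p, s} \<rho>)"
              unfolding z'_eq using T(3) swap_pairs[OF *(1), of p r q s] r r_s s pq by auto
            then have eq: "swap p r z' = insert {p, s} (insert {r, q} \<rho>)" by (simp add: insert_commute)
            have "resolution (swap p r z') z"
            proof (rule resolutionI[OF *(1) _ _ _ eq])
              show "distinct [p, s, r, q]" using r r_s s by auto
              show "{p, s, r, q} \<inter> T = {}" using T by auto
              show "cross {p, s} {r, q}"
                using cross_pair[of p s r q] r r_s s by (auto simp: separates_def)
              show "z = insert {p, r} (insert {s, q} \<rho>)"
                unfolding *(5) using ab by (simp add: insert_commute)
            qed
            then have "uncross_le z w" using le1 resolution_imp_le uncross_le_trans by blast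
            then show ?thesis using v'_max[OF z(1)] v'_v uncross_le_trans by blast
          qed
        qed
      qed
    qed
    then show ?thesis using v v_le by blast
  qed
qed

section \<open>Ideals below a matching that joins two neighbours\<close>

lemma uncross_cover_insert:
  assumes "uncross_cover z1 z" "perfect_matching (S - {p, q}) z" "adjacent S p q"
  shows "uncross_le (insert {p, q} z1) (insert {p, q} z)"
proof -
  obtain a b c d \<rho> T where *: "perfect_matching T \<rho>" "distinct [a, b, c, d]"
     "{a, b, c, d} \<inter> T = {}" "cross {a, b} {c, d}"
     "z = insert {a, b} (insert {c, d} \<rho>)" "z1 = insert {a, c} (insert {b, d} \<rho>)"
    using assms(1) unfolding uncross_cover_def resolution_def by blast
  have S: "S - {p, q} = {a, b, c, d} \<union> T"
    unfolding perfect_matching_Union[OF assms(2), symmetric] perfect_matching_Union[OF *(1), symmetric] *(5)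
    by (simp add: insert_commute)
  have "resolution (insert {p, q} z) (insert {p, q} z1)"
  proof (rule resolutionI[OF _ *(2) _ *(4)])
    show "perfect_matching (insert p (insert q T)) (insert {p, q} \<rho>)"
      using S adjacentD[OF assms(3)] by (intro perfect_matching_insert[OF *(1)]) auto
    show "{a, b, c, d} \<inter> insert p (insert q T) = {}" using S *(3) by auto
    show "insert {p, q} z = insert {a, b} (insert {c, d} (insert {p, q} \<rho>))"
      unfolding *(5) by (simp add: insert_commute)
    show "insert {p, q} z1 = insert {a, c} (insert {b, d} (insert {p, q} \<rho>))"
      unfolding *(6) by (simp add: insert_commute)
  qed
  then show ?thesis by (rule resolution_imp_le)
qed

lemma uncross_le_insert:
  assumes "uncross_le z1 z" "perfect_matching (S - {p, q}) z" "adjacent S p q"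
  shows "uncross_le (insert {p, q} z1) (insert {p, q} z)"
  using assms(1) unfolding uncross_le_def
proof (induction rule: converse_rtranclp_induct)
  case (step z1 z2)
  then have "perfect_matching (S - {p, q}) z2"
    using assms(2) uncross_le_perfect_matching unfolding uncross_le_def by blast
  then have "uncross_le (insert {p, q} z1) (insert {p, q} z2)"
    by (rule uncross_cover_insert[OF step(1) _ assms(3)])
  then show ?case using step.IH unfolding uncross_le_def by (rule rtranclp_trans)
qed simp

lemma uncross_le_remove:
  assumes "uncross_le z1 z" "perfect_matching S z" "adjacent S p q" "{p, q} \<in> z"
  shows "uncross_le (z1 - {{p, q}}) (z - {{p, q}})"
  using assms(1) unfolding uncross_le_def
proof (induction rule: converse_rtranclp_induct)
  case (step z1 z2)
  have le: "uncross_le z2 z" using step(2) by (simp add: uncross_le_def)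
  have pm: "perfect_matching S z2" using le assms(2) uncross_le_perfect_matching by blast
  have cup: "{p, q} \<in> z2" by (rule cup_le[OF le assms(2-4)])
  have res: "resolution z2 z1" using step(1) by (simp add: uncross_cover_def)
  obtain a b c d \<sigma> T where *: "perfect_matching T \<sigma>" "distinct [p, q, a, b, c, d]"
    "{p, q, a, b, c, d} \<inter> T = {}" "cross {a, b} {c, d}"
    "z2 = insert {p, q} (insert {a, b} (insert {c, d} \<sigma>))"
    "z1 = insert {p, q} (insert {a, c} (insert {b, d} \<sigma>))"
    by (rule cup_resolution_cases[OF res pm assms(3) cup])
  have notin: "{p, q} \<notin> \<sigma>" using perfect_matching_distinct[OF *(1)] *(3) by auto
  have "{p, q} \<noteq> {a, b}" "{p, q} \<noteq> {c, d}" "{p, q} \<noteq> {a, c}" "{p, q} \<noteq> {b, d}"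
    using *(2) by (auto simp: doubleton_eq_iff)
  then have "z2 - {{p, q}} = insert {a, b} (insert {c, d} \<sigma>)" "z1 - {{p, q}} = insert {a, c} (insert {b, d} \<sigma>)"
    unfolding *(5,6) using notin by simp_all
  then have "resolution (z2 - {{p, q}}) (z1 - {{p, q}})"
    using *(2,3,4) by (intro resolutionI[OF *(1), of a b c d]) auto
  then have "uncross_le (z1 - {{p, q}}) (z2 - {{p, q}})" by (rule resolution_imp_le)
  then show ?case using step.IH unfolding uncross_le_def by (rule rtranclp_trans)
qed simp

lemma cross_count_insert_cup:
  assumes "perfect_matching (S - {p, q}) z" "adjacent S p q"
  shows "cross_count (insert {p, q} z) = cross_count z"
proof -
  have "\<not> cross g {p, q}" if g: "g \<in> z" for g
  proof -
    obtain x y where xy: "g = {x, y}" "x < y" by (rule perfect_matching_pair[OF assms(1) g])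
    then have "x \<in> S - {p, q}" "y \<in> S - {p, q}"
      using perfect_matching_distinct[OF assms(1)] g by blast+
    then have "\<not> cross {p, q} {x, y}"
      using xy adjacentD[OF assms(2)] by (intro adjacent_not_cross[OF assms(2)]) auto
    then show ?thesis using cross_sym xy by blast
  qed
  moreover have "{p, q} \<notin> z" using perfect_matching_distinct[OF assms(1)] by blast
  ultimately show ?thesis
    using perfect_matching_finite(2)[OF assms(1)] by (simp add: cross_count_insert)
qed

text \<open>All matchings below \<open>v\<close> contain \<open>{p, q}\<close>. Deleting this chord
  identifies the ideal with one on two points fewer and keeps the crossing counts, since the chord
  crosses nothing.\<close>

lemma sign_sum_remove_cup:
  assumes "perfect_matching S v" "adjacent S p q" "{p, q} \<in> v"
  shows "sign_sum {z. uncross_le z v} = sign_sum {z. uncross_le z (v - {{p, q}})}"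
  unfolding sign_sum_def
proof (rule sum.reindex_bij_witness[of _ "insert {p, q}" "\<lambda>z. z - {{p, q}}"])
  have pmv: "perfect_matching (S - {p, q}) (v - {{p, q}})"
    by (rule perfect_matching_remove[OF assms(1,3)])
  {
    fix z assume "z \<in> {z. uncross_le z v}"
    then have le: "uncross_le z v" by simp
    have cup: "{p, q} \<in> z" by (rule cup_le[OF le assms])
    then show ins: "insert {p, q} (z - {{p, q}}) = z" by (rule insert_Diff)
    show "z - {{p, q}} \<in> {z. uncross_le z (v - {{p, q}})}"
      using uncross_le_remove[OF le assms] by simp
    have "perfect_matching S z" using le assms(1) uncross_le_perfect_matching by blast
    then have "perfect_matching (S - {p, q}) (z - {{p, q}})"
      using cup by (rule perfect_matching_remove)
    from cross_count_insert_cup[OF this assms(2)]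
    show "(-1) ^ cross_count (z - {{p, q}}) = (-1 :: int) ^ cross_count z" unfolding ins by simp
  next
    fix z assume "z \<in> {z. uncross_le z (v - {{p, q}})}"
    then have le: "uncross_le z (v - {{p, q}})" by simp
    have "perfect_matching (S - {p, q}) z" using le pmv uncross_le_perfect_matching by blast
    then have "{p, q} \<notin> z" using perfect_matching_distinct by blast
    then show "insert {p, q} z - {{p, q}} = z" by simp
    show "insert {p, q} z \<in> {z. uncross_le z v}"
      using uncross_le_insert[OF le pmv assms(2)] insert_Diff[OF assms(3)] by simp
  }
qed

text \<open>On the matchings without \<open>{i, j}\<close> the exchange reverses the sign and,
  \<open>\<tau>\<close> being crossed, never leaves the ideal; so they cancel.\<close>

lemma sign_sum_below_crossed:
  assumes "perfect_matching S \<tau>" "adjacent S i j" "crossed i j \<tau>"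
  shows "sign_sum {z. uncross_le z \<tau>} = sign_sum {z. {i, j} \<in> z \<and> uncross_le z \<tau>}"
proof -
  let ?Z = "{z. uncross_le z \<tau>}" and ?N = "{z. {i, j} \<notin> z \<and> uncross_le z \<tau>}"
  let ?C = "{z. {i, j} \<in> z \<and> uncross_le z \<tau>}"
  have pm: "perfect_matching S z" if "uncross_le z \<tau>" for z
    using that assms(1) uncross_le_perfect_matching by blast
  have fin: "finite ?Z"
    by (rule finite_subset[OF _ finite_perfect_matchings[of S]]) (use pm in blast)
  have "sign_sum ?N = 0"
  proof (rule sign_sum_swap_closed[OF assms(2)])
    fix z assume "z \<in> ?N"
    then have z: "{i, j} \<notin> z" "uncross_le z \<tau>" by auto
    then show "perfect_matching S z" using pm by blast
    show "{i, j} \<notin> z" by (rule z(1))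
    have "{i, j} \<notin> swap i j z" using crossed_swap(2)[OF pm[OF z(2)] assms(2) z(1)] .
    moreover have "uncross_le (swap i j z) \<tau>"
    proof (cases "crossed i j z")
      case True
      then show ?thesis
        using uncross_le_swap_crossed[OF pm[OF z(2)] assms(2)] z(2) uncross_le_trans by blast
    next
      case False
      then have "uncrossed i j z" using z(1) by (simp add: uncrossed_def)
      then show ?thesis by (rule swap_uncrossed_le[OF z(2) assms(1,2) _ assms(3)])
    qed
    ultimately show "swap i j z \<in> ?N" by simp
  qed
  moreover have "sign_sum ?Z = sign_sum ?C + sign_sum ?N"
  proof -
    have "finite ?C" "finite ?N" by (rule finite_subset[OF _ fin]; blast)+
    moreover have "?C \<inter> ?N = {}" "?Z = ?C \<union> ?N" by blast+
    ultimately show ?thesis unfolding sign_sum_def by (simp only: sum.union_disjoint)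
  qed
  ultimately show ?thesis by simp
qed

text \<open>A chord of minimal length \<open>q - p\<close> will do: a chord with both ends strictly
  inside would be shorter.\<close>

lemma innermost_chord:
  assumes "perfect_matching S \<tau>" "\<tau> \<noteq> {}"
  obtains p q where "{p, q} \<in> \<tau>" "p < q"
    "\<And>x. x \<in> S \<Longrightarrow> p < x \<Longrightarrow> x < q \<Longrightarrow> \<exists>b. {x, b} \<in> \<tau> \<and> (b < p \<or> q < b)"
proof -
  let ?P = "\<lambda>(p, q). {p, q} \<in> \<tau> \<and> p < (q :: nat)"
  obtain e where e: "e \<in> \<tau>" using assms(2) by blast
  obtain a b where "e = {a, b}" "a < b" by (rule perfect_matching_pair[OF assms(1) e])
  then have "?P (a, b)" using e by simp
  then obtain pq where pq: "?P pq" "\<And>y. ?P y \<Longrightarrow> snd pq - fst pq \<le> snd y - fst y"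
    using ex_has_least_nat[of ?P "(a, b)" "\<lambda>y. snd y - fst y"] by blast
  obtain p q where [simp]: "pq = (p, q)" by (cases pq)
  have chord: "{p, q} \<in> \<tau>" "p < q" using pq(1) by auto
  show ?thesis
  proof (rule that[OF chord])
    fix x assume x: "x \<in> S" "p < x" "x < q"
    obtain b where b: "{x, b} \<in> \<tau>" "b \<noteq> x" using perfect_matching_partner[OF assms(1) x(1)] .
    have "b \<noteq> p" "b \<noteq> q"
      using perfect_matching_disjoint[OF assms(1) b(1) chord(1), of b] x by (auto simp: doubleton_eq_iff)
    moreover have "\<not> (p < b \<and> b < q)"
    proof
      assume "p < b \<and> b < q"
      then show False
        using pq(2)[of "(x, b)"] pq(2)[of "(b, x)"] b x
        by (cases "x < b") (auto simp: insert_commute)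
    qed
    ultimately show "\<exists>b. {x, b} \<in> \<tau> \<and> (b < p \<or> q < b)" using b(1) by (meson linorder_neqE_nat)
  qed
qed

text \<open>Induction on the number of points. Next to the left end \<open>p\<close> of an innermost
  chord lies either its right end, so that the chord can be deleted, or a point \<open>r\<close>
  whose chord leaves the arc, so that \<open>\<tau>\<close> is crossed at \<open>p, r\<close>. In
  the latter case only matchings with \<open>{p, r}\<close> survive; they form the ideal of a single
  matching \<open>v\<close>, from which \<open>{p, r}\<close> can be deleted.\<close>

lemma sign_sum_below:
  assumes "perfect_matching S \<tau>"
  shows "sign_sum {z. uncross_le z \<tau>} = 1"
  using assms
proof (induction "card S" arbitrary: S \<tau> rule: less_induct)
  case less
  note pm = less.prems
  have cup: "sign_sum {z. uncross_le z v} = 1"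
    if v: "perfect_matching S v" "adjacent S p q" "{p, q} \<in> v" for v p q
  proof -
    have "S - {p, q} \<subset> S" using adjacentD[OF v(2)] by blast
    then have "card (S - {p, q}) < card S"
      using perfect_matching_finite(1)[OF pm] by (rule psubset_card_mono[rotated])
    from less.hyps[OF this perfect_matching_remove[OF v(1,3)]]
    show ?thesis using sign_sum_remove_cup[OF v] by simp
  qed
  show ?case
  proof (cases "\<tau> = {}")
    case True
    then have "S = {}" using perfect_matching_Union[OF pm] by simp
    then have "z = {}" if "uncross_le z \<tau>" for z
      using uncross_le_perfect_matching[OF that, of S] pm by simp
    then have "{z. uncross_le z \<tau>} = {{}}" using True by auto
    then show ?thesis by (simp add: sign_sum_def cross_count_def)
  next
    case False
    obtain p q where pq: "{p, q} \<in> \<tau>" "p < q"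
      and out: "\<And>x. x \<in> S \<Longrightarrow> p < x \<Longrightarrow> x < q \<Longrightarrow> \<exists>b. {x, b} \<in> \<tau> \<and> (b < p \<or> q < b)"
      using innermost_chord[OF pm False] by metis
    have S: "p \<in> S" "q \<in> S" using perfect_matching_distinct[OF pm pq(1)] by auto
    define I where "I = {x\<in>S. p < x \<and> x < q}"
    have finI: "finite I" using perfect_matching_finite(1)[OF pm] by (simp add: I_def)
    show ?thesis
    proof (cases "I = {}")
      case True
      then have "adjacent S p q" using S pq by (auto simp: I_def adjacent_def)
      then show ?thesis using cup pm pq by blast
    next
      case False
      define r where "r = Min I"
      have "r \<in> I" unfolding r_def using finI False by (intro Min_in)
      then have r: "r \<in> S" "p < r" "r < q" by (auto simp: I_def)
      have r_min: "r \<le> x" if "x \<in> S" "p < x" "x < q" for x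
        unfolding r_def using finI that by (intro Min_le) (auto simp: I_def)
      have adj: "adjacent S p r"
        unfolding adjacent_def using r S r_min by fastforce
      obtain b where b: "{r, b} \<in> \<tau>" "b < p \<or> q < b" using out r by blast
      have "distinct [p, q, r, b]" using r b(2) by auto
      then have "cross {p, q} {r, b}" using cross_pair r b(2) by (auto simp: separates_def)
      then have cr: "crossed p r \<tau>" by (rule crossedI[OF pq(1) b(1)])
      obtain v where v: "{p, r} \<in> v" "uncross_le v \<tau>"
        and v_max: "\<And>z. {p, r} \<in> z \<Longrightarrow> uncross_le z \<tau> \<Longrightarrow> uncross_le z v"
        using max_cup_below[OF pm pq r adj out] by blast
      have pmv: "perfect_matching S v" using v(2) pm uncross_le_perfect_matching by blast
      have "{p, r} \<in> z" if "uncross_le z v" for z by (rule cup_le[OF that pmv adj v(1)])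
      then have "{z. {p, r} \<in> z \<and> uncross_le z \<tau>} = {z. uncross_le z v}"
        using v_max v(2) uncross_le_trans by blast
      then show ?thesis
        using sign_sum_below_crossed[OF pm adj cr] cup[OF pmv adj v(1)] by simp
    qed
  qed
qed

section \<open>Paths with interlaced ends\<close>

text \<open>Weaker than \<open>strand\<close>: self-intersections are allowed and the direction is
  open, which suits paths glued from pieces.\<close>

definition disk_path :: "complex \<Rightarrow> complex \<Rightarrow> (real \<Rightarrow> complex) \<Rightarrow> bool" where
  "disk_path x y g \<longleftrightarrow> path g \<and> {pathstart g, pathfinish g} = {x, y} \<and> path_image g - {x, y} \<subseteq> ball 0 1"

lemma disk_path_commute: "disk_path x y g \<longleftrightarrow> disk_path y x g"
  by (simp add: disk_path_def insert_commute)

lemma disk_path_oriented: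
  assumes "disk_path x y g"
  obtains g' where "path g'" "pathstart g' = x" "pathfinish g' = y" "path_image g' = path_image g"
proof (cases "pathstart g = x")
  case True
  then have "pathfinish g = y" using assms by (auto simp: disk_path_def doubleton_eq_iff)
  then show ?thesis using that[of g] True assms by (simp add: disk_path_def)
next
  case False
  then have "pathstart g = y" "pathfinish g = x" using assms by (auto simp: disk_path_def doubleton_eq_iff)
  then show ?thesis using that[of "reversepath g"] assms by (simp add: disk_path_def)
qed

text \<open>The Cayley transform carries the disk to the half plane, where \<open>fashoda_interlace\<close> applies.\<close>

definition cayley :: "complex \<Rightarrow> complex" where
  "cayley z = \<i> * (1 - z) / (1 + z)"

lemma cayley_inject:
  assumes "cayley z = cayley w" "z \<noteq> -1" "w \<noteq> -1"
  shows "z = w"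
proof -
  have "1 + z \<noteq> 0" "1 + w \<noteq> 0" using assms(2,3) by (metis add.right_neutral add_diff_cancel_left' diff_minus_eq_add minus_diff_eq neg_eq_iff_add_eq_0)+
  then have "\<i> * (1 - z) * (1 + w) = \<i> * (1 - w) * (1 + z)"
    using assms(1) by (simp add: cayley_def frac_eq_eq)
  then have "(1 - z) * (1 + w) = (1 - w) * (1 + z)" by (simp add: mult.assoc)
  then have "2 * z = 2 * w" by (simp add: algebra_simps)
  then show ?thesis by simp
qed

lemma Im_cayley_nonneg:
  assumes "norm z \<le> 1"
  shows "Im (cayley z) \<ge> 0"
proof -
  have "(Re z)\<^sup>2 + (Im z)\<^sup>2 \<le> 1"
    using assms by (simp add: cmod_def)
  then have "(1 - Re z) * (1 + Re z) + - Im z * Im z \<ge> 0"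
    by (simp add: algebra_simps power2_eq_square)
  then show ?thesis by (simp add: cayley_def Im_divide Re_divide field_simps sum_power2_ge_zero)
qed

text \<open>Half angles: \<open>cis (\<phi> / 2)\<close> factors out of
  \<open>1 - cis \<phi>\<close> and \<open>1 + cis \<phi>\<close> and leaves a sine and a cosine. As
  the tangent is monotone, boundary points are arranged on the real axis in the order of their
  angles.\<close>

lemma cayley_cis:
  assumes "\<bar>\<phi>\<bar> < pi"
  shows "cayley (cis \<phi>) = of_real (tan (\<phi> / 2))"
proof -
  have "cos (\<phi> / 2) > 0" using assms by (intro cos_gt_zero_pi) auto
  then have c: "cos (\<phi> / 2) \<noteq> 0" by simp
  have e: "cis \<phi> = cis (\<phi> / 2) * cis (\<phi> / 2)" by (simp add: cis_mult)
  have n: "cis (\<phi> / 2) * cis (- (\<phi> / 2)) = 1" by (simp add: cis_mult)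
  have s: "cis (- (\<phi> / 2)) - cis (\<phi> / 2) = -2 * \<i> * sin (\<phi> / 2)"
    "cis (- (\<phi> / 2)) + cis (\<phi> / 2) = 2 * cos (\<phi> / 2)"
    by (simp_all add: complex_eq_iff)
  have "1 - cis \<phi> = cis (\<phi> / 2) * (cis (- (\<phi> / 2)) - cis (\<phi> / 2))"
    "1 + cis \<phi> = cis (\<phi> / 2) * (cis (- (\<phi> / 2)) + cis (\<phi> / 2))"
    using n by (simp_all only: e right_diff_distrib distrib_left)
  then have "cayley (cis \<phi>) = \<i> * (-2 * \<i> * sin (\<phi> / 2)) / (2 * cos (\<phi> / 2))"
    unfolding cayley_def s by simp
  also have "\<dots> = of_real (sin (\<phi> / 2) / cos (\<phi> / 2))"
    using c by (simp add: field_simps)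
  finally show ?thesis by (simp add: tan_def)
qed

lemma continuous_on_cayley: "continuous_on (- {-1}) cayley"
proof -
  have "1 + z \<noteq> 0" if "z \<in> - {-1}" for z :: complex
    using that by (metis ComplD add_eq_0_iff insertI1 minus_minus)
  then show ?thesis unfolding cayley_def by (intro continuous_intros) auto
qed

lemma disk_paths_meet:
  assumes f: "disk_path (cis \<alpha>) (cis \<beta>) f" and g: "disk_path (cis \<gamma>) (cis \<delta>) g"
    and ord: "\<alpha> < \<gamma>" "\<gamma> < \<beta>" "\<beta> < \<delta>" "\<delta> < \<alpha> + 2 * pi"
  shows "path_image f \<inter> path_image g \<noteq> {}"
proof -
  obtain f' where f': "path f'" "pathstart f' = cis \<alpha>" "pathfinish f' = cis \<beta>" "path_image f' = path_image f"
    using disk_path_oriented[OF f] .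
  obtain g' where g': "path g'" "pathstart g' = cis \<gamma>" "pathfinish g' = cis \<delta>" "path_image g' = path_image g"
    using disk_path_oriented[OF g] .
  \<comment> \<open>The midpoint of the range of angles. Rotating by \<open>- \<eta>\<close> brings
    all four ends strictly between the angles \<open>- pi\<close> and \<open>pi\<close>, away from
    the pole \<open>-1\<close> of the Cayley transform.\<close>
  define \<eta> where "\<eta> = (\<delta> + \<alpha>) / 2"
  define M where "M z = cayley (z * cis (- \<eta>))" for z
  have M_cis: "M (cis t) = of_real (tan ((t - \<eta>) / 2))" "cis t * cis (- \<eta>) \<noteq> -1" if "\<alpha> \<le> t" "t \<le> \<delta>" for t
  proof -
    have *: "\<bar>t - \<eta>\<bar> < pi" using that ord by (auto simp: \<eta>_def field_simps abs_if)
    then show "M (cis t) = of_real (tan ((t - \<eta>) / 2))"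
      by (simp add: M_def cis_mult cayley_cis)
    show "cis t * cis (- \<eta>) \<noteq> -1"
    proof
      assume "cis t * cis (- \<eta>) = -1"
      then have "cos (t - \<eta>) = -1" by (simp add: cis_mult complex_eq_iff)
      moreover have "cos (t - \<eta>) > cos pi"
        using * cos_monotone_0_pi[of "\<bar>t - \<eta>\<bar>" pi] by simp
      ultimately show False by simp
    qed
  qed
  let ?K = "path_image f \<union> path_image g"
  have K: "norm z \<le> 1 \<and> z * cis (- \<eta>) \<noteq> -1" if "z \<in> ?K" for z
  proof -
    have "z \<in> ball 0 1 \<or> z = cis \<alpha> \<or> z = cis \<beta> \<or> z = cis \<gamma> \<or> z = cis \<delta>"
      using that f g unfolding disk_path_def by blast
    moreover have "\<alpha> \<le> \<alpha>" "\<alpha> \<le> \<delta>" "\<alpha> \<le> \<beta>" "\<beta> \<le> \<delta>" "\<alpha> \<le> \<gamma>" "\<gamma> \<le> \<delta>" "\<delta> \<le> \<delta>" using ord by linarith+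
    ultimately have "z \<in> ball 0 1 \<or> (\<exists>t. z = cis t \<and> \<alpha> \<le> t \<and> t \<le> \<delta>)" by blast
    then show ?thesis
    proof
      assume z: "z \<in> ball 0 1"
      then have "norm (z * cis (- \<eta>)) < 1" by (simp add: norm_mult)
      then show ?thesis using z by auto
    next
      assume "\<exists>t. z = cis t \<and> \<alpha> \<le> t \<and> t \<le> \<delta>"
      then show ?thesis using M_cis(2) by auto
    qed
  qed
  have cont: "continuous_on ?K M"
    unfolding M_def
  proof (rule continuous_on_compose2[OF continuous_on_cayley])
    show "continuous_on ?K (\<lambda>z. z * cis (- \<eta>))" by (intro continuous_intros)
    show "(\<lambda>z. z * cis (- \<eta>)) ` ?K \<subseteq> - {-1}" using K by fast
  qed
  \<comment> \<open>\<open>fashoda_interlace\<close> is about paths in \<open>real^2\<close> whose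
    ends lie on the lower side of a box.\<close>
  define F :: "complex \<Rightarrow> real^2" where "F z = (\<chi> i. if i = 1 then Re (M z) else Im (M z))" for z
  have F1: "F z $ 1 = Re (M z)" and F2: "F z $ 2 = Im (M z)" for z by (simp_all add: F_def)
  have contF: "continuous_on ?K F"
    unfolding F_def
  proof (rule continuous_on_vec_lambda)
    fix i :: 2
    show "continuous_on ?K (\<lambda>z. if i = 1 then Re (M z) else Im (M z))"
      using cont by (cases "i = 1") (auto intro: continuous_intros)
  qed
  have compact: "compact (F ` ?K)"
    by (intro compact_continuous_image[OF contF] compact_Un compact_path_image)
      (use f g in \<open>simp_all add: disk_path_def\<close>)
  then have "bounded (F ` ?K)" by (rule compact_imp_bounded)
  then obtain R where R: "\<And>v. v \<in> F ` ?K \<Longrightarrow> norm v \<le> R"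
    unfolding bounded_iff by meson
  have Fim: "Im (M z) \<ge> 0" if "z \<in> ?K" for z
    using K[OF that] unfolding M_def by (intro Im_cayley_nonneg) (simp add: norm_mult)
  \<comment> \<open>By compactness the images fit into this box. Its lower side is on the real axis,
    as the Cayley transform maps the disk to the upper half plane.\<close>
  define a b :: "real^2" where "a = (\<chi> i. if i = 1 then - R else 0)" and "b = (\<chi> i. R)"
  have box: "F z \<in> cbox a b" if "z \<in> ?K" for z
  proof -
    have "\<bar>F z $ i\<bar> \<le> R" for i
      using component_le_norm_cart[of "F z" i] R[of "F z"] that by (meson imageI order_trans)
    from this[of 1] this[of 2] show ?thesis
      using Fim[OF that] unfolding mem_box_cart a_def b_def by (auto simp: forall_2 F1 F2)
  qed
  have F_cis: "F (cis t) $ 1 = tan ((t - \<eta>) / 2)" "F (cis t) $ 2 = 0" if "\<alpha> \<le> t" "t \<le> \<delta>" for t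
    using M_cis(1)[OF that] by (simp_all add: F1 F2)
  have mono: "tan ((s - \<eta>) / 2) < tan ((t - \<eta>) / 2)" if "\<alpha> \<le> s" "s < t" "t \<le> \<delta>" for s t
    using that ord by (intro tan_monotone) (auto simp: \<eta>_def field_simps)
  obtain v where v: "v \<in> path_image (F \<circ> f')" "v \<in> path_image (F \<circ> g')"
  proof (rule fashoda_interlace[of "F \<circ> f'" "F \<circ> g'" a b])
    show "path (F \<circ> f')"
      by (intro path_continuous_image f'(1) continuous_on_subset[OF contF]) (simp add: f'(4))
    show "path (F \<circ> g')"
      by (intro path_continuous_image g'(1) continuous_on_subset[OF contF]) (simp add: g'(4))
    show "path_image (F \<circ> f') \<subseteq> cbox a b" "path_image (F \<circ> g') \<subseteq> cbox a b"
      using box f'(4) g'(4) by (auto simp: path_image_compose)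
  qed (use F_cis mono ord f' g' in \<open>auto simp: pathstart_compose pathfinish_compose a_def\<close>)
  then obtain z w where zw: "z \<in> path_image f" "w \<in> path_image g" "F z = F w"
    using f'(4) g'(4) by (auto simp: path_image_compose)
  then have "M z = M w" using F1 F2 by (metis complex_eqI)
  then have "z * cis (- \<eta>) = w * cis (- \<eta>)"
    using cayley_inject[of "z * cis (- \<eta>)" "w * cis (- \<eta>)"] K[of z] K[of w] zw(1,2)
    by (simp add: M_def)
  then have "z = w" by simp
  then show ?thesis using zw by blast
qed

lemma circular_labellingD:
  assumes "circular_labelling n \<theta>" "i \<in> {1..2 * n}" "j \<in> {1..2 * n}" "i < j"
  shows "\<theta> i < \<theta> j" "\<theta> j < \<theta> i + 2 * pi"
proof -
  have mono: "\<theta> x \<le> \<theta> y" if "x \<in> {1..2 * n}" "y \<in> {1..2 * n}" "x \<le> y" for x y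
  proof (cases "x = y")
    case False
    then have "x < y" using that by simp
    then show ?thesis
      using assms(1) that(1,2) strict_mono_onD[of "{1..2 * n}" \<theta> x y]
      unfolding circular_labelling_def by simp
  qed simp
  show "\<theta> i < \<theta> j"
    using assms strict_mono_onD[of "{1..2 * n}" \<theta> i j] unfolding circular_labelling_def by simp
  have "\<theta> j \<le> \<theta> (2 * n)" "\<theta> 1 \<le> \<theta> i" using mono[of j "2 * n"] mono[of 1 i] assms(2,3) by auto
  then show "\<theta> j < \<theta> i + 2 * pi" using assms(1) unfolding circular_labelling_def by linarith
qed

lemma cis_neq_1:
  assumes "0 < t" "t < 2 * pi"
  shows "cis t \<noteq> 1"
proof
  assume "cis t = 1"
  then have "cos t = 1" by (simp add: complex_eq_iff)
  moreover have "cos t = 1 - 2 * (sin (t / 2))\<^sup>2" using cos_double_sin[of "t / 2"] by simp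
  moreover have "sin (t / 2) > 0" using assms by (intro sin_gt_zero) auto
  ultimately show False by simp
qed

lemma cross_imp_paths_meet:
  assumes lab: "circular_labelling n \<theta>" and sub: "{a, b, c, d} \<subseteq> {1..2 * n}"
    and dist: "distinct [a, b, c, d]" and cr: "cross {a, b} {c, d}"
    and f: "disk_path (cis (\<theta> a)) (cis (\<theta> b)) f" and g: "disk_path (cis (\<theta> c)) (cis (\<theta> d)) g"
  shows "path_image f \<inter> path_image g \<noteq> {}"
proof -
  have main: "path_image f \<inter> path_image g \<noteq> {}"
    if "a < c" "c < b" "b < d" "{a, b, c, d} \<subseteq> {1..2 * n}"
      "disk_path (cis (\<theta> a)) (cis (\<theta> b)) f" "disk_path (cis (\<theta> c)) (cis (\<theta> d)) g" for a b c d f g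
    using that circular_labellingD[OF lab]
    by (intro disk_paths_meet[of "\<theta> a" "\<theta> b" f "\<theta> c" "\<theta> d" g]) auto
  note f' = f[THEN disk_path_commute[THEN iffD1]] and g' = g[THEN disk_path_commute[THEN iffD1]]
  note triples = triple_order[of a b c] triple_order[of a b d] triple_order[of a c d] triple_order[of b c d]
  have "a \<noteq> b" "a \<noteq> c" "a \<noteq> d" "b \<noteq> c" "b \<noteq> d" "c \<noteq> d" using dist by auto
  moreover have "separates a b c \<noteq> separates a b d" using cross_pair dist cr by blast
  \<comment> \<open>The eight linear arrangements of two interlaced pairs; reversing either path or
    exchanging the paths reduces each of them to \<open>main\<close>.\<close>
  ultimately have "(a < c \<and> c < b \<and> b < d) \<or> (b < c \<and> c < a \<and> a < d) \<or> (a < d \<and> d < b \<and> b < c) \<or>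
    (b < d \<and> d < a \<and> a < c) \<or> (c < a \<and> a < d \<and> d < b) \<or> (c < b \<and> b < d \<and> d < a) \<or>
    (d < a \<and> a < c \<and> c < b) \<or> (d < b \<and> b < c \<and> c < a)"
    using triples unfolding separates_def by satx
  then show ?thesis
  proof (elim disjE conjE)
    assume "a < c" "c < b" "b < d"
    then show ?thesis using main[OF _ _ _ _ f g] sub by blast
  next
    assume "b < c" "c < a" "a < d"
    then show ?thesis using main[OF _ _ _ _ f' g] sub by blast
  next
    assume "a < d" "d < b" "b < c"
    then show ?thesis using main[OF _ _ _ _ f g'] sub by blast
  next
    assume "b < d" "d < a" "a < c"
    then show ?thesis using main[OF _ _ _ _ f' g'] sub by blast
  next
    assume "c < a" "a < d" "d < b"
    then show ?thesis using main[OF _ _ _ _ g f] sub by blast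
  next
    assume "c < b" "b < d" "d < a"
    then show ?thesis using main[OF _ _ _ _ g f'] sub by blast
  next
    assume "d < a" "a < c" "c < b"
    then show ?thesis using main[OF _ _ _ _ g' f] sub by blast
  next
    assume "d < b" "b < c" "c < a"
    then show ?thesis using main[OF _ _ _ _ g' f'] sub by blast
  qed
qed

section \<open>Resolving a crossing in a chart\<close>

text \<open>Cuts a strand at the chart into two tails, from the ends of the strand to the ends of
  its axis. The point to prove is that the strand passes through the chart in one go: the axis, read
  in the parameter of the strand, is a continuous injection of an interval, so the parameters in
  question form a single interval \<open>{s..t}\<close>.\<close>

lemma arc_chart_tails:
  fixes c :: "real \<Rightarrow> complex"
  assumes arc: "arc c" and h: "continuous_on square h" "inj_on h square"
    and d: "d \<noteq> 0" "\<And>x::real. x \<in> {-1..1} \<Longrightarrow> of_real x * d \<in> square"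
    and axis: "{w \<in> square. h w \<in> path_image c} = (\<lambda>x::real. of_real x * d) ` {-1..1}"
    and ends: "pathstart c \<notin> h ` square" "pathfinish c \<notin> h ` square"
  obtains p q where "path p" "path q" "{pathstart p, pathstart q} = {pathstart c, pathfinish c}"
    "pathfinish p = h (- d)" "pathfinish q = h d"
    "path_image p \<subseteq> path_image c" "path_image q \<subseteq> path_image c"
    "path_image p \<inter> h ` square = {h (- d)}" "path_image q \<inter> h ` square = {h d}"
    "path_image p \<inter> path_image q = {}"
    "path_image c - h ` square = (path_image p \<union> path_image q) - h ` square"
proof -
  have inj_c: "inj_on c {0..1}" and cont_c: "continuous_on {0..1} c" and path_c: "path c"
    using arc by (simp_all add: arc_def path_def)
  define g where "g = the_inv_into {0..1} c"
  have gc: "g (c u) = u" if "u \<in> {0..1}" for u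
    unfolding g_def by (rule the_inv_into_f_f[OF inj_c that])
  have cont_g: "continuous_on (c ` {0..1}) g"
    by (rule continuous_on_inv[OF cont_c]) (use gc in auto)
  \<comment> \<open>The parameter at which the strand reaches the point \<open>x\<close> of the
    axis.\<close>
  define \<phi> where "\<phi> x = g (h (of_real x * d))" for x :: real
  have on_c: "h (of_real x * d) \<in> c ` {0..1}" if "x \<in> {-1..1}" for x
    using axis that unfolding path_image_def by blast
  have c\<phi>: "c (\<phi> x) = h (of_real x * d)" "\<phi> x \<in> {0..1}" if x: "x \<in> {-1..1}" for x
  proof -
    obtain u where u: "u \<in> {0..1}" "h (of_real x * d) = c u" using on_c[OF x] by blast
    then show "c (\<phi> x) = h (of_real x * d)" "\<phi> x \<in> {0..1}" using gc by (simp_all add: \<phi>_def)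
  qed
  have cont_hd: "continuous_on {-1..1} (\<lambda>x::real. h (of_real x * d))"
    by (rule continuous_on_compose2[OF h(1)]) (auto intro!: continuous_intros d(2))
  have cont_\<phi>: "continuous_on {-1..1} \<phi>"
    unfolding \<phi>_def by (rule continuous_on_compose2[OF cont_g cont_hd]) (use on_c in blast)
  have inj_\<phi>: "inj_on \<phi> {-1..1}"
  proof (rule inj_onI)
    fix x y assume xy: "x \<in> {-1..1}" "y \<in> {-1..1}" "\<phi> x = \<phi> y"
    then have "h (of_real x * d) = h (of_real y * d)" using c\<phi> by metis
    then have "of_real x * d = of_real y * d" using h(2) d(2) xy(1,2) by (meson inj_onD)
    then show "x = y" using d(1) by simp
  qed
  define s where "s = min (\<phi> (-1)) (\<phi> 1)"
  define t where "t = max (\<phi> (-1)) (\<phi> 1)"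
  have img: "\<phi> ` {-1..1} = {s..t}"
  proof
    show "\<phi> ` {-1..1} \<subseteq> {s..t}"
    proof (rule image_subsetI)
      fix x :: real assume x: "x \<in> {-1..1}"
      then consider "x = -1" | "x = 1" | "-1 < x" "x < 1" by fastforce
      then show "\<phi> x \<in> {s..t}"
      proof cases
        case 3
        then show ?thesis using continuous_inj_imp_mono[OF 3 cont_\<phi> inj_\<phi>] by (auto simp: s_def t_def)
      qed (auto simp: s_def t_def)
    qed
    have "connected (\<phi> ` {-1..1})" by (intro connected_continuous_image[OF cont_\<phi>]) simp
    moreover have "s \<in> \<phi> ` {-1..1}" "t \<in> \<phi> ` {-1..1}" by (auto simp: s_def t_def min_def max_def)
    ultimately show "{s..t} \<subseteq> \<phi> ` {-1..1}" by (rule connected_contains_Icc)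
  qed
  have in_sq: "c u \<in> h ` square \<longleftrightarrow> u \<in> {s..t}" if u: "u \<in> {0..1}" for u
  proof
    assume "c u \<in> h ` square"
    then obtain w where w: "w \<in> square" "c u = h w" by blast
    then have "w \<in> {w \<in> square. h w \<in> path_image c}" using u unfolding path_image_def by force
    then obtain x where x: "x \<in> {-1..1}" "w = of_real x * d" using axis by auto
    then have "c u = c (\<phi> x)" using c\<phi> w by simp
    then have "u = \<phi> x" using inj_c u c\<phi>(2)[OF x(1)] by (meson inj_onD)
    then show "u \<in> {s..t}" using img x(1) by blast
  next
    assume "u \<in> {s..t}"
    then obtain x where "x \<in> {-1..1}" "u = \<phi> x" using img by blast
    then show "c u \<in> h ` square" using c\<phi>(1) d(2) by simp
  qed
  have "\<phi> (-1) \<noteq> \<phi> 1" using inj_onD[OF inj_\<phi>, of "-1" 1] by auto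
  then have "s < t" by (simp add: s_def t_def min_def max_def)
  have st01: "s \<in> {0..1}" "t \<in> {0..1}" using c\<phi>(2)[of "-1"] c\<phi>(2)[of 1] by (auto simp: s_def t_def)
  have "s \<noteq> 0" using in_sq[of s] ends(1) \<open>s < t\<close> st01 by (auto simp: pathstart_def)
  have "t \<noteq> 1" using in_sq[of t] ends(2) \<open>s < t\<close> st01 by (auto simp: pathfinish_def)
  have ord: "0 < s" "s < t" "t < 1" using \<open>s < t\<close> \<open>s \<noteq> 0\<close> \<open>t \<noteq> 1\<close> st01 by auto
  \<comment> \<open>The second tail runs backwards, so that both lead towards the chart.\<close>
  define p q where "p = subpath 0 s c" and "q = subpath 1 t c"
  have pq: "path p" "path q" using path_c st01 by (simp_all add: p_def q_def)
  have pq_ends: "pathstart p = pathstart c" "pathstart q = pathfinish c" "pathfinish p = c s" "pathfinish q = c t"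
    by (simp_all add: p_def q_def pathstart_def pathfinish_def subpath_def)
  have im: "path_image p = c ` {0..s}" "path_image q = c ` {t..1}"
    using ord by (simp_all add: p_def q_def path_image_subpath)
  have 1: "path_image p \<subseteq> path_image c" "path_image q \<subseteq> path_image c"
    unfolding im unfolding path_image_def using ord by auto
  have 2: "path_image p \<inter> h ` square = {c s}" "path_image q \<inter> h ` square = {c t}"
  proof -
    have "c s \<in> h ` square" "c t \<in> h ` square" using in_sq[of s] in_sq[of t] ord by auto
    moreover have "u = s" if "u \<in> {0..s}" "c u \<in> h ` square" for u using in_sq[of u] that ord by auto
    moreover have "u = t" if "u \<in> {t..1}" "c u \<in> h ` square" for u using in_sq[of u] that ord by auto
    moreover have "s \<in> {0..s}" "t \<in> {t..1}" using ord by auto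
    ultimately show "path_image p \<inter> h ` square = {c s}" "path_image q \<inter> h ` square = {c t}"
      unfolding im by blast+
  qed
  have "c u \<noteq> c v" if "u \<in> {0..s}" "v \<in> {t..1}" for u v
  proof
    assume "c u = c v"
    then have "u = v" using inj_onD[OF inj_c, of u v] that ord by simp
    then show False using that ord by simp
  qed
  then have 3: "path_image p \<inter> path_image q = {}" unfolding im by blast
  have 4: "path_image c - h ` square = (path_image p \<union> path_image q) - h ` square"
  proof
    show "path_image c - h ` square \<subseteq> (path_image p \<union> path_image q) - h ` square"
    proof
      fix z assume z: "z \<in> path_image c - h ` square"
      then obtain u where u: "u \<in> {0..1}" "z = c u" unfolding path_image_def by blast
      then have "u \<notin> {s..t}" using in_sq z by blast
      then have "u \<in> {0..s} \<or> u \<in> {t..1}" using u by auto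
      then show "z \<in> (path_image p \<union> path_image q) - h ` square" unfolding im using u z by blast
    qed
  qed (use 1 in blast)
  show ?thesis
  \<comment> \<open>The strand may traverse its axis in either direction.\<close>
  proof (cases "\<phi> (-1) < \<phi> 1")
    case True
    then have "c s = h (- d)" "c t = h d"
      using c\<phi>(1)[of "-1"] c\<phi>(1)[of 1] by (simp_all add: s_def t_def)
    then show ?thesis using that[of p q] pq pq_ends 1 2 3 4 by simp
  next
    case False
    then have "c t = h (- d)" "c s = h d"
      using c\<phi>(1)[of "-1"] c\<phi>(1)[of 1] by (simp_all add: s_def t_def)
    then show ?thesis
      by (intro that[of q p]) (use pq pq_ends 1 2 3 4 in \<open>simp_all add: insert_commute Int_commute Un_commute\<close>)
  qed
qed

lemma join_tails:
  assumes "path p" "path q" "pathfinish p = h x" "pathfinish q = h y"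
    "continuous_on square h" "closed_segment x y \<subseteq> square"
  obtains g where "path g" "pathstart g = pathstart p" "pathfinish g = pathstart q"
    "path_image g = path_image p \<union> h ` closed_segment x y \<union> path_image q"
proof -
  let ?m = "h \<circ> linepath x y"
  have m: "path ?m" "pathstart ?m = h x" "pathfinish ?m = h y" "path_image ?m = h ` closed_segment x y"
    using assms(5,6) by (auto intro!: path_continuous_image elim: continuous_on_subset
        simp: pathstart_compose pathfinish_compose path_image_compose)
  show ?thesis
    by (rule that[of "p +++ ?m +++ reversepath q"])
      (use assms m in \<open>auto simp: path_image_join\<close>)
qed

text \<open>In compass directions the first smoothing joins west to north and east to south, the
  second one west to south and east to north.\<close>

lemma smoothing1_segments: "smoothing1 = closed_segment (-1) \<i> \<union> closed_segment 1 (-\<i>)"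
proof (intro set_eqI iffI)
  fix w assume "w \<in> smoothing1"
  then have w: "\<bar>Re w\<bar> \<le> 1" "\<bar>Im w\<bar> \<le> 1" "Re w - Im w = 1 \<or> Re w - Im w = -1"
    by (auto simp: smoothing1_def square_def)
  from w(3) show "w \<in> closed_segment (-1) \<i> \<union> closed_segment 1 (-\<i>)"
  proof
    assume "Re w - Im w = 1"
    then have "w = (1 - (- Im w)) *\<^sub>R 1 + (- Im w) *\<^sub>R (-\<i>)" "0 \<le> - Im w" "- Im w \<le> 1"
      using w by (auto simp: complex_eq_iff)
    then have "w \<in> closed_segment 1 (-\<i>)" unfolding in_segment by blast
    then show ?thesis ..
  next
    assume "Re w - Im w = -1"
    then have "w = (1 - Im w) *\<^sub>R (-1) + Im w *\<^sub>R \<i>" "0 \<le> Im w" "Im w \<le> 1"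
      using w by (auto simp: complex_eq_iff)
    then have "w \<in> closed_segment (-1) \<i>" unfolding in_segment by blast
    then show ?thesis ..
  qed
next
  fix w assume "w \<in> closed_segment (-1) \<i> \<union> closed_segment 1 (-\<i>)"
  then show "w \<in> smoothing1"
    by (auto simp: in_segment smoothing1_def square_def)
qed

lemma smoothing2_segments: "smoothing2 = closed_segment (-1) (-\<i>) \<union> closed_segment 1 \<i>"
proof (intro set_eqI iffI)
  fix w assume "w \<in> smoothing2"
  then have w: "\<bar>Re w\<bar> \<le> 1" "\<bar>Im w\<bar> \<le> 1" "Re w + Im w = 1 \<or> Re w + Im w = -1"
    by (auto simp: smoothing2_def square_def)
  from w(3) show "w \<in> closed_segment (-1) (-\<i>) \<union> closed_segment 1 \<i>"
  proof
    assume "Re w + Im w = 1"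
    then have "w = (1 - Im w) *\<^sub>R 1 + Im w *\<^sub>R \<i>" "0 \<le> Im w" "Im w \<le> 1"
      using w by (auto simp: complex_eq_iff)
    then have "w \<in> closed_segment 1 \<i>" unfolding in_segment by blast
    then show ?thesis ..
  next
    assume "Re w + Im w = -1"
    then have "w = (1 - (- Im w)) *\<^sub>R (-1) + (- Im w) *\<^sub>R (-\<i>)" "0 \<le> - Im w" "- Im w \<le> 1"
      using w by (auto simp: complex_eq_iff)
    then have "w \<in> closed_segment (-1) (-\<i>)" unfolding in_segment by blast
    then show ?thesis ..
  qed
next
  fix w assume "w \<in> closed_segment (-1) (-\<i>) \<union> closed_segment 1 \<i>"
  then show "w \<in> smoothing2"
    by (auto simp: in_segment smoothing2_def square_def)
qed

lemma segment_sides: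
  "w \<in> closed_segment (-1) \<i> \<Longrightarrow> Re w - Im w = -1"
  "w \<in> closed_segment 1 (-\<i>) \<Longrightarrow> Re w - Im w = 1"
  "w \<in> closed_segment (-1) (-\<i>) \<Longrightarrow> Re w + Im w = -1"
  "w \<in> closed_segment 1 \<i> \<Longrightarrow> Re w + Im w = 1"
  by (auto simp: in_segment)

lemma matchings_iff: "\<tau> \<in> matchings n \<longleftrightarrow> perfect_matching {1..2 * n} \<tau>"
  by (simp add: matchings_def perfect_matching_def)

lemma medial_graph_strand:
  assumes "medial_graph n \<theta> \<tau> \<gamma>" "{a, b} \<in> \<tau>"
  shows "disk_path (cis (\<theta> a)) (cis (\<theta> b)) (\<gamma> {a, b})" "arc (\<gamma> {a, b})"
proof -
  have "strand \<theta> {a, b} (\<gamma> {a, b})" using assms unfolding medial_graph_def by blast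
  then have arc: "arc (\<gamma> {a, b})"
    and ends: "{pathstart (\<gamma> {a, b}), pathfinish (\<gamma> {a, b})} = {cis (\<theta> a), cis (\<theta> b)}"
    and img: "path_image (\<gamma> {a, b}) - {pathstart (\<gamma> {a, b}), pathfinish (\<gamma> {a, b})} \<subseteq> ball 0 1"
    by (auto simp: strand_def)
  show "arc (\<gamma> {a, b})" by (rule arc)
  show "disk_path (cis (\<theta> a)) (cis (\<theta> b)) (\<gamma> {a, b})"
    using arc_imp_path[OF arc] ends img[unfolded ends] unfolding disk_path_def by simp
qed

text \<open>Both resolutions of a crossing consist of two disjoint paths. Since disjoint paths do not join
  interlaced pairs of boundary points, the crossing strands themselves must be interlaced.\<close>

lemma chart_resolution:
  assumes med: "medial_graph n \<theta> \<tau> \<gamma>" and chart: "crossing_chart \<tau> \<gamma> h e f"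
    and meet: "path_image (\<gamma> e) \<inter> path_image (\<gamma> f) = {h 0}"
  obtains a b c d g1 g2 g3 g4 where "e = {a, b}" "f = {c, d}" "distinct [a, b, c, d]"
    "disk_path (cis (\<theta> a)) (cis (\<theta> d)) g1" "disk_path (cis (\<theta> b)) (cis (\<theta> c)) g2"
    "path_image g1 \<inter> path_image g2 = {}"
    "((path_image (\<gamma> e) \<union> path_image (\<gamma> f)) - h ` square) \<union> h ` smoothing1 = path_image g1 \<union> path_image g2"
    "disk_path (cis (\<theta> a)) (cis (\<theta> c)) g3" "disk_path (cis (\<theta> b)) (cis (\<theta> d)) g4"
    "path_image g3 \<inter> path_image g4 = {}"
    "((path_image (\<gamma> e) \<union> path_image (\<gamma> f)) - h ` square) \<union> h ` smoothing2 = path_image g3 \<union> path_image g4"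
proof -
  have pm: "perfect_matching {1..2 * n} \<tau>" and lab: "circular_labelling n \<theta>"
    using med by (auto simp: medial_graph_def matchings_iff)
  have h: "continuous_on square h" "inj_on h square" and ball: "h ` square \<subseteq> ball 0 1"
    and ef: "e \<in> \<tau>" "f \<in> \<tau>" "e \<noteq> f"
    and axes: "{w \<in> square. h w \<in> path_image (\<gamma> e)} = {w \<in> square. Im w = 0}"
      "{w \<in> square. h w \<in> path_image (\<gamma> f)} = {w \<in> square. Re w = 0}"
    using chart unfolding crossing_chart_def by auto
  obtain a' b' where e': "e = {a', b'}" using perfect_matching_pair[OF pm ef(1)] by metis
  obtain c' d' where f': "f = {c', d'}" using perfect_matching_pair[OF pm ef(2)] by metis
  have re: "{w \<in> square. Im w = 0} = (\<lambda>x::real. of_real x * 1) ` {-1..1}"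
    and im: "{w \<in> square. Re w = 0} = (\<lambda>x::real. of_real x * \<i>) ` {-1..1}"
    by (auto simp: square_def image_iff complex_eq_iff abs_le_iff)
  have sq1: "of_real x * 1 \<in> square" "of_real x * \<i> \<in> square" if "x \<in> {-1..1}" for x :: real
    using that by (auto simp: square_def)
  have not_sq: "cis t \<notin> h ` square" for t
  proof
    assume "cis t \<in> h ` square"
    then have "cis t \<in> ball 0 1" using ball by blast
    then show False by simp
  qed
  have strand_e: "arc (\<gamma> e)" "{pathstart (\<gamma> e), pathfinish (\<gamma> e)} = {cis (\<theta> a'), cis (\<theta> b')}"
    "path_image (\<gamma> e) - {cis (\<theta> a'), cis (\<theta> b')} \<subseteq> ball 0 1"
    using medial_graph_strand[OF med ef(1)[unfolded e']] unfolding e' disk_path_def by auto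
  have strand_f: "arc (\<gamma> f)" "{pathstart (\<gamma> f), pathfinish (\<gamma> f)} = {cis (\<theta> c'), cis (\<theta> d')}"
    "path_image (\<gamma> f) - {cis (\<theta> c'), cis (\<theta> d')} \<subseteq> ball 0 1"
    using medial_graph_strand[OF med ef(2)[unfolded f']] unfolding f' disk_path_def by auto
  have ends: "pathstart (\<gamma> e) \<notin> h ` square" "pathfinish (\<gamma> e) \<notin> h ` square"
    "pathstart (\<gamma> f) \<notin> h ` square" "pathfinish (\<gamma> f) \<notin> h ` square"
    using strand_e(2) strand_f(2) not_sq by (metis doubleton_eq_iff)+
  obtain pe qe where E: "path pe" "path qe" "{pathstart pe, pathstart qe} = {pathstart (\<gamma> e), pathfinish (\<gamma> e)}"
    "pathfinish pe = h (- 1)" "pathfinish qe = h 1"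
    "path_image pe \<subseteq> path_image (\<gamma> e)" "path_image qe \<subseteq> path_image (\<gamma> e)"
    "path_image pe \<inter> h ` square = {h (- 1)}" "path_image qe \<inter> h ` square = {h 1}"
    "path_image pe \<inter> path_image qe = {}"
    "path_image (\<gamma> e) - h ` square = (path_image pe \<union> path_image qe) - h ` square"
    by (rule arc_chart_tails[OF strand_e(1) h _ sq1(1) axes(1)[unfolded re] ends(1,2)]) auto
  obtain pf qf where F: "path pf" "path qf" "{pathstart pf, pathstart qf} = {pathstart (\<gamma> f), pathfinish (\<gamma> f)}"
    "pathfinish pf = h (- \<i>)" "pathfinish qf = h \<i>"
    "path_image pf \<subseteq> path_image (\<gamma> f)" "path_image qf \<subseteq> path_image (\<gamma> f)"
    "path_image pf \<inter> h ` square = {h (- \<i>)}" "path_image qf \<inter> h ` square = {h \<i>}"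
    "path_image pf \<inter> path_image qf = {}"
    "path_image (\<gamma> f) - h ` square = (path_image pf \<union> path_image qf) - h ` square"
    by (rule arc_chart_tails[OF strand_f(1) h _ sq1(2) axes(2)[unfolded im] ends(3,4)]) auto
  \<comment> \<open>The names are chosen such that the tails from \<open>a\<close>,
    \<open>b\<close>, \<open>c\<close>, \<open>d\<close> enter the square from the west, east, south
    and north.\<close>
  obtain a b where ab: "e = {a, b}" "pathstart pe = cis (\<theta> a)" "pathstart qe = cis (\<theta> b)"
    using E(3) strand_e(2) e' by (metis doubleton_eq_iff)
  obtain c d where cd: "f = {c, d}" "pathstart pf = cis (\<theta> c)" "pathstart qf = cis (\<theta> d)"
    using F(3) strand_f(2) f' by (metis doubleton_eq_iff)
  have dist: "distinct [a, b, c, d]"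
    using perfect_matching_split2[OF pm ef[unfolded ab(1) cd(1)]] by metis
  have in_sq: "0 \<in> square" "1 \<in> square" "-1 \<in> square" "\<i> \<in> square" "-\<i> \<in> square"
    by (auto simp: square_def)
  have h0: "h 0 \<noteq> h 1" "h 0 \<noteq> h (-1)"
    using inj_onD[OF h(2)] in_sq by force+
  have h0_sq: "h 0 \<in> h ` square" using in_sq by blast
  \<comment> \<open>The strands meet only at the centre of the square, which lies on no
    tail.\<close>
  have disj: "X \<inter> Y = {}"
    if "X \<subseteq> path_image (\<gamma> e)" "Y \<subseteq> path_image (\<gamma> f)" "X \<inter> h ` square = {k}" "h 0 \<noteq> k" for X Y k
  proof (rule ccontr)
    assume "X \<inter> Y \<noteq> {}"
    then obtain x where x: "x \<in> X" "x \<in> Y" by blast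
    then have "x \<in> path_image (\<gamma> e) \<inter> path_image (\<gamma> f)" using that(1,2) by blast
    then have "x = h 0" using meet by simp
    then have "h 0 \<in> X \<inter> h ` square" using x h0_sq by simp
    then show False using that(3,4) by simp
  qed
  have e_f: "path_image pe \<inter> path_image pf = {}" "path_image pe \<inter> path_image qf = {}"
    "path_image qe \<inter> path_image pf = {}" "path_image qe \<inter> path_image qf = {}"
    using disj[OF E(6) F(6) E(8) h0(2)] disj[OF E(6) F(7) E(8) h0(2)]
      disj[OF E(7) F(6) E(9) h0(1)] disj[OF E(7) F(7) E(9) h0(1)] by simp_all
  have in_ball: "path_image pe - {cis (\<theta> a)} \<subseteq> ball 0 1" "path_image qe - {cis (\<theta> b)} \<subseteq> ball 0 1"
    "path_image pf - {cis (\<theta> c)} \<subseteq> ball 0 1" "path_image qf - {cis (\<theta> d)} \<subseteq> ball 0 1"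
  proof -
    have "cis (\<theta> b) \<notin> path_image pe" "cis (\<theta> a) \<notin> path_image qe"
      "cis (\<theta> d) \<notin> path_image pf" "cis (\<theta> c) \<notin> path_image qf"
      using E(10) F(10) pathstart_in_path_image ab cd by (metis disjoint_iff)+
    moreover have "path_image (\<gamma> e) - {cis (\<theta> a), cis (\<theta> b)} \<subseteq> ball 0 1"
      using strand_e(2,3) E(3) ab by metis
    moreover have "path_image (\<gamma> f) - {cis (\<theta> c), cis (\<theta> d)} \<subseteq> ball 0 1"
      using strand_f(2,3) F(3) cd by metis
    ultimately show "path_image pe - {cis (\<theta> a)} \<subseteq> ball 0 1" "path_image qe - {cis (\<theta> b)} \<subseteq> ball 0 1"
    "path_image pf - {cis (\<theta> c)} \<subseteq> ball 0 1" "path_image qf - {cis (\<theta> d)} \<subseteq> ball 0 1"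
      using E(6,7) F(6,7) by blast+
  qed
  have seg: "closed_segment (-1) \<i> \<subseteq> square" "closed_segment 1 (-\<i>) \<subseteq> square"
    "closed_segment (-1) (-\<i>) \<subseteq> square" "closed_segment 1 \<i> \<subseteq> square"
    using smoothing1_segments smoothing2_segments by (auto simp: smoothing1_def smoothing2_def)
  have img_disj: "h ` X \<inter> h ` Y = {}" if "X \<subseteq> square" "Y \<subseteq> square" "X \<inter> Y = {}" for X Y
    using that inj_on_image_Int[OF h(2), of X Y] by simp
  have tail_disj: "P \<inter> h ` X = {}" if "P \<inter> h ` square = {h k}" "k \<in> square" "X \<subseteq> square" "k \<notin> X" for P X k
    using that h(2) unfolding inj_on_def by blast
  have notin: "-1 \<notin> closed_segment 1 (-\<i>)" "\<i> \<notin> closed_segment 1 (-\<i>)" "1 \<notin> closed_segment (-1) \<i>" "-\<i> \<notin> closed_segment (-1) \<i>"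
    "-1 \<notin> closed_segment 1 \<i>" "-\<i> \<notin> closed_segment 1 \<i>" "1 \<notin> closed_segment (-1) (-\<i>)" "\<i> \<notin> closed_segment (-1) (-\<i>)"
    using segment_sides by fastforce+
  have seg_disj: "closed_segment (-1) \<i> \<inter> closed_segment 1 (-\<i>) = {}" "closed_segment (-1) (-\<i>) \<inter> closed_segment 1 \<i> = {}"
    using segment_sides by fastforce+
  obtain g1 where g1: "path g1" "pathstart g1 = cis (\<theta> a)" "pathfinish g1 = cis (\<theta> d)"
    "path_image g1 = path_image pe \<union> h ` closed_segment (-1) \<i> \<union> path_image qf"
    using join_tails[OF E(1) F(2) E(4) F(5) h(1) seg(1)] ab cd by metis
  obtain g2 where g2: "path g2" "pathstart g2 = cis (\<theta> b)" "pathfinish g2 = cis (\<theta> c)"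
    "path_image g2 = path_image qe \<union> h ` closed_segment 1 (-\<i>) \<union> path_image pf"
    using join_tails[OF E(2) F(1) E(5) F(4) h(1) seg(2)] ab cd by metis
  obtain g3 where g3: "path g3" "pathstart g3 = cis (\<theta> a)" "pathfinish g3 = cis (\<theta> c)"
    "path_image g3 = path_image pe \<union> h ` closed_segment (-1) (-\<i>) \<union> path_image pf"
    using join_tails[OF E(1) F(1) E(4) F(4) h(1) seg(3)] ab cd by metis
  obtain g4 where g4: "path g4" "pathstart g4 = cis (\<theta> b)" "pathfinish g4 = cis (\<theta> d)"
    "path_image g4 = path_image qe \<union> h ` closed_segment 1 \<i> \<union> path_image qf"
    using join_tails[OF E(2) F(2) E(5) F(5) h(1) seg(4)] ab cd by metis
  show ?thesis
  proof (rule that[OF ab(1) cd(1) dist])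
    show "disk_path (cis (\<theta> a)) (cis (\<theta> d)) g1" "disk_path (cis (\<theta> b)) (cis (\<theta> c)) g2"
      "disk_path (cis (\<theta> a)) (cis (\<theta> c)) g3" "disk_path (cis (\<theta> b)) (cis (\<theta> d)) g4"
      unfolding disk_path_def g1 g2 g3 g4 using g1(1) g2(1) g3(1) g4(1) in_ball seg ball by blast+
    have union_disj: "(A \<union> B \<union> C) \<inter> (A' \<union> B' \<union> C') = {}"
      if "A \<inter> A' = {}" "A \<inter> B' = {}" "A \<inter> C' = {}" "A' \<inter> B = {}" "B \<inter> B' = {}" "C' \<inter> B = {}"
        "A' \<inter> C = {}" "C \<inter> B' = {}" "C' \<inter> C = {}" for A B C A' B' C' :: "complex set"
      using that by blast
    show "path_image g1 \<inter> path_image g2 = {}"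
      unfolding g1 g2
      by (rule union_disj[OF E(10) tail_disj[OF E(8) in_sq(3) seg(2) notin(1)] e_f(1)
        tail_disj[OF E(9) in_sq(2) seg(1) notin(3)] img_disj[OF seg(1,2) seg_disj(1)]
        tail_disj[OF F(8) in_sq(5) seg(1) notin(4)] e_f(4) tail_disj[OF F(9) in_sq(4) seg(2) notin(2)] F(10)])
    have "path_image qf \<inter> path_image pf = {}" using F(10) by blast
    then show "path_image g3 \<inter> path_image g4 = {}"
      unfolding g3 g4
      by (intro union_disj[OF E(10) tail_disj[OF E(8) in_sq(3) seg(4) notin(5)] e_f(2)
        tail_disj[OF E(9) in_sq(2) seg(3) notin(7)] img_disj[OF seg(3,4) seg_disj(2)]
        tail_disj[OF F(9) in_sq(4) seg(3) notin(8)] e_f(3) tail_disj[OF F(8) in_sq(5) seg(4) notin(6)]])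
    have sm: "h (-1) \<in> h ` smoothing1" "h 1 \<in> h ` smoothing1" "h \<i> \<in> h ` smoothing1" "h (-\<i>) \<in> h ` smoothing1"
      "h (-1) \<in> h ` smoothing2" "h 1 \<in> h ` smoothing2" "h \<i> \<in> h ` smoothing2" "h (-\<i>) \<in> h ` smoothing2"
      unfolding smoothing1_segments smoothing2_segments by blast+
    have sub: "h ` smoothing1 \<subseteq> h ` square" "h ` smoothing2 \<subseteq> h ` square"
      by (auto simp: smoothing1_def smoothing2_def)
    \<comment> \<open>The tails end on the smoothing, so cutting out the square loses no
      point.\<close>
    have tails: "((path_image (\<gamma> e) \<union> path_image (\<gamma> f)) - h ` square) \<union> X =
        path_image pe \<union> path_image qe \<union> path_image pf \<union> path_image qf \<union> X"
      if "h (-1) \<in> X" "h 1 \<in> X" "h \<i> \<in> X" "h (-\<i>) \<in> X" for X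
    proof -
      have absorb: "(P - S) \<union> X = P \<union> X" if "P \<inter> S = {k}" "k \<in> X" for P S :: "complex set" and k
        using that by auto
      have "((path_image (\<gamma> e) \<union> path_image (\<gamma> f)) - h ` square) \<union> X =
          ((path_image pe - h ` square) \<union> X) \<union> ((path_image qe - h ` square) \<union> X) \<union>
          (((path_image pf - h ` square) \<union> X) \<union> ((path_image qf - h ` square) \<union> X))"
        unfolding Un_Diff E(11) F(11) by (simp only: Un_ac Un_absorb Un_left_absorb)
      then show ?thesis
        unfolding absorb[OF E(8) that(1)] absorb[OF E(9) that(2)] absorb[OF F(9) that(3)] absorb[OF F(8) that(4)]
        by (simp only: Un_ac Un_absorb Un_left_absorb)
    qed
    show "((path_image (\<gamma> e) \<union> path_image (\<gamma> f)) - h ` square) \<union> h ` smoothing1 = path_image g1 \<union> path_image g2"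
      unfolding tails[OF sm(1-4)] unfolding g1 g2 smoothing1_segments image_Un by (simp only: Un_ac)
    show "((path_image (\<gamma> e) \<union> path_image (\<gamma> f)) - h ` square) \<union> h ` smoothing2 = path_image g3 \<union> path_image g4"
      unfolding tails[OF sm(5-8)] unfolding g3 g4 smoothing2_segments image_Un by (simp only: Un_ac)
  qed
qed

section \<open>Counting crossings of medial graphs\<close>

lemma chords_distinct:
  assumes "perfect_matching S \<tau>" "{a, b} \<in> \<tau>" "{c, d} \<in> \<tau>" "{a, b} \<noteq> {c, d}"
  shows "distinct [a, b, c, d]"
  using perfect_matching_split2[OF assms] by blast

lemma crossing_strands_meet:
  assumes med: "medial_graph n \<theta> \<tau> \<gamma>" and ef: "e \<in> \<tau>" "f \<in> \<tau>" and cr: "cross e f"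
  shows "path_image (\<gamma> e) \<inter> path_image (\<gamma> f) \<noteq> {}"
proof -
  have pm: "perfect_matching {1..2 * n} \<tau>" and lab: "circular_labelling n \<theta>"
    using med by (auto simp: medial_graph_def matchings_iff)
  obtain a b where e: "e = {a, b}" using perfect_matching_pair[OF pm ef(1)] by metis
  obtain c d where f: "f = {c, d}" using perfect_matching_pair[OF pm ef(2)] by metis
  have ab: "{a, b} \<in> \<tau>" and cd: "{c, d} \<in> \<tau>" using ef e f by auto
  have dist: "distinct [a, b, c, d]"
    by (rule chords_distinct[OF pm ab cd]) (use cr e f in auto)
  have sub: "{a, b, c, d} \<subseteq> {1..2 * n}"
    using perfect_matching_distinct[OF pm ab] perfect_matching_distinct[OF pm cd] by simp
  show ?thesis
    unfolding e f
    by (rule cross_imp_paths_meet[OF lab sub dist cr[unfolded e f]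
        medial_graph_strand(1)[OF med ab] medial_graph_strand(1)[OF med cd]])
qed

text \<open>A crossing point determines its two strands, as the chart excludes all further ones;
  this allows crossings to be counted by pairs of strands.\<close>

lemma crossing_chart_strands:
  assumes "crossing_chart \<tau> \<gamma> h e f" "g \<in> \<tau>"
  shows "h 0 \<in> path_image (\<gamma> g) \<longleftrightarrow> g = e \<or> g = f"
proof -
  have 0: "0 \<in> square" by (simp add: square_def)
  have "0 \<in> {w \<in> square. h w \<in> path_image (\<gamma> e)}" "0 \<in> {w \<in> square. h w \<in> path_image (\<gamma> f)}"
    using assms(1) 0 unfolding crossing_chart_def by auto
  moreover have "h 0 \<notin> path_image (\<gamma> g)" if "g \<notin> {e, f}"
    using assms 0 that unfolding crossing_chart_def by blast
  ultimately show ?thesis by auto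
qed

lemma crossing_chart_in_crossings:
  assumes "crossing_chart \<tau> \<gamma> h e f"
  shows "h 0 \<in> crossings \<tau> \<gamma>"
proof -
  have "e \<in> \<tau>" "f \<in> \<tau>" "e \<noteq> f" using assms unfolding crossing_chart_def by auto
  then show ?thesis
    using crossing_chart_strands[OF assms] unfolding crossings_def by blast
qed

lemma lensless_meet:
  assumes "lensless \<tau> \<gamma>" "e \<in> \<tau>" "f \<in> \<tau>" "e \<noteq> f" "z \<in> path_image (\<gamma> e)" "z \<in> path_image (\<gamma> f)"
  shows "path_image (\<gamma> e) \<inter> path_image (\<gamma> f) = {z}"
proof -
  have "\<exists>\<^sub>\<le>\<^sub>1z. z \<in> path_image (\<gamma> e) \<and> z \<in> path_image (\<gamma> f)" using assms unfolding lensless_def by blast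
  then have "y = z" if "y \<in> path_image (\<gamma> e)" "y \<in> path_image (\<gamma> f)" for y
    using that assms(5,6) by (auto simp: Uniq_def)
  then show ?thesis using assms(5,6) by blast
qed

text \<open>Disjoint paths rule out two of the three pairings of the four ends as the interlaced
  one, which leaves the pairing by \<open>e\<close> and \<open>f\<close>.\<close>

lemma single_crossing_imp_cross:
  assumes med: "medial_graph n \<theta> \<tau> \<gamma>" and chart: "crossing_chart \<tau> \<gamma> h e f"
    and meet: "path_image (\<gamma> e) \<inter> path_image (\<gamma> f) = {h 0}"
  shows "cross e f"
proof -
  have pm: "perfect_matching {1..2 * n} \<tau>" and lab: "circular_labelling n \<theta>"
    using med by (auto simp: medial_graph_def matchings_iff)
  obtain a b c d g1 g2 g3 g4 where *: "e = {a, b}" "f = {c, d}" "distinct [a, b, c, d]"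
    "disk_path (cis (\<theta> a)) (cis (\<theta> d)) g1" "disk_path (cis (\<theta> b)) (cis (\<theta> c)) g2"
    "path_image g1 \<inter> path_image g2 = {}"
    "disk_path (cis (\<theta> a)) (cis (\<theta> c)) g3" "disk_path (cis (\<theta> b)) (cis (\<theta> d)) g4"
    "path_image g3 \<inter> path_image g4 = {}"
    by (rule chart_resolution[OF med chart meet])
  have "e \<in> \<tau>" "f \<in> \<tau>" using chart unfolding crossing_chart_def by auto
  then have sub: "{a, b, c, d} \<subseteq> {1..2 * n}"
    using perfect_matching_distinct[OF pm, of a b] perfect_matching_distinct[OF pm, of c d] *(1,2) by simp
  have d: "distinct [a, d, b, c]" "distinct [a, c, b, d]" "distinct [a, c, d, b]" "distinct [a, d, c, b]"
    using *(3) by auto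
  have sub': "{a, d, b, c} \<subseteq> {1..2 * n}" "{a, c, b, d} \<subseteq> {1..2 * n}" using sub by auto
  have "\<not> cross {a, d} {b, c}"
    using cross_imp_paths_meet[OF lab sub'(1) d(1) _ *(4,5)] *(6) by blast
  then have "separates a d c = separates a d b" using cross_pair[OF d(1)] by blast
  moreover have "\<not> cross {a, c} {b, d}"
    using cross_imp_paths_meet[OF lab sub'(2) d(2) _ *(7,8)] *(9) by blast
  then have "separates a c d = separates a c b" using cross_pair[OF d(2)] by blast
  ultimately have "separates a b c \<noteq> separates a b d"
    using separates_some_pairing[OF d(3)] by blast
  then show ?thesis unfolding *(1,2) using cross_pair[OF *(3)] by blast
qed

lemma cross_count_card: 
  assumes "finite \<tau>"
  shows "cross_count \<tau> = card {p \<in> \<tau> \<times> \<tau>. cross_left (fst p) (snd p)}"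
proof -
  have "cross_count \<tau> = (\<Sum>p\<in>\<tau> \<times> \<tau>. of_bool (cross_left (fst p) (snd p)))"
    unfolding cross_count_def by (simp add: sum.cartesian_product case_prod_unfold del: sum_of_bool_eq)
  then show ?thesis using assms by (simp add: Int_def)
qed

text \<open>Chooses one crossing for each interlaced pair. Different pairs get different points
  because a crossing lies on two strands only, and \<open>cross_left\<close> fixes the order within
  the pair.\<close>

lemma crossing_choice:
  assumes med: "medial_graph n \<theta> \<tau> \<gamma>"
  defines "P \<equiv> {p \<in> \<tau> \<times> \<tau>. cross_left (fst p) (snd p)}"
  obtains pt where "\<And>e f. (e, f) \<in> P \<Longrightarrow> pt (e, f) \<in> path_image (\<gamma> e) \<inter> path_image (\<gamma> f)"
    "inj_on pt P" "pt ` P \<subseteq> crossings \<tau> \<gamma>" 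
proof -
  have "\<exists>z. z \<in> path_image (\<gamma> e) \<inter> path_image (\<gamma> f)" if "(e, f) \<in> P" for e f
    using crossing_strands_meet[OF med, of e f] that by (auto simp: P_def cross_def)
  moreover define pt where "pt p = (SOME z. z \<in> path_image (\<gamma> (fst p)) \<inter> path_image (\<gamma> (snd p)))" for p
  ultimately have pt: "pt (e, f) \<in> path_image (\<gamma> e) \<inter> path_image (\<gamma> f)" if "(e, f) \<in> P" for e f
    using someI_ex[of "\<lambda>z. z \<in> path_image (\<gamma> e) \<inter> path_image (\<gamma> f)"] that by simp
  have neq: "e \<noteq> f" if "(e, f) \<in> P" for e f using that by (auto simp: P_def cross_left_def)
  have sub: "pt ` P \<subseteq> crossings \<tau> \<gamma>"
  proof
    fix z assume "z \<in> pt ` P"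
    then obtain e f where ef: "(e, f) \<in> P" "z = pt (e, f)" by auto
    then show "z \<in> crossings \<tau> \<gamma>"
      using pt[OF ef(1)] neq[OF ef(1)] unfolding crossings_def P_def by auto
  qed
  have "inj_on pt P"
  proof (rule inj_onI)
    fix p p' assume p: "p \<in> P" "p' \<in> P" "pt p = pt p'"
    obtain e f where [simp]: "p = (e, f)" by (cases p)
    obtain e' f' where [simp]: "p' = (e', f')" by (cases p')
    have "pt p \<in> crossings \<tau> \<gamma>" using sub p(1) by blast
    then obtain h g1 g2 where h: "h 0 = pt p" "crossing_chart \<tau> \<gamma> h g1 g2"
      using med unfolding medial_graph_def by metis
    have in\<tau>: "e \<in> \<tau>" "f \<in> \<tau>" "e' \<in> \<tau>" "f' \<in> \<tau>" using p by (auto simp: P_def)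
    have "g = g1 \<or> g = g2" if "g \<in> {e, f, e', f'}" for g
      using crossing_chart_strands[OF h(2), of g] pt[of e f] pt[of e' f'] p h(1) in\<tau> that by auto
    then have "{e, f} \<subseteq> {g1, g2}" "{e', f'} \<subseteq> {g1, g2}" by auto
    then have "e' = e \<and> f' = f \<or> e' = f \<and> f' = e"
      using neq[of e f] neq[of e' f'] p by auto
    moreover have "\<not> (e' = f \<and> f' = e)" using p by (auto simp: P_def cross_left_def)
    ultimately show "p = p'" by simp
  qed
  then show ?thesis using that pt sub by blast
qed

text \<open>All claims compare the crossings with the points chosen for the interlaced pairs. If
  there are no more crossings than such pairs, each crossing is a chosen one, so no two strands can
  meet twice. In a lensless drawing each crossing belongs to an interlaced pair by
  \<open>single_crossing_imp_cross\<close>.\<close>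

lemma medial_graph_crossings:
  assumes med: "medial_graph n \<theta> \<tau> \<gamma>"
  shows "cross_count \<tau> \<le> card (crossings \<tau> \<gamma>)"
    and "card (crossings \<tau> \<gamma>) \<le> cross_count \<tau> \<Longrightarrow> lensless \<tau> \<gamma>"
    and "lensless \<tau> \<gamma> \<Longrightarrow> card (crossings \<tau> \<gamma>) = cross_count \<tau>"
proof -
  have pm: "perfect_matching {1..2 * n} \<tau>" and fin: "finite (crossings \<tau> \<gamma>)"
    using med by (auto simp: medial_graph_def matchings_iff)
  define P where "P = {p \<in> \<tau> \<times> \<tau>. cross_left (fst p) (snd p)}"
  obtain pt where pt: "\<And>e f. (e, f) \<in> P \<Longrightarrow> pt (e, f) \<in> path_image (\<gamma> e) \<inter> path_image (\<gamma> f)"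
    and inj: "inj_on pt P" and sub: "pt ` P \<subseteq> crossings \<tau> \<gamma>"
    using crossing_choice[OF med] unfolding P_def by blast
  have count: "cross_count \<tau> = card (pt ` P)"
    using cross_count_card[OF perfect_matching_finite(2)[OF pm]] card_image[OF inj] by (simp add: P_def)
  then show "cross_count \<tau> \<le> card (crossings \<tau> \<gamma>)" using card_mono[OF fin sub] by simp
  {
    assume "card (crossings \<tau> \<gamma>) \<le> cross_count \<tau>"
    then have img: "pt ` P = crossings \<tau> \<gamma>" using card_seteq[OF fin sub] count by simp
    have pt_unique: "z = pt (if cross_left e f then (e, f) else (f, e))"
      if ef: "e \<in> \<tau>" "f \<in> \<tau>" "e \<noteq> f" "z \<in> path_image (\<gamma> e)" "z \<in> path_image (\<gamma> f)" for e f z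
    proof -
      have z: "z \<in> crossings \<tau> \<gamma>" using ef unfolding crossings_def by blast
      then obtain p where p: "p \<in> P" "z = pt p" using img by blast
      obtain e' f' where [simp]: "p = (e', f')" by (cases p)
      obtain h g1 g2 where h: "h 0 = z" "crossing_chart \<tau> \<gamma> h g1 g2"
        using z med unfolding medial_graph_def by metis
      have in\<tau>: "e' \<in> \<tau>" "f' \<in> \<tau>" "e' \<noteq> f'" using p by (auto simp: P_def cross_left_def)
      have "g = g1 \<or> g = g2" if "g \<in> {e, f, e', f'}" for g
        using crossing_chart_strands[OF h(2), of g] pt[of e' f'] p h(1) in\<tau> ef that by auto
      then have "{e, f} \<subseteq> {g1, g2}" "{e', f'} \<subseteq> {g1, g2}" by auto
      then have "e' = e \<and> f' = f \<or> e' = f \<and> f' = e" using in\<tau>(3) ef(3) by auto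
      then show ?thesis using p by (auto simp: P_def cross_left_def)
    qed
    show "lensless \<tau> \<gamma>"
      unfolding lensless_def
    proof (intro ballI impI)
      fix e f assume "e \<in> \<tau>" "f \<in> \<tau>" "e \<noteq> f"
      then show "\<exists>\<^sub>\<le>\<^sub>1z. z \<in> path_image (\<gamma> e) \<and> z \<in> path_image (\<gamma> f)"
        unfolding Uniq_def using pt_unique by blast
    qed
  next
    assume len: "lensless \<tau> \<gamma>"
    have "crossings \<tau> \<gamma> \<subseteq> pt ` P"
    proof
      fix z assume z: "z \<in> crossings \<tau> \<gamma>"
      then obtain h e f where h: "h 0 = z" "crossing_chart \<tau> \<gamma> h e f"
        using med unfolding medial_graph_def by metis
      have ef: "e \<in> \<tau>" "f \<in> \<tau>" "e \<noteq> f" using h(2) unfolding crossing_chart_def by auto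
      have "z \<in> path_image (\<gamma> e)" "z \<in> path_image (\<gamma> f)"
        using crossing_chart_strands[OF h(2)] ef h(1) by auto
      then have meet: "path_image (\<gamma> e) \<inter> path_image (\<gamma> f) = {z}" by (rule lensless_meet[OF len ef])
      then have "cross e f" using single_crossing_imp_cross[OF med h(2)] h(1) by simp
      then consider "(e, f) \<in> P" | "(f, e) \<in> P" using ef by (auto simp: P_def cross_def)
      then show "z \<in> pt ` P"
      proof cases
        case 1
        then have "pt (e, f) = z" using pt meet by blast
        then show ?thesis using 1 by blast
      next
        case 2
        then have "pt (f, e) = z" using pt meet by blast
        then show ?thesis using 2 by blast
      qed
    qed
    then show "card (crossings \<tau> \<gamma>) = cross_count \<tau>" using sub count by simp
  }
qed

text \<open>Gives meaning to the definite description: the number of crossings is the same for all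
  lensless drawings.\<close>

lemma crossing_number_eq:
  assumes "lensless_medial_graph n \<theta> \<tau> \<gamma>"
  shows "crossing_number n \<tau> = cross_count \<tau>"
  unfolding crossing_number_def
proof (rule the_equality)
  show "\<exists>\<theta> \<gamma>. lensless_medial_graph n \<theta> \<tau> \<gamma> \<and> cross_count \<tau> = card (crossings \<tau> \<gamma>)"
    using assms medial_graph_crossings(3) unfolding lensless_medial_graph_def by metis
  fix k assume "\<exists>\<theta> \<gamma>. lensless_medial_graph n \<theta> \<tau> \<gamma> \<and> k = card (crossings \<tau> \<gamma>)"
  then show "k = cross_count \<tau>"
    using medial_graph_crossings(3) unfolding lensless_medial_graph_def by metis
qed

text \<open>\<open>K\<close> is the image of the chart. Since the new pair is disjoint and the old
  pair meets in \<open>z\<close> only, each crossing other than \<open>z\<close> involves an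
  untouched strand, hence lies outside \<open>K\<close>, where both drawings cover the same
  points.\<close>

lemma resolved_crossings:
  assumes \<tau>': "\<tau>' = (\<tau> - {e, f}) \<union> {e', f'}" and ef: "e \<in> \<tau>" "f \<in> \<tau>"
    and new: "e' \<notin> \<tau> - {e, f}" "f' \<notin> \<tau> - {e, f}" "e' \<noteq> f'"
    and same: "\<And>g. g \<in> \<tau> - {e, f} \<Longrightarrow> \<gamma>' g = \<gamma> g"
    and outside: "(path_image (\<gamma>' e') \<union> path_image (\<gamma>' f')) - K = (path_image (\<gamma> e) \<union> path_image (\<gamma> f)) - K"
    and avoid: "\<And>g. g \<in> \<tau> - {e, f} \<Longrightarrow> path_image (\<gamma> g) \<inter> K = {}"
    and meet: "path_image (\<gamma> e) \<inter> path_image (\<gamma> f) = {z}" and z: "z \<in> K"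
    and disj: "path_image (\<gamma>' e') \<inter> path_image (\<gamma>' f') = {}"
  shows "crossings \<tau>' \<gamma>' = crossings \<tau> \<gamma> - {z}"
proof -
  have union: "x \<in> path_image (\<gamma>' e') \<or> x \<in> path_image (\<gamma>' f') \<longleftrightarrow> x \<in> path_image (\<gamma> e) \<or> x \<in> path_image (\<gamma> f)"
    if "x \<notin> K" for x
    using outside that by blast
  show ?thesis
  proof (intro set_eqI iffI)
    fix x assume "x \<in> crossings \<tau>' \<gamma>'"
    then obtain g1 g2 where g: "g1 \<in> \<tau>'" "g2 \<in> \<tau>'" "g1 \<noteq> g2" "x \<in> path_image (\<gamma>' g1)" "x \<in> path_image (\<gamma>' g2)"
      unfolding crossings_def by blast
    have "\<exists>g1 g2. g1 \<in> \<tau> - {e, f} \<and> g2 \<in> \<tau>' \<and> g1 \<noteq> g2 \<and> x \<in> path_image (\<gamma>' g1) \<and> x \<in> path_image (\<gamma>' g2)"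
    proof (cases "g1 \<in> \<tau> - {e, f}")
      case False
      then have "g1 \<in> {e', f'}" using g(1) \<tau>' by blast
      then have "g2 \<in> \<tau> - {e, f}" using g \<tau>' disj by blast
      then show ?thesis using g by blast
    qed (use g in blast)
    then obtain g1 g2 where g: "g1 \<in> \<tau> - {e, f}" "g2 \<in> \<tau>'" "g1 \<noteq> g2" "x \<in> path_image (\<gamma>' g1)" "x \<in> path_image (\<gamma>' g2)"
      by blast
    have x1: "x \<in> path_image (\<gamma> g1)" using g same by simp
    then have "x \<notin> K" using avoid g(1) by blast
    then have "x \<noteq> z" using z by blast
    have "\<exists>g2\<in>\<tau>. g2 \<noteq> g1 \<and> x \<in> path_image (\<gamma> g2)"
    proof (cases "g2 \<in> \<tau> - {e, f}")
      case True
      then show ?thesis using g same by auto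
    next
      case False
      then have "x \<in> path_image (\<gamma>' e') \<or> x \<in> path_image (\<gamma>' f')" using g(2,5) \<tau>' by blast
      then have "x \<in> path_image (\<gamma> e) \<or> x \<in> path_image (\<gamma> f)" using union \<open>x \<notin> K\<close> by blast
      then show ?thesis using ef g(1) by blast
    qed
    then show "x \<in> crossings \<tau> \<gamma> - {z}"
      using x1 g(1) \<open>x \<noteq> z\<close> unfolding crossings_def by blast
  next
    fix x assume "x \<in> crossings \<tau> \<gamma> - {z}"
    then obtain g1 g2 where g: "g1 \<in> \<tau>" "g2 \<in> \<tau>" "g1 \<noteq> g2" "x \<in> path_image (\<gamma> g1)" "x \<in> path_image (\<gamma> g2)" "x \<noteq> z"
      unfolding crossings_def by blast
    have "\<exists>g1 g2. g1 \<in> \<tau> - {e, f} \<and> g2 \<in> \<tau> \<and> g1 \<noteq> g2 \<and> x \<in> path_image (\<gamma> g1) \<and> x \<in> path_image (\<gamma> g2)"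
    proof (cases "g1 \<in> \<tau> - {e, f}")
      case False
      then have "g2 \<in> \<tau> - {e, f}" using g meet by blast
      then show ?thesis using g by blast
    qed (use g in blast)
    then obtain g1 g2 where g: "g1 \<in> \<tau> - {e, f}" "g2 \<in> \<tau>" "g1 \<noteq> g2" "x \<in> path_image (\<gamma> g1)" "x \<in> path_image (\<gamma> g2)"
      by blast
    have x1: "x \<in> path_image (\<gamma>' g1)" "g1 \<in> \<tau>'" using g same \<tau>' by auto
    have "x \<notin> K" using g avoid by blast
    have "\<exists>g2\<in>\<tau>'. g2 \<noteq> g1 \<and> x \<in> path_image (\<gamma>' g2)"
    proof (cases "g2 \<in> \<tau> - {e, f}")
      case True
      then show ?thesis using g same \<tau>' by auto
    next
      case False
      then have "x \<in> path_image (\<gamma> e) \<or> x \<in> path_image (\<gamma> f)" using g by blast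
      then have "x \<in> path_image (\<gamma>' e') \<or> x \<in> path_image (\<gamma>' f')" using union \<open>x \<notin> K\<close> by blast
      moreover have "e' \<in> \<tau>'" "f' \<in> \<tau>'" using \<tau>' by simp_all
      moreover have "e' \<noteq> g1" "f' \<noteq> g1" using g(1) new(1,2) by metis+
      ultimately show ?thesis by metis
    qed
    then show "x \<in> crossings \<tau>' \<gamma>'" using x1 unfolding crossings_def by blast
  qed
qed

section \<open>From resolved drawings to covers\<close>

lemma perfect_matching_card:
  assumes "perfect_matching S \<tau>"
  shows "card S = 2 * card \<tau>"
proof -
  have "card (\<Union>\<tau>) = (\<Sum>e\<in>\<tau>. card e)"
  proof (rule card_Union_disjoint)
    show "disjoint \<tau>" using assms by (simp add: perfect_matching_def partition_on_def)
    show "finite e" if "e \<in> \<tau>" for e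
      using assms that by (intro card_ge_0_finite) (auto simp: perfect_matching_def)
  qed
  also have "\<dots> = (\<Sum>e\<in>\<tau>. 2)" by (intro sum.cong) (use assms in \<open>auto simp: perfect_matching_def\<close>)
  finally show ?thesis using perfect_matching_Union[OF assms] by simp
qed

text \<open>A resolution of drawings prescribes only the union of the new strands. This union has
  two disjoint closed parts; each strand, being connected, lies in one of them, and as both parts
  have to be covered, the strands lie in different ones.\<close>

lemma connected_parts_disjoint:
  fixes A B P Q :: "complex set"
  assumes "connected A" "connected B" "closed P" "closed Q" "P \<inter> Q = {}" "A \<union> B = P \<union> Q" "P \<noteq> {}" "Q \<noteq> {}"
  shows "A \<inter> B = {}"
proof -
  have part: "C \<subseteq> P \<or> C \<subseteq> Q" if "connected C" "C \<subseteq> P \<union> Q" for C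
    using connected_closedD[OF that(1), of P Q] that(2) assms(3-5) by blast
  have "A \<subseteq> P \<or> A \<subseteq> Q" "B \<subseteq> P \<or> B \<subseteq> Q" using part assms(1,2,6) by blast+
  then show ?thesis using assms(5-8) by blast
qed

text \<open>The new pair covers the same four points as \<open>e\<close> and \<open>f\<close>. Of
  their three pairings one is the old one, and the other two are the two resolutions.\<close>

lemma repairing_imp_resolution:
  assumes pm: "perfect_matching S \<tau>" "perfect_matching S \<tau>'" and ef: "e \<in> \<tau>" "f \<in> \<tau>" "cross e f"
    and \<tau>': "\<tau>' = (\<tau> - {e, f}) \<union> {e', f'}" and neq: "\<tau>' \<noteq> \<tau>"
  shows "resolution \<tau> \<tau>' \<and> e' \<noteq> f' \<and> e' \<notin> \<tau> - {e, f} \<and> f' \<notin> \<tau> - {e, f}"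
proof -
  have e_f: "e \<noteq> f" using ef(3) by auto
  obtain a b where e: "e = {a, b}" using perfect_matching_pair[OF pm(1) ef(1)] by metis
  obtain c d where f: "f = {c, d}" using perfect_matching_pair[OF pm(1) ef(2)] by metis
  obtain \<rho> T where *: "\<tau> = insert {a, b} (insert {c, d} \<rho>)" "perfect_matching T \<rho>"
    "distinct [a, b, c, d]" "{a, b, c, d} \<inter> T = {}" "S = {a, b, c, d} \<union> T" "\<rho> = \<tau> - {{a, b}, {c, d}}"
    using perfect_matching_split2[OF pm(1) ef(1,2)[unfolded e f] e_f[unfolded e f]] by metis
  have \<rho>: "\<rho> = \<tau> - {e, f}" using *(6) e f by simp
  have fin: "finite \<rho>" using perfect_matching_finite(2)[OF *(2)] .
  \<comment> \<open>Counting chords shows that \<open>e'\<close> and \<open>f'\<close> are two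
    different chords outside \<open>\<rho>\<close>.\<close>
  have "card \<tau> = card \<tau>'" using perfect_matching_card[OF pm(1)] perfect_matching_card[OF pm(2)] by simp
  moreover have "card \<tau> = card \<rho> + 2"
    using perfect_matching_card[OF pm(1)] perfect_matching_card[OF *(2)] *(3,4,5) perfect_matching_finite(1)[OF *(2)]
    by (simp add: card_Un_disjoint)
  ultimately have card: "card (insert e' (insert f' \<rho>)) = card \<rho> + 2" using \<tau>' \<rho> by simp
  have f': "f' \<notin> \<rho>"
  proof
    assume "f' \<in> \<rho>"
    then show False using card fin by (simp add: insert_absorb card_insert_if split: if_splits)
  qed
  have e': "e' \<notin> insert f' \<rho>"
  proof
    assume "e' \<in> insert f' \<rho>"
    then show False using card fin f' by (simp add: insert_absorb)
  qed
  have \<tau>'_eq: "\<tau>' = insert e' (insert f' \<rho>)" using \<tau>' \<rho> by blast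
  have main: "resolution \<tau> \<tau>'" if "a \<in> u" "\<tau>' = insert u (insert v \<rho>)" "u \<notin> \<rho>" "v \<notin> \<rho>" "u \<noteq> v" for u v
  proof -
    have U: "u \<inter> v = {}" "u \<inter> T = {}" "v \<inter> T = {}"
      using perfect_matching_disjoint[OF pm(2)] that(2-5) perfect_matching_Union[OF *(2)] by blast+
    have "u \<union> v \<union> T = {a, b, c, d} \<union> T"
      using perfect_matching_Union[OF pm(2)] perfect_matching_Union[OF *(2)] that(2) *(5) by (simp add: Un_assoc)
    then have uv: "u \<union> v = {a, b, c, d}" using U *(4) by blast
    have "card u = 2" using pm(2) that(2) by (simp add: perfect_matching_def)
    then obtain x1 x2 where x12: "u = {x1, x2}" "x1 \<noteq> x2" unfolding card_2_iff by blast
    obtain x where x: "u = {a, x}" "x \<noteq> a"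
    proof (cases "a = x1")
      case True
      then show ?thesis using x12 by (intro that[of x2]) auto
    next
      case False
      then have "a = x2" using \<open>a \<in> u\<close> x12 by simp
      then show ?thesis using x12 by (intro that[of x1]) auto
    qed
    have v: "v = {a, b, c, d} - {a, x}" using uv U(1) x by blast
    have "x = b \<or> x = c \<or> x = d" using uv x by blast
    then show ?thesis
    proof (elim disjE)
      assume "x = b"
      then have "v = {c, d}" using v *(3) by auto
      then have "\<tau>' = \<tau>" using that(2) x \<open>x = b\<close> *(1) by simp
      then show ?thesis using neq by simp
    next
      assume "x = c"
      then have "v = {b, d}" using v *(3) by auto
      then show ?thesis
        using resolutionI[OF *(2,3,4) ef(3)[unfolded e f] *(1)] that(2) x \<open>x = c\<close> by simp
    next
      assume "x = d"
      then have v': "v = {b, c}" using v *(3) by auto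
      show ?thesis
      proof (rule resolutionI[OF *(2)])
        show "distinct [a, b, d, c]" using *(3) by auto
        show "{a, b, d, c} \<inter> T = {}" using *(4) by auto
        show "cross {a, b} {d, c}" using ef(3) e f by (simp add: insert_commute)
        show "\<tau> = insert {a, b} (insert {d, c} \<rho>)" using *(1) by (simp add: insert_commute)
        show "\<tau>' = insert {a, d} (insert {b, c} \<rho>)" using that(2) x v' \<open>x = d\<close> by simp
      qed
    qed
  qed
  have "a \<in> S" "a \<notin> T" using *(4,5) by auto
  then have "a \<in> e' \<or> a \<in> f'"
    using perfect_matching_Union[OF pm(2)] perfect_matching_Union[OF *(2)] \<tau>'_eq by auto
  then have "resolution \<tau> \<tau>'"
  proof
    assume "a \<in> e'"
    then show ?thesis using main[of e' f'] \<tau>'_eq e' f' by blast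
  next
    assume "a \<in> f'"
    moreover have "\<tau>' = insert f' (insert e' \<rho>)" using \<tau>'_eq by (simp add: insert_commute)
    ultimately show ?thesis using main[of f' e'] e' f' by blast
  qed
  then show ?thesis using e' f' \<rho> by blast
qed

text \<open>Both drawings are lensless, so their numbers of crossings are the counts of crossing
  chords, and the passage between them removes exactly one crossing.\<close>

lemma uncrosses_imp_cover:
  assumes "uncrosses n \<tau>' \<tau>"
  shows "uncross_cover \<tau>' \<tau>" "perfect_matching {1..2 * n} \<tau>"
proof -
  obtain \<theta> \<gamma> \<gamma>' where lm: "lensless_medial_graph n \<theta> \<tau> \<gamma>" "lensless_medial_graph n \<theta> \<tau>' \<gamma>'"
    and res: "resolves \<tau> \<gamma> \<tau>' \<gamma>'" using assms unfolding uncrosses_def by blast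
  then have med: "medial_graph n \<theta> \<tau> \<gamma>" "medial_graph n \<theta> \<tau>' \<gamma>'"
    and len: "lensless \<tau> \<gamma>" "lensless \<tau>' \<gamma>'" by (auto simp: lensless_medial_graph_def)
  have pm: "perfect_matching {1..2 * n} \<tau>" "perfect_matching {1..2 * n} \<tau>'"
    using med by (auto simp: medial_graph_def matchings_iff)
  show "perfect_matching {1..2 * n} \<tau>" by (rule pm(1))
  obtain h e f e' f' where chart: "crossing_chart \<tau> \<gamma> h e f"
    and \<tau>': "\<tau>' = (\<tau> - {e, f}) \<union> {e', f'}" and same: "\<forall>g \<in> \<tau> - {e, f}. \<gamma>' g = \<gamma> g"
    and outside: "(path_image (\<gamma>' e') \<union> path_image (\<gamma>' f')) - h ` square =
          (path_image (\<gamma> e) \<union> path_image (\<gamma> f)) - h ` square"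
    and inside: "{w \<in> square. h w \<in> path_image (\<gamma>' e') \<union> path_image (\<gamma>' f')} \<in> {smoothing1, smoothing2}"
    using res unfolding resolves_def by (elim exE conjE) (rule that)
  have ef: "e \<in> \<tau>" "f \<in> \<tau>" "e \<noteq> f" using chart unfolding crossing_chart_def by auto
  have avoid: "path_image (\<gamma> g) \<inter> h ` square = {}" if "g \<in> \<tau> - {e, f}" for g
    using chart that unfolding crossing_chart_def by blast
  have z: "h 0 \<in> h ` square" by (auto simp: square_def)
  have "h 0 \<in> path_image (\<gamma> e)" "h 0 \<in> path_image (\<gamma> f)"
    using crossing_chart_strands[OF chart] ef by auto
  then have meet: "path_image (\<gamma> e) \<inter> path_image (\<gamma> f) = {h 0}" by (rule lensless_meet[OF len(1) ef])
  have cr: "cross e f" by (rule single_crossing_imp_cross[OF med(1) chart meet])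
  obtain a b c d g1 g2 g3 g4 where
    g12: "disk_path (cis (\<theta> a)) (cis (\<theta> d)) g1" "disk_path (cis (\<theta> b)) (cis (\<theta> c)) g2"
    "path_image g1 \<inter> path_image g2 = {}"
    "((path_image (\<gamma> e) \<union> path_image (\<gamma> f)) - h ` square) \<union> h ` smoothing1 = path_image g1 \<union> path_image g2"
    and g34: "disk_path (cis (\<theta> a)) (cis (\<theta> c)) g3" "disk_path (cis (\<theta> b)) (cis (\<theta> d)) g4"
    "path_image g3 \<inter> path_image g4 = {}"
    "((path_image (\<gamma> e) \<union> path_image (\<gamma> f)) - h ` square) \<union> h ` smoothing2 = path_image g3 \<union> path_image g4"
    by (rule chart_resolution[OF med(1) chart meet])
  have union: "path_image (\<gamma>' e') \<union> path_image (\<gamma>' f') =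
      ((path_image (\<gamma> e) \<union> path_image (\<gamma> f)) - h ` square) \<union> h ` X"
    if "{w \<in> square. h w \<in> path_image (\<gamma>' e') \<union> path_image (\<gamma>' f')} = X" for X
    unfolding that[symmetric] outside[symmetric] by blast
  have "\<exists>g g'. path g \<and> path g' \<and> path_image g \<inter> path_image g' = {} \<and>
      path_image (\<gamma>' e') \<union> path_image (\<gamma>' f') = path_image g \<union> path_image g'"
  proof -
    let ?R = "{w \<in> square. h w \<in> path_image (\<gamma>' e') \<union> path_image (\<gamma>' f')}"
    have "?R = smoothing1 \<or> ?R = smoothing2" using inside by (simp only: insert_iff empty_iff simp_thms)
    then show ?thesis
    proof
      assume "?R = smoothing1"
      from union[OF this, unfolded g12(4)] show ?thesis
        using g12(1-3) unfolding disk_path_def by blast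
    next
      assume "?R = smoothing2"
      from union[OF this, unfolded g34(4)] show ?thesis
        using g34(1-3) unfolding disk_path_def by blast
    qed
  qed
  then obtain g g' where g: "path g" "path g'" "path_image g \<inter> path_image g' = {}"
      "path_image (\<gamma>' e') \<union> path_image (\<gamma>' f') = path_image g \<union> path_image g'" by blast
  have "path (\<gamma>' k)" if "k \<in> {e', f'}" for k
  proof -
    have "strand \<theta> k (\<gamma>' k)" using med(2) \<tau>' that unfolding medial_graph_def by blast
    then show ?thesis by (simp add: strand_def arc_imp_path)
  qed
  then have conn: "connected (path_image (\<gamma>' e'))" "connected (path_image (\<gamma>' f'))"
    using connected_path_image by blast+
  have disj: "path_image (\<gamma>' e') \<inter> path_image (\<gamma>' f') = {}"
    by (rule connected_parts_disjoint[OF conn closed_path_image[OF g(1)] closed_path_image[OF g(2)] g(3,4)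
        path_image_nonempty path_image_nonempty])
  \<comment> \<open>Otherwise \<open>e\<close> and \<open>f\<close> would be the new pair, whose
    strands are disjoint, although strands of crossing chords always meet.\<close>
  have neq: "\<tau>' \<noteq> \<tau>"
  proof
    assume eq: "\<tau>' = \<tau>"
    then have "e \<in> {e', f'}" "f \<in> {e', f'}" using \<tau>' ef by blast+
    then have "{e, f} = {e', f'}" using ef(3) by auto
    then have "path_image (\<gamma>' e) \<inter> path_image (\<gamma>' f) = {}"
      using disj by (auto simp: doubleton_eq_iff)
    then show False using crossing_strands_meet[OF med(2) _ _ cr] ef eq by blast
  qed
  have r: "resolution \<tau> \<tau>'" "e' \<noteq> f'" "e' \<notin> \<tau> - {e, f}" "f' \<notin> \<tau> - {e, f}"
    using repairing_imp_resolution[OF pm ef(1,2) cr \<tau>' neq] by auto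
  have cs: "crossings \<tau>' \<gamma>' = crossings \<tau> \<gamma> - {h 0}"
    by (rule resolved_crossings[OF \<tau>' ef(1,2) r(3,4,2) _ outside avoid meet z disj]) (use same in blast)
  have "finite (crossings \<tau> \<gamma>)" using med(1) by (simp add: medial_graph_def)
  then have "card (crossings \<tau> \<gamma>) = Suc (card (crossings \<tau>' \<gamma>'))"
    unfolding cs using crossing_chart_in_crossings[OF chart] by (rule card.remove)
  then show "uncross_cover \<tau>' \<tau>"
    using medial_graph_crossings(3)[OF med(1) len(1)] medial_graph_crossings(3)[OF med(2) len(2)] r(1)
    by (simp add: uncross_cover_def)
qed

section \<open>Straight chords in general position\<close>

text \<open>The determinant of two plane vectors; it vanishes for parallel ones.\<close>

definition cross_product :: "complex \<Rightarrow> complex \<Rightarrow> real" where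
  "cross_product u v = Re u * Im v - Im u * Re v"

lemma cross_product_independent:
  assumes "cross_product u v \<noteq> 0" "of_real s * u = of_real t * v"
  shows "s = 0" "t = 0"
proof -
  have 1: "s * Re u = t * Re v" "s * Im u = t * Im v"
    using arg_cong[OF assms(2), of Re] arg_cong[OF assms(2), of Im] by simp_all
  have "s * cross_product u v = (s * Re u) * Im v - (s * Im u) * Re v"
    by (simp add: cross_product_def algebra_simps)
  also have "\<dots> = 0" unfolding 1 by simp
  finally show "s = 0" using assms(1) by simp
  have "t * cross_product u v = (t * Im v) * Re u - (t * Re v) * Im u"
    by (simp add: cross_product_def algebra_simps)
  also have "\<dots> = 0" unfolding 1[symmetric] by simp
  finally show "t = 0" using assms(1) by simp
qed

lemma cross_product_dependent:
  assumes "cross_product u v = 0" "u \<noteq> 0"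
  obtains k :: real where "v = of_real k * u"
proof -
  define N where "N = (Re u)\<^sup>2 + (Im u)\<^sup>2"
  have N: "N \<noteq> 0" using assms(2) by (simp add: N_def sum_power2_eq_zero_iff complex_eq_iff)
  define k where "k = (Re u * Re v + Im u * Im v) / N"
  have c: "Re u * Im v = Im u * Re v" using assms(1) by (simp add: cross_product_def)
  have "N * Re v = (Re u * Re v + Im u * Im v) * Re u"
  proof -
    have "(Re u * Re v + Im u * Im v) * Re u = (Re u)\<^sup>2 * Re v + Im u * (Re u * Im v)"
      by (simp add: algebra_simps power2_eq_square)
    also have "\<dots> = N * Re v" unfolding c by (simp add: N_def algebra_simps power2_eq_square)
    finally show ?thesis by simp
  qed
  then have 1: "Re v = k * Re u" using N by (simp add: k_def field_simps)
  have "N * Im v = (Re u * Re v + Im u * Im v) * Im u"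
  proof -
    have "(Re u * Re v + Im u * Im v) * Im u = Re u * (Im u * Re v) + (Im u)\<^sup>2 * Im v"
      by (simp add: algebra_simps power2_eq_square)
    also have "\<dots> = N * Im v" unfolding c[symmetric] by (simp add: N_def algebra_simps power2_eq_square)
    finally show ?thesis by simp
  qed
  then have 2: "Im v = k * Im u" using N by (simp add: k_def field_simps)
  show ?thesis by (rule that[of k]) (simp add: complex_eq_iff 1 2)
qed

text \<open>This is the power of a point on the line through \<open>A\<close> and \<open>B\<close>
  with respect to the unit circle; its sign shows which part of the line is inside.\<close>

lemma norm_chord_point:
  assumes "cmod A = 1" "cmod B = 1"
  shows "(norm (A + of_real t * (B - A)))\<^sup>2 = 1 - t * (1 - t) * (norm (B - A))\<^sup>2"
proof -
  have "(Re A)\<^sup>2 + (Im A)\<^sup>2 = 1" "(Re B)\<^sup>2 + (Im B)\<^sup>2 = 1"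
    using assms by (simp_all add: cmod_def)
  then have "(Re A + t * (Re B - Re A))\<^sup>2 + (Im A + t * (Im B - Im A))\<^sup>2 =
      1 - t * (1 - t) * ((Re B - Re A)\<^sup>2 + (Im B - Im A)\<^sup>2)" by algebra
  then show ?thesis unfolding cmod_power2 by simp
qed

lemma in_chord:
  "z \<in> closed_segment A B \<longleftrightarrow> (\<exists>t::real. 0 \<le> t \<and> t \<le> 1 \<and> z = A + of_real t * (B - A))"
  for A B z :: complex
  by (auto simp: in_segment scaleR_conv_of_real algebra_simps)

lemma chord_norm_less:
  assumes "cmod A = 1" "cmod B = 1" "A \<noteq> B" "0 < t" "t < 1"
  shows "norm (A + of_real t * (B - A)) < 1"
proof -
  have "t * (1 - t) * (norm (B - A))\<^sup>2 > 0" using assms(3-5) by simp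
  then have "(norm (A + of_real t * (B - A)))\<^sup>2 < 1\<^sup>2" using norm_chord_point[OF assms(1,2), of t] by simp
  then show ?thesis by (rule power_less_imp_less_base) simp
qed

lemma chord_line_meets_circle:
  assumes "cmod A = 1" "cmod B = 1" "A \<noteq> B" "norm (A + of_real t * (B - A)) = 1"
  shows "t = 0 \<or> t = 1"
proof -
  have "t * (1 - t) * (norm (B - A))\<^sup>2 = 0" using norm_chord_point[OF assms(1,2), of t] assms(4) by simp
  then show ?thesis using assms(3) by simp
qed

text \<open>Only the ends of a chord are on the circle, and the four ends are distinct, so a common
  point is an inner one. Parallel chords with a common point would lie on one line, which meets the
  circle in two points only.\<close>

lemma chords_transversal:
  assumes norm: "cmod A = 1" "cmod B = 1" "cmod C = 1" "cmod D = 1" and dist: "distinct [A, B, C, D]"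
    and z: "z \<in> closed_segment A B" "z \<in> closed_segment C D"
  obtains s t where "0 < s" "s < 1" "z = A + of_real s * (B - A)"
    "0 < t" "t < 1" "z = C + of_real t * (D - C)" "cross_product (B - A) (D - C) \<noteq> 0"
proof -
  have AB: "A \<noteq> B" and CD: "C \<noteq> D" using dist by auto
  obtain s where s: "0 \<le> s" "s \<le> 1" "z = A + of_real s * (B - A)" using z(1) unfolding in_chord by blast
  obtain t where t: "0 \<le> t" "t \<le> 1" "z = C + of_real t * (D - C)" using z(2) unfolding in_chord by blast
  have "norm z < 1"
  proof (rule ccontr)
    assume "\<not> norm z < 1"
    then have "\<not> (0 < s \<and> s < 1)" "\<not> (0 < t \<and> t < 1)"
      using chord_norm_less[OF norm(1,2) AB, of s] chord_norm_less[OF norm(3,4) CD, of t] s(3) t(3) by auto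
    then have "s = 0 \<or> s = 1" "t = 0 \<or> t = 1" using s t by auto
    then have "z = A \<or> z = B" "z = C \<or> z = D" using s(3) t(3) by auto
    then show False using dist by auto
  qed
  then have "s \<noteq> 0" "s \<noteq> 1" "t \<noteq> 0" "t \<noteq> 1" using s(3) t(3) norm by auto
  then have st: "0 < s" "s < 1" "0 < t" "t < 1" using s t by auto
  have "cross_product (B - A) (D - C) \<noteq> 0"
  proof
    assume "cross_product (B - A) (D - C) = 0"
    then obtain k where k: "D - C = of_real k * (B - A)" using cross_product_dependent AB by (metis eq_iff_diff_eq_0)
    have "C = z - of_real t * (D - C)" using t(3) by simp
    then have C: "C = A + of_real (s - t * k) * (B - A)" unfolding k s(3) by (simp add: algebra_simps)
    then have "s - t * k = 0 \<or> s - t * k = 1"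
      using chord_line_meets_circle[OF norm(1,2) AB, of "s - t * k"] norm(3) by simp
    then have "C = A \<or> C = B" using C by (auto simp del: of_real_diff of_real_mult)
    then show False using dist by auto
  qed
  then show ?thesis using that st s(3) t(3) by blast
qed

lemma chords_meet_once:
  assumes norm: "cmod A = 1" "cmod B = 1" "cmod C = 1" "cmod D = 1" and dist: "distinct [A, B, C, D]"
    and z: "z \<in> closed_segment A B" "z \<in> closed_segment C D"
    and z': "z' \<in> closed_segment A B" "z' \<in> closed_segment C D"
  shows "z = z'"
proof -
  obtain s t where st: "z = A + of_real s * (B - A)" "z = C + of_real t * (D - C)"
    "cross_product (B - A) (D - C) \<noteq> 0"
    using chords_transversal[OF norm dist z] by metis
  obtain s' t' where st': "z' = A + of_real s' * (B - A)" "z' = C + of_real t' * (D - C)"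
    using chords_transversal[OF norm dist z'] by metis
  have "of_real (s - s') * (B - A) = z - z'" unfolding st(1) st'(1) by (simp add: algebra_simps)
  also have "\<dots> = of_real (t - t') * (D - C)" unfolding st(2) st'(2) by (simp add: algebra_simps)
  finally have "s - s' = 0" by (rule cross_product_independent(1)[OF st(3)])
  then show ?thesis using st(1) st'(1) by simp
qed

text \<open>The convex hull makes the chord a function of the unordered pair.\<close>

definition chord :: "(nat \<Rightarrow> real) \<Rightarrow> nat set \<Rightarrow> complex set" where
  "chord \<theta> e = convex hull ((\<lambda>i. cis (\<theta> i)) ` e)"

lemma chord_pair [simp]: "chord \<theta> {a, b} = closed_segment (cis (\<theta> a)) (cis (\<theta> b))"
  by (simp add: chord_def segment_convex_hull)

section \<open>Angles in general position\<close>

definition labelled_angles :: "nat \<Rightarrow> (nat \<Rightarrow> real) \<Rightarrow> bool" where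
  "labelled_angles m \<theta> \<longleftrightarrow> strict_mono_on {1..m} \<theta> \<and> (\<forall>i\<in>{1..m}. 0 < \<theta> i \<and> \<theta> i < 2 * pi)"

text \<open>A chart admits only two strands at a crossing, so no three chords may be concurrent. All
  disjoint chords on the labels are considered, not just those of one matching, so the same angles
  serve every matching.\<close>

definition generic_angles :: "nat \<Rightarrow> (nat \<Rightarrow> real) \<Rightarrow> bool" where
  "generic_angles m \<theta> \<longleftrightarrow> (\<forall>e f g. e \<union> f \<union> g \<subseteq> {1..m} \<and> card e = 2 \<and> card f = 2 \<and> card g = 2 \<and>
     e \<inter> f = {} \<and> e \<inter> g = {} \<and> f \<inter> g = {} \<longrightarrow> chord \<theta> e \<inter> chord \<theta> f \<inter> chord \<theta> g = {})"

lemma cis_inject_2pi: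
  assumes "0 < s" "s < 2 * pi" "0 < t" "t < 2 * pi" "cis s = cis t"
  shows "s = t"
proof -
  have less: "\<not> x < y" if "0 < x" "y < 2 * pi" "cis x = cis y" for x y
  proof
    assume "x < y"
    then have "cis (y - x) \<noteq> 1" using that by (intro cis_neq_1) auto
    then show False using that(3) by (simp flip: cis_divide)
  qed
  show ?thesis using less[of s t] less[of t s] assms by simp
qed

lemma labelled_angles_inject:
  assumes "labelled_angles m \<theta>" "i \<in> {1..m}" "j \<in> {1..m}" "cis (\<theta> i) = cis (\<theta> j)"
  shows "i = j"
proof -
  have "\<theta> i = \<theta> j" using assms by (intro cis_inject_2pi) (auto simp: labelled_angles_def)
  moreover have "inj_on \<theta> {1..m}"
    using assms(1) strict_mono_on_imp_inj_on unfolding labelled_angles_def by blast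
  ultimately show ?thesis using assms(2,3) by (meson inj_onD)
qed

lemma pair_subset:
  assumes "card e = 2" "e \<subseteq> {1..m}"
  obtains a b where "e = {a, b}" "a \<noteq> b" "a \<in> {1..m}" "b \<in> {1..m}"
  using assms unfolding card_2_iff by auto

lemma finite_chord_meetings:
  assumes lab: "labelled_angles m \<theta>"
  shows "finite {z. \<exists>e f. e \<union> f \<subseteq> {1..m} \<and> card e = 2 \<and> card f = 2 \<and> e \<inter> f = {} \<and> z \<in> chord \<theta> e \<inter> chord \<theta> f}"
    (is "finite ?X")
proof -
  have one: "\<exists>w. chord \<theta> e \<inter> chord \<theta> f \<subseteq> {w}"
    if ef: "e \<union> f \<subseteq> {1..m}" "card e = 2" "card f = 2" "e \<inter> f = {}" for e f
  proof -
    have sub: "e \<subseteq> {1..m}" "f \<subseteq> {1..m}" using ef(1) by auto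
    obtain a b where ab: "e = {a, b}" "a \<noteq> b" "a \<in> {1..m}" "b \<in> {1..m}"
      by (rule pair_subset[OF ef(2) sub(1)])
    obtain c d where cd: "f = {c, d}" "c \<noteq> d" "c \<in> {1..m}" "d \<in> {1..m}"
      by (rule pair_subset[OF ef(3) sub(2)])
    have "distinct [a, b, c, d]" using ab cd ef(4) by auto
    then have dist: "distinct [cis (\<theta> a), cis (\<theta> b), cis (\<theta> c), cis (\<theta> d)]"
      using labelled_angles_inject[OF lab] ab cd by (metis distinct_length_2_or_more distinct_singleton)
    have "z = z'" if "z \<in> chord \<theta> e \<inter> chord \<theta> f" "z' \<in> chord \<theta> e \<inter> chord \<theta> f" for z z'
      by (rule chords_meet_once[OF _ _ _ _ dist]) (use that ab(1) cd(1) in auto)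
    then show ?thesis by blast
  qed
  let ?Q = "{(e, f). e \<union> f \<subseteq> {1..m} \<and> card e = 2 \<and> card f = 2 \<and> e \<inter> f = {}}"
  have "?Q \<subseteq> Pow {1..m} \<times> Pow {1..m}" by auto
  then have "finite ?Q" by (rule finite_subset) simp
  moreover have "finite (chord \<theta> (fst p) \<inter> chord \<theta> (snd p))" if p: "p \<in> ?Q" for p
  proof -
    obtain w where "chord \<theta> (fst p) \<inter> chord \<theta> (snd p) \<subseteq> {w}"
      using one[of "fst p" "snd p"] p by (auto simp: case_prod_unfold)
    then show ?thesis by (rule finite_subset) simp
  qed
  ultimately have "finite (\<Union>p\<in>?Q. chord \<theta> (fst p) \<inter> chord \<theta> (snd p))" by blast
  moreover have "?X \<subseteq> (\<Union>p\<in>?Q. chord \<theta> (fst p) \<inter> chord \<theta> (snd p))"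
  proof
    fix z assume "z \<in> ?X"
    then obtain e f where "(e, f) \<in> ?Q" "z \<in> chord \<theta> e \<inter> chord \<theta> f" by blast
    then show "z \<in> (\<Union>p\<in>?Q. chord \<theta> (fst p) \<inter> chord \<theta> (snd p))"
      by (intro UN_I[of "(e, f)"]) simp_all
  qed
  ultimately show ?thesis by (rule finite_subset[rotated])
qed

text \<open>The line through \<open>A\<close> and \<open>z\<close> has only one more point on the
  circle. So for fixed \<open>A\<close>, a point \<open>z\<close> forbids at most one position of
  the other end.\<close>

lemma chord_through_point_unique:
  assumes "cmod A = 1" "cmod P = 1" "cmod P' = 1" "z \<noteq> A" "z \<in> closed_segment A P" "z \<in> closed_segment A P'"
  shows "P = P'"
proof -
  obtain s where s: "0 \<le> s" "z = A + of_real s * (P - A)" using assms(5) unfolding in_chord by blast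
  obtain s' where s': "0 \<le> s'" "z = A + of_real s' * (P' - A)" using assms(6) unfolding in_chord by blast
  have nz: "s \<noteq> 0" "s' \<noteq> 0" "P \<noteq> A" "P' \<noteq> A" using s s' assms(4) by auto
  have "of_real s' * (P' - A) = of_real s * (P - A)" using s(2) s'(2) by simp
  then have "P' - A = of_real (s / s') * (P - A)" using nz by (simp add: field_simps)
  then have P': "P' = A + of_real (s / s') * (P - A)" by (simp add: algebra_simps)
  then have "s / s' = 0 \<or> s / s' = 1"
    using chord_line_meets_circle[OF assms(1,2) nz(3)[symmetric], of "s / s'"] assms(3) by simp
  then show ?thesis using P' nz by auto
qed

text \<open>Points are added one at a time. The earlier chords have finitely many meeting points,
  and each of them, together with an earlier end, forbids at most one angle for the new
  point.\<close>

lemma generic_angles_exist: "\<exists>\<theta>. labelled_angles m \<theta> \<and> generic_angles m \<theta>"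
proof (induction m)
  case 0
  have "generic_angles 0 (\<lambda>_. 0)" by (auto simp: generic_angles_def)
  then show ?case by (auto simp: labelled_angles_def intro!: exI[of _ "\<lambda>_. 0"] strict_mono_onI)
next
  case (Suc m)
  then obtain \<theta> where lab: "labelled_angles m \<theta>" and gen: "generic_angles m \<theta>" by blast
  define X where "X = {z. \<exists>e f. e \<union> f \<subseteq> {1..m} \<and> card e = 2 \<and> card f = 2 \<and> e \<inter> f = {} \<and> z \<in> chord \<theta> e \<inter> chord \<theta> f}"
  have finX: "finite X" unfolding X_def by (rule finite_chord_meetings[OF lab])
  \<comment> \<open>The new angle must exceed the earlier ones; for \<open>m = 0\<close> it only has
    to be positive.\<close>
  define M where "M = (if m = 0 then 0 else \<theta> m)"
  have M: "0 \<le> M" "M < 2 * pi" using lab by (auto simp: M_def labelled_angles_def less_imp_le)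
  have \<theta>M: "\<theta> i \<le> M" if "i \<in> {1..m}" for i
  proof (cases "i = m")
    case False
    then have "\<theta> i < \<theta> m"
      using lab that strict_mono_onD[of "{1..m}" \<theta> i m] unfolding labelled_angles_def by simp
    then show ?thesis using that by (simp add: M_def)
  qed (use that in \<open>simp add: M_def\<close>)
  define bad where "bad a z = {\<phi>\<in>{M<..<2*pi}. z \<in> closed_segment (cis (\<theta> a)) (cis \<phi>)}" for a z
  have fin_bad: "finite (bad a z)" if "z \<noteq> cis (\<theta> a)" for a z
  proof -
    have "\<phi> = \<psi>" if "\<phi> \<in> bad a z" "\<psi> \<in> bad a z" for \<phi> \<psi>
    proof -
      have "cis \<phi> = cis \<psi>"
        by (rule chord_through_point_unique[of "cis (\<theta> a)" _ _ z]) (use that \<open>z \<noteq> cis (\<theta> a)\<close> in \<open>auto simp: bad_def\<close>)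
      then show ?thesis using that M by (intro cis_inject_2pi) (auto simp: bad_def)
    qed
    then have "bad a z = {} \<or> (\<exists>\<phi>. bad a z = {\<phi>})" by blast
    then show ?thesis by auto
  qed
  define Bad where "Bad = (\<Union>a\<in>{1..m}. \<Union>z\<in>X - {cis (\<theta> a)}. bad a z)"
  have "finite Bad" unfolding Bad_def using finX fin_bad by blast
  then have "infinite ({M<..<2*pi} - Bad)" using M by (intro Diff_infinite_finite) auto
  then obtain \<phi> where \<phi>: "\<phi> \<in> {M<..<2*pi}" "\<phi> \<notin> Bad" using infinite_imp_nonempty by blast
  define \<theta>' where "\<theta>' = \<theta>(Suc m := \<phi>)"
  have old: "\<theta>' i = \<theta> i" if "i \<in> {1..m}" for i using that by (simp add: \<theta>'_def)
  have new: "\<theta>' (Suc m) = \<phi>" by (simp add: \<theta>'_def)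
  have lab': "labelled_angles (Suc m) \<theta>'"
    unfolding labelled_angles_def
  proof (intro conjI ballI strict_mono_onI)
    fix i j :: nat assume ij: "i \<in> {1..Suc m}" "j \<in> {1..Suc m}" "i < j"
    then have i: "i \<in> {1..m}" by auto
    show "\<theta>' i < \<theta>' j"
    proof (cases "j = Suc m")
      case True
      then show ?thesis using \<theta>M[OF i] \<phi>(1) old[OF i] new by simp
    next
      case False
      then have j: "j \<in> {1..m}" using ij by auto
      then show ?thesis
        using lab i ij(3) old[OF i] old[OF j] strict_mono_onD[of "{1..m}" \<theta> i j]
        unfolding labelled_angles_def by simp
    qed
  next
    fix i assume "i \<in> {1..Suc m}"
    then have "i \<in> {1..m} \<or> i = Suc m" by auto
    then have "0 < \<theta>' i \<and> \<theta>' i < 2 * pi"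
      using lab \<phi>(1) M old new unfolding labelled_angles_def by auto
    then show "0 < \<theta>' i" "\<theta>' i < 2 * pi" by auto
  qed
  have chord_old: "chord \<theta>' e = chord \<theta> e" if "e \<subseteq> {1..m}" for e
  proof -
    have "(\<lambda>i. cis (\<theta>' i)) ` e = (\<lambda>i. cis (\<theta> i)) ` e" using old that by (intro image_cong) auto
    then show ?thesis by (simp add: chord_def)
  qed
  \<comment> \<open>At most one of three disjoint chords ends in the new point; if there is one, it
    takes the place of \<open>g\<close>.\<close>
  have main: "chord \<theta>' e \<inter> chord \<theta>' f \<inter> chord \<theta>' g = {}"
    if *: "e \<subseteq> {1..m}" "f \<subseteq> {1..m}" "g \<subseteq> {1..Suc m}" "card e = 2" "card f = 2" "card g = 2"
       "e \<inter> f = {}" "e \<inter> g = {}" "f \<inter> g = {}" for e f g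
  proof (cases "Suc m \<in> g")
    case False
    then have "g \<subseteq> {1..m}" using *(3) by (auto simp: atLeastAtMostSuc_conv)
    then show ?thesis using gen * unfolding generic_angles_def by (simp add: chord_old)
  next
    case True
    obtain x y where xy: "g = {x, y}" "x \<noteq> y" "x \<in> {1..Suc m}" "y \<in> {1..Suc m}"
      by (rule pair_subset[OF *(6,3)])
    obtain a where a: "g = {a, Suc m}" "a \<in> {1..m}"
    proof (cases "x = Suc m")
      case True
      then show ?thesis using xy by (intro that[of y]) auto
    next
      case False
      then have "y = Suc m" using xy \<open>Suc m \<in> g\<close> by auto
      then show ?thesis using xy False by (intro that[of x]) auto
    qed
    show ?thesis
    proof (rule ccontr)
      assume "chord \<theta>' e \<inter> chord \<theta>' f \<inter> chord \<theta>' g \<noteq> {}"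
      then obtain z where z: "z \<in> chord \<theta> e" "z \<in> chord \<theta> f" "z \<in> chord \<theta>' g"
        using chord_old *(1,2) by auto
      then have zX: "z \<in> X" using * unfolding X_def by blast
      obtain p q where pq: "e = {p, q}" "p \<noteq> q" "p \<in> {1..m}" "q \<in> {1..m}" by (rule pair_subset[OF *(4,1)])
      obtain r s where rs: "f = {r, s}" "r \<noteq> s" "r \<in> {1..m}" "s \<in> {1..m}" by (rule pair_subset[OF *(5,2)])
      have "distinct [p, q, r, s]" using pq rs *(7) by auto
      then have dist: "distinct [cis (\<theta> p), cis (\<theta> q), cis (\<theta> r), cis (\<theta> s)]"
        using labelled_angles_inject[OF lab] pq rs by (metis distinct_length_2_or_more distinct_singleton)
      \<comment> \<open>Meeting points are inner points of the disk and so differ from all ends, as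
        the definition of \<open>Bad\<close> demands.\<close>
      have "z \<in> closed_segment (cis (\<theta> p)) (cis (\<theta> q))" "z \<in> closed_segment (cis (\<theta> r)) (cis (\<theta> s))"
        using z pq(1) rs(1) by auto
      then obtain t where "0 < t" "t < 1" "z = cis (\<theta> p) + of_real t * (cis (\<theta> q) - cis (\<theta> p))"
        by (rule chords_transversal[OF _ _ _ _ dist, rotated 4]) auto
      then have "norm z < 1" using chord_norm_less[of "cis (\<theta> p)" "cis (\<theta> q)" t] dist by simp
      then have "z \<noteq> cis (\<theta> a)" by auto
      moreover have "z \<in> closed_segment (cis (\<theta> a)) (cis \<phi>)" using z(3) a old[OF a(2)] new by simp
      ultimately have "\<phi> \<in> Bad" unfolding Bad_def bad_def using a(2) zX \<phi>(1) by blast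
      then show False using \<phi>(2) by blast
    qed
  qed
  have sub: "e \<subseteq> {1..m}" if "e \<subseteq> {1..Suc m}" "Suc m \<notin> e" for e :: "nat set"
    using that by (auto simp: atLeastAtMostSuc_conv)
  have "generic_angles (Suc m) \<theta>'"
    unfolding generic_angles_def
  proof (intro allI impI, elim conjE)
    fix e f g :: "nat set"
    assume *: "e \<union> f \<union> g \<subseteq> {1..Suc m}" "card e = 2" "card f = 2" "card g = 2" "e \<inter> f = {}" "e \<inter> g = {}" "f \<inter> g = {}"
    then have S: "e \<subseteq> {1..Suc m}" "f \<subseteq> {1..Suc m}" "g \<subseteq> {1..Suc m}" by auto
    consider "Suc m \<notin> e" "Suc m \<notin> f" | "Suc m \<in> e" "Suc m \<notin> f" "Suc m \<notin> g" | "Suc m \<in> f" "Suc m \<notin> e" "Suc m \<notin> g"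
      using * by blast
    then show "chord \<theta>' e \<inter> chord \<theta>' f \<inter> chord \<theta>' g = {}"
    proof cases
      case 1
      then show ?thesis using main[OF sub[OF S(1)] sub[OF S(2)] S(3)] * by blast
    next
      case 2
      then have "chord \<theta>' f \<inter> chord \<theta>' g \<inter> chord \<theta>' e = {}"
        using * by (intro main sub S) auto
      then show ?thesis by blast
    next
      case 3
      then have "chord \<theta>' e \<inter> chord \<theta>' g \<inter> chord \<theta>' f = {}"
        using * by (intro main sub S) auto
      then show ?thesis by blast
    qed
  qed
  then show ?case using lab' by blast
qed

section \<open>Charts at transversal crossings\<close>

definition locally_line :: "complex \<Rightarrow> complex \<Rightarrow> complex set \<Rightarrow> bool" where
  "locally_line z u X \<longleftrightarrow> (\<forall>\<^sub>F x in nhds z. x \<in> X \<longleftrightarrow> (\<exists>t::real. x = z + of_real t * u))"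

definition affine_chart :: "complex \<Rightarrow> complex \<Rightarrow> complex \<Rightarrow> complex \<Rightarrow> complex" where
  "affine_chart z u v w = z + of_real (Re w) * u + of_real (Im w) * v"

lemma affine_chart_0 [simp]: "affine_chart z u v 0 = z"
  by (simp add: affine_chart_def)

lemma affine_chart_scale:
  "affine_chart z (of_real \<delta> * u) (of_real \<delta> * v) w = affine_chart z u v (of_real \<delta> * w)"
  by (simp add: affine_chart_def algebra_simps)

lemma inj_affine_chart:
  assumes "cross_product u v \<noteq> 0"
  shows "inj (affine_chart z u v)"
proof (rule injI)
  fix w w' assume "affine_chart z u v w = affine_chart z u v w'"
  then have "of_real (Re w - Re w') * u = of_real (Im w' - Im w) * v"
    by (simp add: affine_chart_def algebra_simps)
  then have "Re w - Re w' = 0" "Im w' - Im w = 0"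
    using cross_product_independent[OF assms] by blast+
  then show "w = w'" by (simp add: complex_eq_iff)
qed

lemma continuous_on_affine_chart: "continuous_on S (affine_chart z u v)"
  unfolding affine_chart_def by (intro continuous_intros)

text \<open>Only the germ of the set at \<open>z\<close> matters, so a strand that has been changed
  elsewhere still counts as straight at \<open>z\<close>.\<close>

lemma locally_line_cong:
  assumes "\<forall>\<^sub>F x in nhds z. x \<in> X \<longleftrightarrow> x \<in> Y" "locally_line z u Y"
  shows "locally_line z u X"
  using eventually_conj[OF assms(1) assms(2)[unfolded locally_line_def]] unfolding locally_line_def
  by (rule eventually_mono) blast

lemma eventually_notin_closed:
  assumes "closed X" "z \<notin> X"
  shows "\<forall>\<^sub>F x in nhds z. x \<notin> X"
  using eventually_nhds_in_open[of "- X" z] assms by (simp add: open_Compl)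

lemma locally_line_chord:
  assumes "A \<noteq> B" "0 < s" "s < 1" "z = A + of_real s * (B - A)"
  shows "locally_line z (B - A) (closed_segment A B)"
proof -
  let ?r = "min s (1 - s) * norm (B - A)"
  have r: "?r > 0" using assms by simp
  have "x \<in> closed_segment A B \<longleftrightarrow> (\<exists>t::real. x = z + of_real t * (B - A))" if x: "x \<in> ball z ?r" for x
  proof
    assume "x \<in> closed_segment A B"
    then obtain t :: real where t: "x = A + of_real t * (B - A)" unfolding in_chord by blast
    have "x = z + of_real (t - s) * (B - A)" unfolding t assms(4) by (simp add: algebra_simps)
    then show "\<exists>t::real. x = z + of_real t * (B - A)" by blast
  next
    assume "\<exists>t::real. x = z + of_real t * (B - A)"
    then obtain t :: real where t: "x = z + of_real t * (B - A)" by blast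
    have "dist z x = \<bar>t\<bar> * norm (B - A)" using t by (simp add: dist_norm norm_mult)
    then have "\<bar>t\<bar> * norm (B - A) < min s (1 - s) * norm (B - A)" using x by simp
    then have "\<bar>t\<bar> < min s (1 - s)" by (rule mult_right_less_imp_less) simp
    then have "0 \<le> s + t" "s + t \<le> 1" by auto
    moreover have "x = A + of_real (s + t) * (B - A)" unfolding t assms(4) by (simp add: algebra_simps)
    ultimately show "x \<in> closed_segment A B" unfolding in_chord by blast
  qed
  then show ?thesis
    unfolding locally_line_def
    using eventually_nhds_in_open[of "ball z ?r" z] r by (auto elim: eventually_mono)
qed

text \<open>Each condition on a chart holds near \<open>z\<close>: the two strands are lines of
  independent directions, and the finitely many others are closed and miss \<open>z\<close>. A small
  parallelogram with sides along \<open>u\<close> and \<open>v\<close> therefore serves as the image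
  of the square.\<close>

lemma crossing_chart_exists:
  assumes fin: "finite \<tau>" and ef: "e \<in> \<tau>" "f \<in> \<tau>" "e \<noteq> f"
    and uv: "cross_product u v \<noteq> 0" and z: "norm z < 1"
    and lines: "locally_line z u (path_image (\<gamma> e))" "locally_line z v (path_image (\<gamma> f))"
    and avoid: "\<And>g. g \<in> \<tau> - {e, f} \<Longrightarrow> closed (path_image (\<gamma> g)) \<and> z \<notin> path_image (\<gamma> g)"
  obtains \<delta> where "\<delta> > 0" "crossing_chart \<tau> \<gamma> (affine_chart z (of_real \<delta> * u) (of_real \<delta> * v)) e f"
proof -
  have "\<forall>\<^sub>F x in nhds z. \<forall>g\<in>\<tau> - {e, f}. x \<notin> path_image (\<gamma> g)"
    using fin avoid by (intro eventually_ball_finite) (auto intro: eventually_notin_closed)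
  moreover have "\<forall>\<^sub>F x in nhds z. x \<in> ball 0 1" using z by (intro eventually_nhds_in_open) auto
  ultimately have "\<forall>\<^sub>F x in nhds z. (\<forall>g\<in>\<tau> - {e, f}. x \<notin> path_image (\<gamma> g)) \<and> x \<in> ball 0 1 \<and>
      (x \<in> path_image (\<gamma> e) \<longleftrightarrow> (\<exists>t::real. x = z + of_real t * u)) \<and>
      (x \<in> path_image (\<gamma> f) \<longleftrightarrow> (\<exists>t::real. x = z + of_real t * v))"
    using lines unfolding locally_line_def by (intro eventually_conj)
  then obtain r where r: "r > 0" and near: "\<And>x. dist x z < r \<Longrightarrow>
      (\<forall>g\<in>\<tau> - {e, f}. x \<notin> path_image (\<gamma> g)) \<and> x \<in> ball 0 1 \<and>
      (x \<in> path_image (\<gamma> e) \<longleftrightarrow> (\<exists>t::real. x = z + of_real t * u)) \<and>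
      (x \<in> path_image (\<gamma> f) \<longleftrightarrow> (\<exists>t::real. x = z + of_real t * v))"
    unfolding eventually_nhds_metric by blast
  have uv0: "norm u + norm v > 0"
  proof -
    have "u \<noteq> 0" using uv by (auto simp: cross_product_def)
    then show ?thesis by (simp add: add_pos_nonneg)
  qed
  \<comment> \<open>Chosen such that all points of the parallelogram are within \<open>r / 2\<close>
    of \<open>z\<close>.\<close>
  define \<delta> where "\<delta> = r / (2 * (norm u + norm v))"
  have \<delta>: "\<delta> > 0" using r uv0 by (simp add: \<delta>_def)
  define h where "h = affine_chart z (of_real \<delta> * u) (of_real \<delta> * v)"
  have h_eq: "h w = z + of_real (\<delta> * Re w) * u + of_real (\<delta> * Im w) * v" for w
    by (simp add: h_def affine_chart_def mult_ac)
  have h_near: "dist (h w) z < r" if "w \<in> square" for w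
  proof -
    have "dist (h w) z = norm (of_real (\<delta> * Re w) * u + of_real (\<delta> * Im w) * v)"
      by (simp add: h_eq dist_norm)
    also have "\<dots> \<le> norm (of_real (\<delta> * Re w) * u) + norm (of_real (\<delta> * Im w) * v)" by (rule norm_triangle_ineq)
    also have "\<dots> = \<delta> * \<bar>Re w\<bar> * norm u + \<delta> * \<bar>Im w\<bar> * norm v" using \<delta> by (simp add: norm_mult abs_mult)
    also have "\<dots> \<le> \<delta> * 1 * norm u + \<delta> * 1 * norm v"
      using that \<delta> unfolding square_def by (intro add_mono mult_right_mono mult_left_mono) auto
    also have "\<dots> = \<delta> * (norm u + norm v)" by (simp add: algebra_simps)
    also have "\<dots> = r / 2" using uv0 by (simp add: \<delta>_def field_simps)
    also have "\<dots> < r" using r by simp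
    finally show ?thesis .
  qed
  have "cross_product (of_real \<delta> * u) (of_real \<delta> * v) = \<delta> * \<delta> * cross_product u v"
    by (simp add: cross_product_def algebra_simps)
  then have inj: "inj h" unfolding h_def using \<delta> uv by (intro inj_affine_chart) simp
  have on_e: "h w \<in> path_image (\<gamma> e) \<longleftrightarrow> Im w = 0" if "w \<in> square" for w
  proof -
    have "h w \<in> path_image (\<gamma> e) \<longleftrightarrow> (\<exists>t::real. h w = z + of_real t * u)"
      using near[OF h_near[OF that]] by blast
    also have "\<dots> \<longleftrightarrow> Im w = 0"
    proof
      assume "\<exists>t::real. h w = z + of_real t * u"
      then obtain t :: real where "h w = z + of_real t * u" by blast
      then have "of_real (t - \<delta> * Re w) * u = of_real (\<delta> * Im w) * v" by (simp add: h_eq algebra_simps)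
      then have "\<delta> * Im w = 0" by (rule cross_product_independent(2)[OF uv])
      then show "Im w = 0" using \<delta> by simp
    next
      assume "Im w = 0"
      then have "h w = z + of_real (\<delta> * Re w) * u" by (simp add: h_eq)
      then show "\<exists>t::real. h w = z + of_real t * u" by blast
    qed
    finally show ?thesis .
  qed
  have on_f: "h w \<in> path_image (\<gamma> f) \<longleftrightarrow> Re w = 0" if "w \<in> square" for w
  proof -
    have "h w \<in> path_image (\<gamma> f) \<longleftrightarrow> (\<exists>t::real. h w = z + of_real t * v)"
      using near[OF h_near[OF that]] by blast
    also have "\<dots> \<longleftrightarrow> Re w = 0"
    proof
      assume "\<exists>t::real. h w = z + of_real t * v"
      then obtain t :: real where "h w = z + of_real t * v" by blast
      then have "of_real (\<delta> * Re w) * u = of_real (t - \<delta> * Im w) * v" by (simp add: h_eq algebra_simps)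
      then have "\<delta> * Re w = 0" by (rule cross_product_independent(1)[OF uv])
      then show "Re w = 0" using \<delta> by simp
    next
      assume "Re w = 0"
      then have "h w = z + of_real (\<delta> * Im w) * v" by (simp add: h_eq)
      then show "\<exists>t::real. h w = z + of_real t * v" by blast
    qed
    finally show ?thesis .
  qed
  have "crossing_chart \<tau> \<gamma> h e f"
    unfolding crossing_chart_def
  proof (intro conjI ballI)
    show "continuous_on square h" unfolding h_def by (rule continuous_on_affine_chart)
    show "inj_on h square" using inj by (rule inj_on_subset) simp
    show "h ` square \<subseteq> ball 0 1" using near h_near by blast
    show "{w \<in> square. h w \<in> path_image (\<gamma> e)} = {w \<in> square. Im w = 0}" using on_e by blast
    show "{w \<in> square. h w \<in> path_image (\<gamma> f)} = {w \<in> square. Re w = 0}" using on_f by blast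
    show "path_image (\<gamma> g) \<inter> h ` square = {}" if "g \<in> \<tau> - {e, f}" for g
      using near h_near that by blast
  qed (use ef in auto)
  then show ?thesis using that \<delta> unfolding h_def by blast
qed

section \<open>Straight drawings\<close>

definition straight :: "(nat \<Rightarrow> real) \<Rightarrow> strands" where
  "straight \<theta> e = linepath (cis (\<theta> (Min e))) (cis (\<theta> (Max e)))"

lemma straight_pair:
  "path_image (straight \<theta> {a, b}) = closed_segment (cis (\<theta> a)) (cis (\<theta> b))"
  "{pathstart (straight \<theta> {a, b}), pathfinish (straight \<theta> {a, b})} = {cis (\<theta> a), cis (\<theta> b)}"
  by (auto simp: straight_def min_def max_def closed_segment_commute)

lemma circular_labelling_angles:
  assumes "labelled_angles (2 * n) \<theta>" "n \<ge> 1"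
  shows "circular_labelling n \<theta>"
proof -
  have "0 < \<theta> 1" "\<theta> (2 * n) < 2 * pi" using assms by (auto simp: labelled_angles_def)
  then show ?thesis using assms(1) unfolding circular_labelling_def labelled_angles_def by auto
qed

lemma strand_straight:
  assumes "labelled_angles (2 * n) \<theta>" "perfect_matching {1..2 * n} \<tau>" "e \<in> \<tau>"
  shows "strand \<theta> e (straight \<theta> e)"
proof -
  obtain a b where e: "e = {a, b}" "a < b" by (rule perfect_matching_pair[OF assms(2,3)])
  have ab: "a \<in> {1..2 * n}" "b \<in> {1..2 * n}" using perfect_matching_distinct[OF assms(2)] assms(3) e by blast+
  then have neq: "cis (\<theta> a) \<noteq> cis (\<theta> b)" using labelled_angles_inject[OF assms(1)] e(2) by blast
  have "arc (straight \<theta> e)" using neq e by (simp add: straight_def)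
  moreover have "x \<in> ball 0 1" if x: "x \<in> closed_segment (cis (\<theta> a)) (cis (\<theta> b)) - {cis (\<theta> a), cis (\<theta> b)}" for x
  proof -
    have "x \<in> closed_segment (cis (\<theta> a)) (cis (\<theta> b))" using x by simp
    then obtain t :: real where t: "0 \<le> t" "t \<le> 1" "x = cis (\<theta> a) + of_real t * (cis (\<theta> b) - cis (\<theta> a))"
      unfolding in_chord by (elim exE conjE) (rule that)
    have "t \<noteq> 0" "t \<noteq> 1" using t(3) x by auto
    then show ?thesis using chord_norm_less[OF _ _ neq, of t] t by simp
  qed
  then have "path_image (straight \<theta> e) - {pathstart (straight \<theta> e), pathfinish (straight \<theta> e)} \<subseteq> ball 0 1"
    unfolding e(1) straight_pair by blast
  moreover have "{pathstart (straight \<theta> e), pathfinish (straight \<theta> e)} = (\<lambda>i. cis (\<theta> i)) ` e"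
    unfolding e(1) straight_pair by simp
  ultimately show ?thesis unfolding strand_def by blast
qed

lemma straight_crossing:
  assumes lab: "labelled_angles (2 * n) \<theta>" and gen: "generic_angles (2 * n) \<theta>"
    and pm: "perfect_matching {1..2 * n} \<tau>" and ef: "{a, b} \<in> \<tau>" "{c, d} \<in> \<tau>" "{a, b} \<noteq> {c, d}"
    and z: "z \<in> path_image (straight \<theta> {a, b})" "z \<in> path_image (straight \<theta> {c, d})"
  obtains s t where "0 < s" "s < 1" "z = cis (\<theta> a) + of_real s * (cis (\<theta> b) - cis (\<theta> a))"
    "0 < t" "t < 1" "z = cis (\<theta> c) + of_real t * (cis (\<theta> d) - cis (\<theta> c))"
    "cross_product (cis (\<theta> b) - cis (\<theta> a)) (cis (\<theta> d) - cis (\<theta> c)) \<noteq> 0"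
    "locally_line z (cis (\<theta> b) - cis (\<theta> a)) (path_image (straight \<theta> {a, b}))"
    "locally_line z (cis (\<theta> d) - cis (\<theta> c)) (path_image (straight \<theta> {c, d}))"
    "norm z < 1" "path_image (straight \<theta> {a, b}) \<inter> path_image (straight \<theta> {c, d}) = {z}"
    "\<And>g. g \<in> \<tau> - {{a, b}, {c, d}} \<Longrightarrow> z \<notin> path_image (straight \<theta> g)"
proof -
  let ?A = "cis (\<theta> a)" and ?B = "cis (\<theta> b)" and ?C = "cis (\<theta> c)" and ?D = "cis (\<theta> d)"
  have d: "distinct [a, b, c, d]" by (rule chords_distinct[OF pm ef])
  have S: "a \<in> {1..2 * n}" "b \<in> {1..2 * n}" "c \<in> {1..2 * n}" "d \<in> {1..2 * n}"
    using perfect_matching_distinct[OF pm ef(1)] perfect_matching_distinct[OF pm ef(2)] by auto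
  have neq: "cis (\<theta> x) \<noteq> cis (\<theta> y)" if "x \<noteq> y" "x \<in> {1..2 * n}" "y \<in> {1..2 * n}" for x y
    using labelled_angles_inject[OF lab that(2,3)] that(1) by blast
  have dist: "distinct [?A, ?B, ?C, ?D]" using d S by (simp add: neq)
  have z': "z \<in> closed_segment ?A ?B" "z \<in> closed_segment ?C ?D" using z by (simp_all add: straight_pair)
  have norm: "cmod ?A = 1" "cmod ?B = 1" "cmod ?C = 1" "cmod ?D = 1" by simp_all
  obtain s t where st: "0 < s" "s < 1" "z = ?A + of_real s * (?B - ?A)"
    "0 < t" "t < 1" "z = ?C + of_real t * (?D - ?C)" "cross_product (?B - ?A) (?D - ?C) \<noteq> 0"
    using chords_transversal[OF norm dist z'] .
  have AB: "?A \<noteq> ?B" and CD: "?C \<noteq> ?D" using dist by auto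
  have 1: "locally_line z (?B - ?A) (path_image (straight \<theta> {a, b}))"
    unfolding straight_pair by (rule locally_line_chord[OF AB st(1-3)])
  have 2: "locally_line z (?D - ?C) (path_image (straight \<theta> {c, d}))"
    unfolding straight_pair by (rule locally_line_chord[OF CD st(4-6)])
  have 3: "norm z < 1" unfolding st(3) by (rule chord_norm_less[OF norm(1,2) AB st(1,2)])
  have "y = z" if "y \<in> path_image (straight \<theta> {a, b})" "y \<in> path_image (straight \<theta> {c, d})" for y
    by (rule chords_meet_once[OF norm dist _ _ z']) (use that in \<open>simp_all add: straight_pair\<close>)
  then have 4: "path_image (straight \<theta> {a, b}) \<inter> path_image (straight \<theta> {c, d}) = {z}" using z by blast
  have 5: "z \<notin> path_image (straight \<theta> g)" if g: "g \<in> \<tau> - {{a, b}, {c, d}}" for g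
  proof -
    have g\<tau>: "g \<in> \<tau>" using g by blast
    obtain p q where pq: "g = {p, q}" "p < q" by (rule perfect_matching_pair[OF pm g\<tau>])
    have disj: "{a, b} \<inter> {c, d} = {}" "{a, b} \<inter> g = {}" "{c, d} \<inter> g = {}"
    proof -
      show "{a, b} \<inter> {c, d} = {}" using d by auto
      show "{a, b} \<inter> g = {}" using perfect_matching_disjoint[OF pm ef(1) g\<tau>] g by blast
      show "{c, d} \<inter> g = {}" using perfect_matching_disjoint[OF pm ef(2) g\<tau>] g by blast
    qed
    have "g \<subseteq> {1..2 * n}" using perfect_matching_Union[OF pm] g\<tau> by blast
    then have "{a, b} \<union> {c, d} \<union> g \<subseteq> {1..2 * n}" using S by blast
    moreover have "card {a, b} = 2" "card {c, d} = 2" "card g = 2" using d pq by auto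
    ultimately have "chord \<theta> {a, b} \<inter> chord \<theta> {c, d} \<inter> chord \<theta> g = {}"
      using gen disj unfolding generic_angles_def by blast
    then show ?thesis using z' pq(1) by (auto simp: straight_pair)
  qed
  show ?thesis using that[OF st 1 2 3 4 5] .
qed

lemma straight_lensless:
  assumes lab: "labelled_angles (2 * n) \<theta>" and gen: "generic_angles (2 * n) \<theta>"
    and pm: "perfect_matching {1..2 * n} \<tau>" and n: "n \<ge> 1"
  shows "lensless_medial_graph n \<theta> \<tau> (straight \<theta>)"
proof -
  have len: "lensless \<tau> (straight \<theta>)"
    unfolding lensless_def Uniq_def
  proof (intro ballI impI allI)
    fix e f x y assume ef: "e \<in> \<tau>" "f \<in> \<tau>" "e \<noteq> f"
      and x: "x \<in> path_image (straight \<theta> e) \<and> x \<in> path_image (straight \<theta> f)"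
      and y: "y \<in> path_image (straight \<theta> e) \<and> y \<in> path_image (straight \<theta> f)"
    obtain a b where e: "e = {a, b}" using perfect_matching_pair[OF pm ef(1)] by metis
    obtain c d where f: "f = {c, d}" using perfect_matching_pair[OF pm ef(2)] by metis
    have "path_image (straight \<theta> e) \<inter> path_image (straight \<theta> f) = {x}"
      unfolding e f
      by (rule straight_crossing[OF lab gen pm, of a b c d x]) (use ef x e f in auto)
    then have "y \<in> {x}" using y by blast
    then show "x = y" by simp
  qed
  have fin\<tau>: "finite \<tau>" by (rule perfect_matching_finite(2)[OF pm])
  have "finite (\<Union>e\<in>\<tau>. \<Union>f\<in>\<tau> - {e}. path_image (straight \<theta> e) \<inter> path_image (straight \<theta> f))"
  proof (intro finite_UN_I fin\<tau> finite_Diff)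
    fix e f assume ef: "e \<in> \<tau>" "f \<in> \<tau> - {e}"
    show "finite (path_image (straight \<theta> e) \<inter> path_image (straight \<theta> f))"
    proof (cases "path_image (straight \<theta> e) \<inter> path_image (straight \<theta> f) = {}")
      case False
      then obtain x where "x \<in> path_image (straight \<theta> e)" "x \<in> path_image (straight \<theta> f)" by blast
      then have "path_image (straight \<theta> e) \<inter> path_image (straight \<theta> f) = {x}"
        using lensless_meet[OF len, of e f x] ef by blast
      then show ?thesis by simp
    qed simp
  qed
  moreover have "crossings \<tau> (straight \<theta>) \<subseteq>
      (\<Union>e\<in>\<tau>. \<Union>f\<in>\<tau> - {e}. path_image (straight \<theta> e) \<inter> path_image (straight \<theta> f))"
    unfolding crossings_def by blast
  ultimately have fin: "finite (crossings \<tau> (straight \<theta>))" by (rule finite_subset[rotated])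
  have charts: "\<exists>h e f. h 0 = z \<and> crossing_chart \<tau> (straight \<theta>) h e f"
    if "z \<in> crossings \<tau> (straight \<theta>)" for z
  proof -
    obtain e f where ef: "e \<in> \<tau>" "f \<in> \<tau>" "e \<noteq> f" "z \<in> path_image (straight \<theta> e)" "z \<in> path_image (straight \<theta> f)"
      using \<open>z \<in> crossings \<tau> (straight \<theta>)\<close> unfolding crossings_def by blast
    obtain a b where e: "e = {a, b}" using perfect_matching_pair[OF pm ef(1)] by metis
    obtain c d where f: "f = {c, d}" using perfect_matching_pair[OF pm ef(2)] by metis
    obtain u v where uv: "cross_product u v \<noteq> 0" "locally_line z u (path_image (straight \<theta> e))"
      "locally_line z v (path_image (straight \<theta> f))" "norm z < 1"
      "\<And>g. g \<in> \<tau> - {e, f} \<Longrightarrow> z \<notin> path_image (straight \<theta> g)"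
      unfolding e f
      by (rule straight_crossing[OF lab gen pm, of a b c d z]) (use ef e f in auto)
    obtain \<delta> where "crossing_chart \<tau> (straight \<theta>) (affine_chart z (of_real \<delta> * u) (of_real \<delta> * v)) e f"
    proof (rule crossing_chart_exists[OF fin\<tau> ef(1-3) uv(1,4,2,3)])
      show "closed (path_image (straight \<theta> g)) \<and> z \<notin> path_image (straight \<theta> g)" if "g \<in> \<tau> - {e, f}" for g
        using uv(5)[OF that] by (simp add: closed_path_image straight_def)
    qed
    then show ?thesis using affine_chart_0 by blast
  qed
  have "medial_graph n \<theta> \<tau> (straight \<theta>)"
    unfolding medial_graph_def
    using pm circular_labelling_angles[OF lab n] strand_straight[OF lab pm] fin charts
    by (auto simp: matchings_iff)
  then show ?thesis using len by (simp add: lensless_medial_graph_def)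
qed

lemma lensless_medial_graph_exists:
  assumes "\<tau> \<in> matchings n" "n \<ge> 1"
  obtains \<theta> \<gamma> where "lensless_medial_graph n \<theta> \<tau> \<gamma>"
  using generic_angles_exist[of "2 * n"] straight_lensless assms unfolding matchings_iff by blast

text \<open>Along the real axis from \<open>- \<alpha>\<close> to \<open>- \<delta>\<close>,
  diagonally to height \<open>\<delta>\<close> on the imaginary axis, and up to height
  \<open>\<beta>\<close>: one smoothed strand in coordinates where the crossing chords are on the
  axes. The other one is the negative of such a set.\<close>

definition corner_set :: "real \<Rightarrow> real \<Rightarrow> real \<Rightarrow> complex set" where
  "corner_set \<alpha> \<beta> \<delta> = {w. Im w = 0 \<and> - \<alpha> \<le> Re w \<and> Re w \<le> - \<delta>} \<union>
     ({w. Im w = Re w + \<delta> \<and> - \<delta> \<le> Re w \<and> Re w \<le> 0} \<union> {w. Re w = 0 \<and> \<delta> \<le> Im w \<and> Im w \<le> \<beta>})"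

lemma corner_arc:
  assumes "0 < \<delta>" "\<delta> < \<alpha>" "\<delta> < \<beta>"
  obtains p where "arc p" "pathstart p = of_real (- \<alpha>)" "pathfinish p = \<i> * of_real \<beta>"
    "path_image p = corner_set \<alpha> \<beta> \<delta>"
proof -
  let ?x = "of_real (- \<alpha>) :: complex" and ?y = "of_real (- \<delta>) :: complex"
  let ?z = "\<i> * of_real \<delta> :: complex" and ?w = "\<i> * of_real \<beta> :: complex"
  have 1: "closed_segment ?x ?y = {w. Im w = 0 \<and> - \<alpha> \<le> Re w \<and> Re w \<le> - \<delta>}"
    using assms by (subst closed_segment_same_Im) (auto simp: closed_segment_eq_real_ivl)
  have 3: "closed_segment ?z ?w = {w. Re w = 0 \<and> \<delta> \<le> Im w \<and> Im w \<le> \<beta>}"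
    using assms by (subst closed_segment_same_Re) (auto simp: closed_segment_eq_real_ivl)
  have 2: "closed_segment ?y ?z = {w. Im w = Re w + \<delta> \<and> - \<delta> \<le> Re w \<and> Re w \<le> 0}"
  proof (intro set_eqI iffI)
    fix w assume "w \<in> closed_segment ?y ?z"
    then obtain t :: real where t: "0 \<le> t" "t \<le> 1" "w = ?y + of_real t * (?z - ?y)" unfolding in_chord by blast
    then have "Re w = - \<delta> + t * \<delta>" "Im w = t * \<delta>" by auto
    moreover have "t * \<delta> \<le> 1 * \<delta>" using t assms by (intro mult_right_mono) auto
    ultimately show "w \<in> {w. Im w = Re w + \<delta> \<and> - \<delta> \<le> Re w \<and> Re w \<le> 0}" using t assms by simp
  next
    fix w assume w: "w \<in> {w. Im w = Re w + \<delta> \<and> - \<delta> \<le> Re w \<and> Re w \<le> 0}"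
    then have "w = ?y + of_real (Im w / \<delta>) * (?z - ?y)" "0 \<le> Im w / \<delta>" "Im w / \<delta> \<le> 1"
      using assms by (auto simp: complex_eq_iff field_simps)
    then show "w \<in> closed_segment ?y ?z" unfolding in_chord by blast
  qed
  have neq: "?x \<noteq> ?y" "?y \<noteq> ?z" "?z \<noteq> ?w" using assms by (auto simp: complex_eq_iff)
  have "closed_segment ?y ?z \<inter> closed_segment ?z ?w \<subseteq> {?z}"
    unfolding 2 3 by (auto simp: complex_eq_iff)
  then have arc23: "arc (linepath ?y ?z +++ linepath ?z ?w)"
    using neq by (intro arc_join) simp_all
  have img23: "path_image (linepath ?y ?z +++ linepath ?z ?w) = closed_segment ?y ?z \<union> closed_segment ?z ?w"
    by (simp add: path_image_join)
  have "closed_segment ?x ?y \<inter> (closed_segment ?y ?z \<union> closed_segment ?z ?w) \<subseteq> {?y}"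
    unfolding 1 2 3 using assms by (auto simp: complex_eq_iff)
  then have "arc (linepath ?x ?y +++ (linepath ?y ?z +++ linepath ?z ?w))"
    using neq by (intro arc_join[OF _ arc23]) (simp_all only: img23 path_image_linepath pathfinish_linepath
        pathstart_linepath pathstart_join arc_linepath not_False_eq_True)
  moreover have "path_image (linepath ?x ?y +++ (linepath ?y ?z +++ linepath ?z ?w)) = corner_set \<alpha> \<beta> \<delta>"
    unfolding corner_set_def 1[symmetric] 2[symmetric] 3[symmetric] by (simp add: path_image_join)
  ultimately show ?thesis by (intro that) auto
qed

lemma arc_injective_image:
  assumes "arc p" "continuous_on (path_image p) f" "inj_on f (path_image p)"
  shows "arc (f \<circ> p)"
proof -
  have "inj_on (f \<circ> p) {0..1}"
    using assms(1,3) by (intro comp_inj_on) (auto simp: arc_def path_image_def)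
  then show ?thesis using assms by (simp add: arc_def path_continuous_image)
qed

section \<open>Realising covers by medial graphs\<close>

text \<open>The resolved drawing is lensless for numerical reasons: interlaced pairs meet anyway, so a drawing
  with only \<open>cross_count\<close> many crossings has no lens.\<close>

lemma cover_imp_uncrosses:
  assumes cover: "uncross_cover \<tau>' \<tau>" and pm: "perfect_matching {1..2 * n} \<tau>" and n: "n \<ge> 1"
  shows "uncrosses n \<tau>' \<tau>"
proof -
  have count: "cross_count \<tau> = Suc (cross_count \<tau>')" and res: "resolution \<tau> \<tau>'"
    using cover by (auto simp: uncross_cover_def)
  have pm': "perfect_matching {1..2 * n} \<tau>'" using resolution_perfect_matching[OF res] pm by blast
  obtain a b c d \<rho> T where *: "perfect_matching T \<rho>" "distinct [a, b, c, d]"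
     "{a, b, c, d} \<inter> T = {}" "cross {a, b} {c, d}"
     "\<tau> = insert {a, b} (insert {c, d} \<rho>)" "\<tau>' = insert {a, c} (insert {b, d} \<rho>)"
    using res unfolding resolution_def by blast
  have notin: "{x, y} \<notin> \<rho>" if "x \<in> {a, b, c, d}" for x y
    using that *(3) perfect_matching_distinct[OF *(1)] by blast
  have neq: "{a, b} \<noteq> {c, d}" "{a, c} \<noteq> {b, d}" using *(2) by (auto simp: doubleton_eq_iff)
  have \<rho>: "\<tau> - {{a, b}, {c, d}} = \<rho>" using *(5) notin by auto
  have ef: "{a, b} \<in> \<tau>" "{c, d} \<in> \<tau>" using *(5) by simp_all
  \<comment> \<open>The second chord is read from \<open>d\<close> to \<open>c\<close>. Then
    \<open>a\<close>, \<open>b\<close>, \<open>d\<close>, \<open>c\<close> lie in the west, east,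
    south and north of the chart, and the first smoothing produces the pairs \<open>{a, c}\<close>
    and \<open>{b, d}\<close>.\<close>
  have dc: "{d, c} \<in> \<tau>" "{a, b} \<noteq> {d, c}" "{d, c} = {c, d}" using ef neq by (simp_all add: insert_commute)
  have \<rho>_sub: "g \<in> \<tau>" "g \<in> \<tau>'" if "g \<in> \<rho>" for g using that *(5,6) by simp_all
  obtain \<theta> where lab: "labelled_angles (2 * n) \<theta>" and gen: "generic_angles (2 * n) \<theta>"
    using generic_angles_exist by blast
  let ?\<gamma> = "straight \<theta>"
  have lm: "lensless_medial_graph n \<theta> \<tau> ?\<gamma>" by (rule straight_lensless[OF lab gen pm n])
  then have med: "medial_graph n \<theta> \<tau> ?\<gamma>" and len: "lensless \<tau> ?\<gamma>" by (auto simp: lensless_medial_graph_def)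
  define A B C D where "A = cis (\<theta> a)" and "B = cis (\<theta> b)" and "C = cis (\<theta> c)" and "D = cis (\<theta> d)"
  have norm: "cmod A = 1" "cmod B = 1" "cmod C = 1" "cmod D = 1" by (simp_all add: A_def B_def C_def D_def)
  obtain z where z: "z \<in> path_image (?\<gamma> {a, b})" "z \<in> path_image (?\<gamma> {d, c})"
    using crossing_strands_meet[OF med ef *(4)] unfolding dc(3) by blast
  obtain s t where st: "0 < s" "s < 1" "z = A + of_real s * (B - A)" "0 < t" "t < 1" "z = D + of_real t * (C - D)"
    and uv: "cross_product (B - A) (C - D) \<noteq> 0"
    and lines: "locally_line z (B - A) (path_image (?\<gamma> {a, b}))" "locally_line z (C - D) (path_image (?\<gamma> {d, c}))"
    and z1: "norm z < 1" and meet: "path_image (?\<gamma> {a, b}) \<inter> path_image (?\<gamma> {d, c}) = {z}"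
    and others: "\<And>g. g \<in> \<tau> - {{a, b}, {d, c}} \<Longrightarrow> z \<notin> path_image (?\<gamma> g)"
    by (rule straight_crossing[OF lab gen pm ef(1) dc(1,2) z, folded A_def B_def C_def D_def]) (rule that)
  define u v where "u = B - A" and "v = C - D"
  \<comment> \<open>Coordinates in which \<open>z\<close> is the origin and the crossing chords lie
    on the axes, from \<open>- s\<close> to \<open>1 - s\<close> and from \<open>- t\<close> to
    \<open>1 - t\<close>.\<close>
  define L where "L = affine_chart z u v"
  have inj_L: "inj L" unfolding L_def u_def v_def by (rule inj_affine_chart[OF uv])
  have cont_L: "continuous_on X L" for X unfolding L_def by (rule continuous_on_affine_chart)
  have closed_\<gamma>: "closed (path_image (?\<gamma> g))" for g by (simp add: straight_def closed_path_image)
  obtain \<delta> where \<delta>: "\<delta> > 0"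
    and chart: "crossing_chart \<tau> ?\<gamma> (affine_chart z (of_real \<delta> * u) (of_real \<delta> * v)) {a, b} {c, d}"
    unfolding u_def v_def
    by (rule crossing_chart_exists[OF perfect_matching_finite(2)[OF pm] ef neq(1) uv z1 lines[unfolded dc(3)]])
      (use closed_\<gamma> others dc(3) in auto)
  define h where "h = affine_chart z (of_real \<delta> * u) (of_real \<delta> * v)"
  note chart = chart[folded h_def]
  have h_L: "h w = L (of_real \<delta> * w)" for w unfolding h_def L_def by (rule affine_chart_scale)
  have h_ball: "h ` square \<subseteq> ball 0 1" using chart unfolding crossing_chart_def by blast
  have L_eq: "L w = z + of_real (Re w) * u + of_real (Im w) * v" for w by (simp add: L_def affine_chart_def)
  have L_ends: "L (of_real (- s)) = A" "L (of_real (1 - s)) = B" "L (\<i> * of_real (- t)) = D" "L (\<i> * of_real (1 - t)) = C"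
  proof -
    show "L (of_real (- s)) = A" unfolding L_eq st(3) u_def by (simp add: algebra_simps)
    show "L (of_real (1 - s)) = B" unfolding L_eq st(3) u_def by (simp add: algebra_simps)
    show "L (\<i> * of_real (- t)) = D" unfolding L_eq st(6) v_def by (simp add: algebra_simps)
    show "L (\<i> * of_real (1 - t)) = C" unfolding L_eq st(6) v_def by (simp add: algebra_simps)
  qed
  define K where "K = {w. \<bar>Re w\<bar> \<le> \<delta> \<and> \<bar>Im w\<bar> \<le> \<delta>}"
  have hK: "h ` square = L ` K"
  proof -
    have "(\<lambda>w. of_real \<delta> * w) ` square = K"
    proof (intro set_eqI iffI)
      fix w assume "w \<in> (\<lambda>w. of_real \<delta> * w) ` square"
      then obtain w' where w': "\<bar>Re w'\<bar> \<le> 1" "\<bar>Im w'\<bar> \<le> 1" "w = of_real \<delta> * w'" by (auto simp: square_def)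
      then have "\<delta> * \<bar>Re w'\<bar> \<le> \<delta> * 1" "\<delta> * \<bar>Im w'\<bar> \<le> \<delta> * 1" using \<delta> by (auto intro!: mult_left_mono)
      then show "w \<in> K" using w'(3) \<delta> by (simp add: K_def abs_mult)
    next
      fix w assume "w \<in> K"
      then have "w / of_real \<delta> \<in> square" "w = of_real \<delta> * (w / of_real \<delta>)"
        using \<delta> by (auto simp: K_def square_def abs_divide Re_divide_of_real Im_divide_of_real)
      then show "w \<in> (\<lambda>w. of_real \<delta> * w) ` square" by blast
    qed
    then have "L ` (\<lambda>w. of_real \<delta> * w) ` square = L ` K" by simp
    then show ?thesis by (simp add: image_image h_L)
  qed
  have LK_ball: "norm (L w) < 1" if "w \<in> K" for w
    using h_ball that unfolding hK by auto
  \<comment> \<open>The chart lies in the open disk and so excludes the ends of the chords.\<close>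
  have \<delta>_less: "\<delta> < s" "\<delta> < 1 - s" "\<delta> < t" "\<delta> < 1 - t"
  proof -
    have "of_real (- s) \<notin> K" "of_real (1 - s) \<notin> K" "\<i> * of_real (- t) \<notin> K" "\<i> * of_real (1 - t) \<notin> K"
      using LK_ball[of "of_real (- s)"] LK_ball[of "of_real (1 - s)"]
        LK_ball[of "\<i> * of_real (- t)"] LK_ball[of "\<i> * of_real (1 - t)"] norm
      unfolding L_ends by auto
    then show "\<delta> < s" "\<delta> < 1 - s" "\<delta> < t" "\<delta> < 1 - t" using st \<delta> by (auto simp: K_def)
  qed
  define E where "E = {w. Im w = 0 \<and> - s \<le> Re w \<and> Re w \<le> 1 - s}"
  define F where "F = {w. Re w = 0 \<and> - t \<le> Im w \<and> Im w \<le> 1 - t}"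
  have LE: "path_image (?\<gamma> {a, b}) = L ` E"
  proof (intro set_eqI iffI)
    fix x assume "x \<in> path_image (?\<gamma> {a, b})"
    then obtain r :: real where r: "0 \<le> r" "r \<le> 1" "x = A + of_real r * (B - A)"
      unfolding straight_pair A_def[symmetric] B_def[symmetric] in_chord by blast
    have "x = L (of_real (r - s))" unfolding L_eq r(3) st(3) u_def by (simp add: algebra_simps)
    moreover have "of_real (r - s) \<in> E" using r by (simp add: E_def)
    ultimately show "x \<in> L ` E" by blast
  next
    fix x assume "x \<in> L ` E"
    then obtain w where w: "Im w = 0" "- s \<le> Re w" "Re w \<le> 1 - s" "x = L w" by (auto simp: E_def)
    have "x = A + of_real (s + Re w) * (B - A)" unfolding w(4) L_eq st(3) u_def w(1) by (simp add: algebra_simps)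
    then show "x \<in> path_image (?\<gamma> {a, b})"
      unfolding straight_pair A_def[symmetric] B_def[symmetric] in_chord using w(2,3) by (intro exI[of _ "s + Re w"]) simp
  qed
  have LF: "path_image (?\<gamma> {c, d}) = L ` F"
  proof (intro set_eqI iffI)
    fix x assume "x \<in> path_image (?\<gamma> {c, d})"
    then obtain r :: real where r: "0 \<le> r" "r \<le> 1" "x = D + of_real r * (C - D)"
      unfolding dc(3)[symmetric] straight_pair C_def[symmetric] D_def[symmetric] in_chord by blast
    have "x = L (\<i> * of_real (r - t))" unfolding L_eq r(3) st(6) v_def by (simp add: algebra_simps)
    moreover have "\<i> * of_real (r - t) \<in> F" using r by (simp add: F_def)
    ultimately show "x \<in> L ` F" by blast
  next
    fix x assume "x \<in> L ` F"
    then obtain w where w: "Re w = 0" "- t \<le> Im w" "Im w \<le> 1 - t" "x = L w" by (auto simp: F_def)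
    have "x = D + of_real (t + Im w) * (C - D)" unfolding w(4) L_eq st(6) v_def w(1) by (simp add: algebra_simps)
    then show "x \<in> path_image (?\<gamma> {c, d})"
      unfolding dc(3)[symmetric] straight_pair C_def[symmetric] D_def[symmetric] in_chord
      using w(2,3) by (intro exI[of _ "t + Im w"]) simp
  qed
  define P where "P = corner_set s (1 - t) \<delta>"
  \<comment> \<open>The point reflection of a corner; its arms \<open>1 - s\<close> and
    \<open>t\<close> are those towards \<open>B\<close> and \<open>D\<close>.\<close>
  define Q where "Q = uminus ` corner_set (1 - s) t \<delta>"
  have Q_iff: "w \<in> Q \<longleftrightarrow> - w \<in> corner_set (1 - s) t \<delta>" for w
    unfolding Q_def by (metis (no_types) add.inverse_inverse image_iff)
  obtain p where p: "arc p" "pathstart p = of_real (- s)" "pathfinish p = \<i> * of_real (1 - t)" "path_image p = P"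
    unfolding P_def by (rule corner_arc[OF \<delta> \<delta>_less(1,4)])
  obtain q where q: "arc q" "pathstart q = of_real (- (1 - s))" "pathfinish q = \<i> * of_real t"
    "path_image q = corner_set (1 - s) t \<delta>"
    by (rule corner_arc[OF \<delta> \<delta>_less(2,3)])
  define p' where "p' = L \<circ> p"
  define q' where "q' = (L \<circ> uminus) \<circ> q"
  have p': "arc p'" "pathstart p' = A" "pathfinish p' = C" "path_image p' = L ` P"
    unfolding p'_def using p L_ends inj_on_subset[OF inj_L]
    by (simp_all add: arc_injective_image cont_L pathstart_compose pathfinish_compose path_image_compose)
  have cont_Lm: "continuous_on X (L \<circ> uminus)" for X
    unfolding o_def by (intro continuous_on_compose2[OF cont_L[of UNIV]] continuous_intros) auto
  have inj_Lm: "inj_on (L \<circ> uminus) X" for X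
    by (rule comp_inj_on) (auto intro: inj_on_subset[OF inj_L])
  have q': "arc q'" "pathstart q' = B" "pathfinish q' = D" "path_image q' = L ` Q"
  proof -
    show "arc q'" unfolding q'_def by (rule arc_injective_image[OF q(1) cont_Lm inj_Lm])
    show "pathstart q' = B" "pathfinish q' = D"
      using L_ends(2,3) by (simp_all add: q'_def pathstart_compose pathfinish_compose q)
    show "path_image q' = L ` Q" unfolding q'_def path_image_compose q(4) Q_def by (simp add: image_comp)
  qed
  have PQ: "P \<inter> Q = {}"
    using \<delta> by (auto simp: P_def Q_iff corner_set_def)
  have outside0: "(P \<union> Q) - K = (E \<union> F) - K"
    using \<delta> \<delta>_less by (auto simp: P_def Q_iff corner_set_def K_def E_def F_def)
  \<comment> \<open>Inside the square the axis parts of \<open>P\<close> and \<open>Q\<close> shrink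
    to single points, which already belong to the diagonals.\<close>
  have inside0: "of_real \<delta> * w \<in> P \<union> Q \<longleftrightarrow> w \<in> smoothing1" if w: "w \<in> square" for w
  proof -
    let ?x = "Re w" and ?y = "Im w"
    have b: "\<bar>?x\<bar> \<le> 1" "\<bar>?y\<bar> \<le> 1" using w by (auto simp: square_def)
    have scale: "\<delta> * r \<le> \<delta> * r' \<longleftrightarrow> r \<le> r'" for r r' using \<delta> by simp
    have mem: "\<delta> * ?x \<ge> - s \<and> \<delta> * ?x \<le> 1 - s \<and> \<delta> * ?y \<ge> - t \<and> \<delta> * ?y \<le> 1 - t"
    proof -
      have "\<bar>\<delta> * ?x\<bar> \<le> \<delta> * 1" "\<bar>\<delta> * ?y\<bar> \<le> \<delta> * 1" using b \<delta> by (auto simp: abs_mult intro!: mult_left_mono)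
      then show ?thesis using \<delta>_less by auto
    qed
    have lin: "\<delta> * ?y = \<delta> * ?x + \<delta> \<longleftrightarrow> ?y = ?x + 1" "\<delta> * ?y = \<delta> * ?x - \<delta> \<longleftrightarrow> ?y = ?x - 1"
      "\<delta> * ?x \<le> - \<delta> \<longleftrightarrow> ?x \<le> -1" "\<delta> \<le> \<delta> * ?x \<longleftrightarrow> 1 \<le> ?x" "\<delta> * ?y \<le> - \<delta> \<longleftrightarrow> ?y \<le> -1" "\<delta> \<le> \<delta> * ?y \<longleftrightarrow> 1 \<le> ?y"
      "- \<delta> \<le> \<delta> * ?x \<longleftrightarrow> -1 \<le> ?x" "\<delta> * ?x \<le> \<delta> \<longleftrightarrow> ?x \<le> 1" "\<delta> * ?x \<le> 0 \<longleftrightarrow> ?x \<le> 0" "0 \<le> \<delta> * ?x \<longleftrightarrow> 0 \<le> ?x"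
      "\<delta> * ?x = 0 \<longleftrightarrow> ?x = 0" "\<delta> * ?y = 0 \<longleftrightarrow> ?y = 0"
    proof -
      have "\<delta> * ?x + \<delta> = \<delta> * (?x + 1)" "\<delta> * ?x - \<delta> = \<delta> * (?x - 1)" by (simp_all add: algebra_simps)
      then show "\<delta> * ?y = \<delta> * ?x + \<delta> \<longleftrightarrow> ?y = ?x + 1" "\<delta> * ?y = \<delta> * ?x - \<delta> \<longleftrightarrow> ?y = ?x - 1"
        using \<delta> by simp_all
      show "\<delta> * ?x \<le> - \<delta> \<longleftrightarrow> ?x \<le> -1" using scale[of ?x "-1"] by simp
      show "\<delta> \<le> \<delta> * ?x \<longleftrightarrow> 1 \<le> ?x" using scale[of 1 ?x] by simp
      show "\<delta> * ?y \<le> - \<delta> \<longleftrightarrow> ?y \<le> -1" using scale[of ?y "-1"] by simp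
      show "\<delta> \<le> \<delta> * ?y \<longleftrightarrow> 1 \<le> ?y" using scale[of 1 ?y] by simp
      show "- \<delta> \<le> \<delta> * ?x \<longleftrightarrow> -1 \<le> ?x" using scale[of "-1" ?x] by simp
      show "\<delta> * ?x \<le> \<delta> \<longleftrightarrow> ?x \<le> 1" using scale[of ?x 1] by simp
      show "\<delta> * ?x \<le> 0 \<longleftrightarrow> ?x \<le> 0" using scale[of ?x 0] by simp
      show "0 \<le> \<delta> * ?x \<longleftrightarrow> 0 \<le> ?x" using scale[of 0 ?x] by simp
    qed (use \<delta> in auto)
    have P_iff: "of_real \<delta> * w \<in> P \<longleftrightarrow> ?y = 0 \<and> ?x \<le> -1 \<or> ?y = ?x + 1 \<and> -1 \<le> ?x \<and> ?x \<le> 0 \<or> ?x = 0 \<and> 1 \<le> ?y"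
      using mem \<delta> by (simp add: P_def corner_set_def lin)
    have Q_iff': "of_real \<delta> * w \<in> Q \<longleftrightarrow> ?y = 0 \<and> 1 \<le> ?x \<or> ?y = ?x - 1 \<and> ?x \<le> 1 \<and> 0 \<le> ?x \<or> ?x = 0 \<and> ?y \<le> -1"
    proof -
      have "- (\<delta> * ?y) = - (\<delta> * ?x) + \<delta> \<longleftrightarrow> \<delta> * ?y = \<delta> * ?x - \<delta>" by linarith
      moreover have "\<delta> \<le> - (\<delta> * ?y) \<longleftrightarrow> \<delta> * ?y \<le> - \<delta>" by linarith
      ultimately show ?thesis using mem \<delta> by (simp add: Q_iff corner_set_def lin)
    qed
    show ?thesis
      using b w unfolding Un_iff P_iff Q_iff' smoothing1_def by (auto simp: abs_if split: if_splits)
  qed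
  define \<gamma>' where "\<gamma>' = ?\<gamma>({a, c} := p', {b, d} := q')"
  have \<gamma>'_new: "\<gamma>' {a, c} = p'" "\<gamma>' {b, d} = q'" using neq(2) by (simp_all add: \<gamma>'_def)
  have \<gamma>'_old: "\<gamma>' g = ?\<gamma> g" if "g \<in> \<rho>" for g
    using that notin[of a c] notin[of b d] unfolding \<gamma>'_def by auto
  have outside: "(path_image (\<gamma>' {a, c}) \<union> path_image (\<gamma>' {b, d})) - h ` square =
      (path_image (?\<gamma> {a, b}) \<union> path_image (?\<gamma> {c, d})) - h ` square"
    unfolding \<gamma>'_new p'(4) q'(4) LE LF hK image_Un[symmetric] image_set_diff[OF inj_L, symmetric] outside0 ..
  have disj: "path_image (\<gamma>' {a, c}) \<inter> path_image (\<gamma>' {b, d}) = {}"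
    unfolding \<gamma>'_new p'(4) q'(4) image_Int[OF inj_L, symmetric] PQ by simp
  have avoid: "path_image (?\<gamma> g) \<inter> h ` square = {}" if "g \<in> \<tau> - {{a, b}, {c, d}}" for g
    using chart that unfolding crossing_chart_def by blast
  have \<tau>'_eq: "\<tau>' = (\<tau> - {{a, b}, {c, d}}) \<union> {{a, c}, {b, d}}" unfolding \<rho> *(6) by blast
  have new: "{a, c} \<notin> \<tau> - {{a, b}, {c, d}}" "{b, d} \<notin> \<tau> - {{a, b}, {c, d}}"
    unfolding \<rho> using notin by auto
  have "0 \<in> square" by (simp add: square_def)
  then have z_K: "z \<in> h ` square" unfolding h_def by (metis affine_chart_0 imageI)
  have cs: "crossings \<tau>' \<gamma>' = crossings \<tau> ?\<gamma> - {z}"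
    by (rule resolved_crossings[OF \<tau>'_eq ef new neq(2) _ outside avoid meet[unfolded dc(3)] z_K disj])
      (use \<gamma>'_old \<rho> in auto)
  have fin: "finite (crossings \<tau> ?\<gamma>)" using med by (simp add: medial_graph_def)
  have "h 0 = z" by (simp add: h_def)
  then have "z \<in> crossings \<tau> ?\<gamma>" using crossing_chart_in_crossings[OF chart] by simp
  then have "card (crossings \<tau> ?\<gamma>) = Suc (card (crossings \<tau>' \<gamma>'))"
    unfolding cs by (rule card.remove[OF fin])
  then have card: "card (crossings \<tau>' \<gamma>') \<le> cross_count \<tau>'"
    using medial_graph_crossings(3)[OF med len] count by simp
  \<comment> \<open>Off the chart the new strands follow the old chords, which lie in the open disk
    except for their ends; on the chart this is part of its definition.\<close>
  have in_ball: "norm (L w) < 1"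
    if "w \<in> P \<union> Q" "w \<noteq> of_real (- s)" "w \<noteq> of_real (1 - s)" "w \<noteq> \<i> * of_real (- t)" "w \<noteq> \<i> * of_real (1 - t)" for w
  proof (cases "w \<in> K")
    case False
    then have "w \<in> E \<or> w \<in> F" using that(1) outside0 by blast
    then show ?thesis
    proof
      assume w: "w \<in> E"
      then have "Re w \<noteq> - s" "Re w \<noteq> 1 - s" using that(2,3) by (auto simp: E_def complex_eq_iff)
      then have "0 < s + Re w" "s + Re w < 1" using w by (auto simp: E_def)
      moreover have "L w = A + of_real (s + Re w) * (B - A)"
        using w unfolding L_eq st(3) u_def by (simp add: E_def algebra_simps)
      moreover have "A \<noteq> B" using uv by (auto simp: cross_product_def)
      ultimately show ?thesis using chord_norm_less[OF norm(1,2)] by metis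
    next
      assume w: "w \<in> F"
      then have "Im w \<noteq> - t" "Im w \<noteq> 1 - t" using that(4,5) by (auto simp: F_def complex_eq_iff)
      then have "0 < t + Im w" "t + Im w < 1" using w by (auto simp: F_def)
      moreover have "L w = D + of_real (t + Im w) * (C - D)"
        using w unfolding L_eq st(6) v_def by (simp add: F_def algebra_simps)
      moreover have "D \<noteq> C" using uv by (auto simp: cross_product_def)
      ultimately show ?thesis using chord_norm_less[OF norm(4,3)] by metis
    qed
  qed (rule LK_ball)
  have P_ends: "of_real (1 - s) \<notin> P" "\<i> * of_real (- t) \<notin> P" "of_real (- s) \<notin> Q" "\<i> * of_real (1 - t) \<notin> Q"
    using st \<delta> by (auto simp: P_def Q_iff corner_set_def)
  have strands: "strand \<theta> g (\<gamma>' g)" if g: "g \<in> \<tau>'" for g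
  proof -
    consider "g \<in> \<rho>" | "g = {a, c}" | "g = {b, d}" using g *(6) by blast
    then show ?thesis
    proof cases
      case 1
      then show ?thesis using \<gamma>'_old strand_straight[OF lab pm] \<rho>_sub by simp
    next
      case 2
      have "L ` P - {A, C} \<subseteq> ball 0 1"
      proof
        fix x assume x: "x \<in> L ` P - {A, C}"
        then obtain w where w: "w \<in> P" "x = L w" by blast
        have "norm (L w) < 1"
        proof (rule in_ball)
          show "w \<in> P \<union> Q" using w by blast
          show "w \<noteq> of_real (- s)" using w(2) x L_ends(1) by blast
          show "w \<noteq> \<i> * of_real (1 - t)" using w(2) x L_ends(4) by blast
        qed (use w P_ends in auto)
        then show "x \<in> ball 0 1" using w by simp
      qed
      then show ?thesis
        using p' 2 by (simp add: strand_def \<gamma>'_new A_def C_def)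
    next
      case 3
      have "L ` Q - {B, D} \<subseteq> ball 0 1"
      proof
        fix x assume x: "x \<in> L ` Q - {B, D}"
        then obtain w where w: "w \<in> Q" "x = L w" by blast
        have "norm (L w) < 1"
        proof (rule in_ball)
          show "w \<in> P \<union> Q" using w by blast
          show "w \<noteq> of_real (1 - s)" using w(2) x L_ends(2) by blast
          show "w \<noteq> \<i> * of_real (- t)" using w(2) x L_ends(3) by blast
        qed (use w P_ends in auto)
        then show "x \<in> ball 0 1" using w by simp
      qed
      then show ?thesis
        using q' 3 by (simp add: strand_def \<gamma>'_new B_def D_def)
    qed
  qed
  have closed_\<gamma>': "closed (path_image (\<gamma>' g))" if "g \<in> \<tau>'" for g
    using strands[OF that] by (auto simp: strand_def intro!: closed_path_image arc_imp_path)
  have closed_K: "closed (h ` square)"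
  proof -
    have "K = cbox (- Complex \<delta> \<delta>) (Complex \<delta> \<delta>)"
      by (auto simp: K_def in_cbox_complex_iff abs_le_iff)
    then have "compact K" by simp
    then show ?thesis unfolding hK by (intro compact_imp_closed compact_continuous_image[OF cont_L])
  qed
  \<comment> \<open>A crossing of the new drawing involves an untouched strand \<open>k1\<close> and
    hence lies off the chart. Around it the other strand coincides with a chord \<open>m\<close> of
    the old drawing, so the local picture is that of two straight chords.\<close>
  have charts: "\<exists>h e f. h 0 = x \<and> crossing_chart \<tau>' \<gamma>' h e f" if x: "x \<in> crossings \<tau>' \<gamma>'" for x
  proof -
    obtain k1 k2 where k: "k1 \<in> \<rho>" "k2 \<in> \<tau>'" "k1 \<noteq> k2" "x \<in> path_image (\<gamma>' k1)" "x \<in> path_image (\<gamma>' k2)"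
    proof -
      obtain g1 g2 where g: "g1 \<in> \<tau>'" "g2 \<in> \<tau>'" "g1 \<noteq> g2" "x \<in> path_image (\<gamma>' g1)" "x \<in> path_image (\<gamma>' g2)"
        using x unfolding crossings_def by blast
      have "\<not> ({g1, g2} \<subseteq> {{a, c}, {b, d}})" using g(3,4,5) disj by blast
      then have "g1 \<in> \<rho> \<or> g2 \<in> \<rho>" using g(1,2) *(6) by blast
      then show ?thesis using that g by metis
    qed
    have x_k1: "x \<in> path_image (?\<gamma> k1)" using k(1,4) \<gamma>'_old by simp
    have x_K: "x \<notin> h ` square" using avoid[of k1] k(1) x_k1 \<rho> by blast
    have x_z: "x \<noteq> z" using x cs by blast
    have union: "y \<in> path_image (\<gamma>' {a, c}) \<or> y \<in> path_image (\<gamma>' {b, d}) \<longleftrightarrow>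
        y \<in> path_image (?\<gamma> {a, b}) \<or> y \<in> path_image (?\<gamma> {c, d})" if "y \<notin> h ` square" for y
      using outside that by blast
    have near_K: "\<forall>\<^sub>F y in nhds x. y \<notin> h ` square" by (rule eventually_notin_closed[OF closed_K x_K])
    \<comment> \<open>The unions agree near \<open>x\<close>, and the second members
      \<open>l'\<close> and \<open>m'\<close> stay away from \<open>x\<close>; so the first members
      agree there.\<close>
    have near_eq: "\<forall>\<^sub>F y in nhds x. y \<in> path_image (\<gamma>' l) \<longleftrightarrow> y \<in> path_image (?\<gamma> m)"
      if "l' \<in> \<tau>'" "x \<notin> path_image (\<gamma>' l')" "x \<notin> path_image (?\<gamma> m')"
        and un: "\<And>y. y \<notin> h ` square \<Longrightarrow> y \<in> path_image (\<gamma>' l) \<or> y \<in> path_image (\<gamma>' l') \<longleftrightarrow>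
          y \<in> path_image (?\<gamma> m) \<or> y \<in> path_image (?\<gamma> m')" for l l' m m'
      using near_K eventually_notin_closed[OF closed_\<gamma>'[OF that(1)] that(2)]
        eventually_notin_closed[OF closed_\<gamma> that(3)]
      by eventually_elim (use un in blast)
    have not_both: "x \<notin> path_image (?\<gamma> {a, b}) \<or> x \<notin> path_image (?\<gamma> {c, d})"
      "x \<notin> path_image (\<gamma>' {a, c}) \<or> x \<notin> path_image (\<gamma>' {b, d})"
      using meet[unfolded dc(3)] x_z disj by blast+
    have new_in: "{a, c} \<in> \<tau>'" "{b, d} \<in> \<tau>'" using *(6) by simp_all
    have local: "\<exists>m\<in>{{a, b}, {c, d}}. x \<in> path_image (?\<gamma> m) \<and>
        (\<forall>\<^sub>F y in nhds x. y \<in> path_image (\<gamma>' l) \<longleftrightarrow> y \<in> path_image (?\<gamma> m))"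
      if l: "l \<in> {{a, c}, {b, d}}" "x \<in> path_image (\<gamma>' l)" for l
    proof -
      obtain l' where l': "l' \<in> \<tau>'" "x \<notin> path_image (\<gamma>' l')"
        "\<And>y. y \<in> path_image (\<gamma>' l) \<or> y \<in> path_image (\<gamma>' l') \<longleftrightarrow> y \<in> path_image (\<gamma>' {a, c}) \<or> y \<in> path_image (\<gamma>' {b, d})"
      proof (cases "l = {a, c}")
        case True
        then show ?thesis using that[of "{b, d}"] new_in not_both(2) l(2) by blast
      next
        case False
        then have "l = {b, d}" using l(1) by blast
        then show ?thesis using that[of "{a, c}"] new_in not_both(2) l(2) by blast
      qed
      have "x \<in> path_image (?\<gamma> {a, b}) \<or> x \<in> path_image (?\<gamma> {c, d})" using union[OF x_K] l'(3) l(2) by blast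
      then show ?thesis
      proof
        assume m: "x \<in> path_image (?\<gamma> {a, b})"
        then have "\<forall>\<^sub>F y in nhds x. y \<in> path_image (\<gamma>' l) \<longleftrightarrow> y \<in> path_image (?\<gamma> {a, b})"
          using near_eq[OF l'(1,2), of "{c, d}"] not_both(1) union l'(3) by blast
        then show ?thesis using m by blast
      next
        assume m: "x \<in> path_image (?\<gamma> {c, d})"
        then have "\<forall>\<^sub>F y in nhds x. y \<in> path_image (\<gamma>' l) \<longleftrightarrow> y \<in> path_image (?\<gamma> {c, d})"
          using near_eq[OF l'(1,2), of "{a, b}"] not_both(1) union l'(3) by blast
        then show ?thesis using m by blast
      qed
    qed
    \<comment> \<open>The last two conditions record whether \<open>m\<close> is an untouched chord.
      They keep \<open>m\<close> apart from the remaining strands when a third strand through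
      \<open>x\<close> is excluded below.\<close>
    have "\<exists>m\<in>\<tau>. m \<noteq> k1 \<and> x \<in> path_image (?\<gamma> m) \<and>
        (\<forall>\<^sub>F y in nhds x. y \<in> path_image (\<gamma>' k2) \<longleftrightarrow> y \<in> path_image (?\<gamma> m)) \<and> (k2 \<in> \<rho> \<longrightarrow> m = k2) \<and> (k2 \<notin> \<rho> \<longrightarrow> m \<notin> \<rho>)"
    proof (cases "k2 \<in> \<rho>")
      case True
      then show ?thesis using k \<gamma>'_old \<rho>_sub by (intro bexI[of _ k2]) auto
    next
      case False
      then have "k2 \<in> {{a, c}, {b, d}}" using k(2) *(6) by blast
      then obtain m where m: "m \<in> {{a, b}, {c, d}}" "x \<in> path_image (?\<gamma> m)"
          "\<forall>\<^sub>F y in nhds x. y \<in> path_image (\<gamma>' k2) \<longleftrightarrow> y \<in> path_image (?\<gamma> m)"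
        using local k(5) by blast
      have "m \<notin> \<rho>" using m(1) notin by auto
      then show ?thesis using m ef k(1) False by (intro bexI[of _ m]) auto
    qed
    then obtain m where m: "m \<in> \<tau>" "m \<noteq> k1" "x \<in> path_image (?\<gamma> m)"
      "\<forall>\<^sub>F y in nhds x. y \<in> path_image (\<gamma>' k2) \<longleftrightarrow> y \<in> path_image (?\<gamma> m)"
      "k2 \<in> \<rho> \<Longrightarrow> m = k2" "k2 \<notin> \<rho> \<Longrightarrow> m \<notin> \<rho>" by blast
    have k1\<tau>: "k1 \<in> \<tau>" "k1 \<in> \<tau>'" using \<rho>_sub[OF k(1)] by auto
    obtain i j where ij: "k1 = {i, j}" using perfect_matching_pair[OF pm k1\<tau>(1)] by metis
    obtain i' j' where ij': "m = {i', j'}" using perfect_matching_pair[OF pm m(1)] by metis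
    obtain u' v' where uv': "cross_product u' v' \<noteq> 0" "locally_line x u' (path_image (?\<gamma> k1))"
      "locally_line x v' (path_image (?\<gamma> m))" "norm x < 1"
      "\<And>g. g \<in> \<tau> - {k1, m} \<Longrightarrow> x \<notin> path_image (?\<gamma> g)"
      unfolding ij ij'
      by (rule straight_crossing[OF lab gen pm, of i j i' j' x]) (use k1\<tau> m x_k1 ij ij' in auto)
    have line2: "locally_line x v' (path_image (\<gamma>' k2))" by (rule locally_line_cong[OF m(4) uv'(3)])
    have line1: "locally_line x u' (path_image (\<gamma>' k1))" using uv'(2) \<gamma>'_old[OF k(1)] by simp
    have "x \<notin> path_image (\<gamma>' g)" if g: "g \<in> \<tau>' - {k1, k2}" for g
    proof (cases "g \<in> \<rho>")
      case True
      then have "g \<noteq> m" using m(5,6) g by blast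
      then have "x \<notin> path_image (?\<gamma> g)" using uv'(5)[of g] True \<rho>_sub(1) g by blast
      then show ?thesis using \<gamma>'_old[OF True] by simp
    next
      case False
      then have g2: "g \<in> {{a, c}, {b, d}}" using g *(6) by blast
      show ?thesis
      proof
        assume xg: "x \<in> path_image (\<gamma>' g)"
        show False
        proof (cases "k2 \<in> \<rho>")
          case True
          obtain m' where m': "m' \<in> {{a, b}, {c, d}}" "x \<in> path_image (?\<gamma> m')" using local[OF g2 xg] by blast
          have "m' \<notin> \<rho>" using m'(1) notin by auto
          then have "m' \<in> \<tau> - {k1, m}" using m'(1) ef k(1) True m(5) by auto
          then show False using uv'(5) m'(2) by blast
        next
          case False
          then have "k2 \<in> {{a, c}, {b, d}}" using k(2) *(6) by blast
          then show False using g2 g xg k(5) disj by auto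
        qed
      qed
    qed
    then have av: "closed (path_image (\<gamma>' g)) \<and> x \<notin> path_image (\<gamma>' g)" if "g \<in> \<tau>' - {k1, k2}" for g
      using that closed_\<gamma>' by blast
    obtain \<epsilon> where "crossing_chart \<tau>' \<gamma>' (affine_chart x (of_real \<epsilon> * u') (of_real \<epsilon> * v')) k1 k2"
      by (rule crossing_chart_exists[OF perfect_matching_finite(2)[OF pm'] k1\<tau>(2) k(2,3) uv'(1,4) line1 line2 av])
    then show ?thesis using affine_chart_0 by blast
  qed
  have "finite (crossings \<tau>' \<gamma>')" unfolding cs using fin by simp
  then have med': "medial_graph n \<theta> \<tau>' \<gamma>'"
    unfolding medial_graph_def using pm' circular_labelling_angles[OF lab n] strands charts
    by (simp add: matchings_iff)
  have lm': "lensless_medial_graph n \<theta> \<tau>' \<gamma>'"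
    unfolding lensless_medial_graph_def using med' medial_graph_crossings(2)[OF med' card] by blast
  have "{w \<in> square. h w \<in> path_image (\<gamma>' {a, c}) \<union> path_image (\<gamma>' {b, d})} = smoothing1"
  proof -
    have "h w \<in> path_image (\<gamma>' {a, c}) \<union> path_image (\<gamma>' {b, d}) \<longleftrightarrow> of_real \<delta> * w \<in> P \<union> Q" for w
      unfolding \<gamma>'_new p'(4) q'(4) image_Un[symmetric] h_L by (rule inj_image_mem_iff[OF inj_L])
    then show ?thesis using inside0 by (auto simp: smoothing1_def)
  qed
  then have "resolves \<tau> ?\<gamma> \<tau>' \<gamma>'"
    unfolding resolves_def using chart \<tau>'_eq outside \<gamma>'_old \<rho>
    by (intro exI[of _ h] exI[of _ "{a, b}"] exI[of _ "{c, d}"] exI[of _ "{a, c}"] exI[of _ "{b, d}"]) simp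
  then show ?thesis unfolding uncrosses_def using lm lm' by blast
qed

section \<open>The Eulerian property\<close>

text \<open>Both orders are generated by their covers, which agree by
  \<open>uncrosses_imp_cover\<close> and \<open>cover_imp_uncrosses\<close>.\<close>

lemma uncrossing_le_iff:
  assumes "perfect_matching {1..2 * n} \<tau>" "n \<ge> 1"
  shows "uncrossing_le n \<sigma> \<tau> \<longleftrightarrow> uncross_le \<sigma> \<tau>"
proof
  assume "uncrossing_le n \<sigma> \<tau>"
  moreover have "uncrosses n \<le> uncross_cover" using uncrosses_imp_cover by blast
  ultimately show "uncross_le \<sigma> \<tau>"
    unfolding uncrossing_le_def uncross_le_def using rtranclp_mono by blast
next
  assume "uncross_le \<sigma> \<tau>"
  then show "uncrossing_le n \<sigma> \<tau>" unfolding uncross_le_def uncrossing_le_def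
  proof (induction rule: converse_rtranclp_induct)
    case (step \<rho> \<sigma>)
    have "perfect_matching {1..2 * n} \<sigma>"
      using uncross_le_perfect_matching[of \<sigma> \<tau>] step(2) assms(1) by (simp add: uncross_le_def)
    then have "uncrosses n \<rho> \<sigma>" by (rule cover_imp_uncrosses[OF step(1) _ assms(2)])
    then show ?case using step.IH by (rule converse_rtranclp_into_rtranclp)
  qed simp
qed

lemma crossing_number_eq_cross_count:
  assumes "perfect_matching {1..2 * n} \<tau>" "n \<ge> 1"
  shows "crossing_number n \<tau> = cross_count \<tau>"
  using lensless_medial_graph_exists[of \<tau> n] crossing_number_eq assms by (metis matchings_iff)

text \<open>Shows that minimal matchings have no crossings, which places the adjoined minimum
  exactly one rank below them.\<close>

lemma crossing_imp_uncross_less: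
  assumes pm: "perfect_matching S \<tau>" and pos: "cross_count \<tau> \<noteq> 0"
  obtains \<sigma> where "uncross_le \<sigma> \<tau>" "\<sigma> \<noteq> \<tau>"
proof -
  have "\<exists>e\<in>\<tau>. \<exists>f\<in>\<tau>. cross_left e f"
  proof (rule ccontr)
    assume "\<not> (\<exists>e\<in>\<tau>. \<exists>f\<in>\<tau>. cross_left e f)"
    then have "cross_count \<tau> = 0" by (simp add: cross_count_def)
    then show False using pos by simp
  qed
  then obtain e f where ef: "e \<in> \<tau>" "f \<in> \<tau>" "cross e f" unfolding cross_def by blast
  obtain a b where e: "e = {a, b}" using perfect_matching_pair[OF pm ef(1)] by metis
  obtain c d where f: "f = {c, d}" using perfect_matching_pair[OF pm ef(2)] by metis
  have "e \<noteq> f" using ef(3) by auto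
  then obtain \<rho> T where *: "\<tau> = insert {a, b} (insert {c, d} \<rho>)" "perfect_matching T \<rho>"
    "distinct [a, b, c, d]" "{a, b, c, d} \<inter> T = {}"
    using perfect_matching_split2[OF pm ef(1,2)[unfolded e f]] e f by metis
  have res: "resolution \<tau> (insert {a, c} (insert {b, d} \<rho>))"
    by (rule resolutionI[OF *(2,3,4) ef(3)[unfolded e f] *(1) refl])
  then show ?thesis
    using that[OF resolution_imp_le[OF res]] resolution_cross_count_less[OF res] by fastforce
qed

lemma sign_sum_card:
  assumes "finite Z"
  shows "sign_sum Z = int (card {z \<in> Z. even (cross_count z)}) - int (card {z \<in> Z. odd (cross_count z)})"
proof -
  have "sign_sum Z = (\<Sum>z\<in>Z. of_bool (even (cross_count z)) - of_bool (odd (cross_count z)))"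
    unfolding sign_sum_def by (intro sum.cong) auto
  then show ?thesis using assms by (simp add: sum_subtractf Int_def)
qed

theorem theorem1p1:
  fixes n :: nat
  assumes "n \<ge> 1"
  shows "eulerian_poset (P_hat n) (order_hat n) (rank_hat n)"
proof -
  let ?S = "{1..2 * n}"
  have rank: "rank_hat n (Some \<tau>) = int (cross_count \<tau>)" if "perfect_matching ?S \<tau>" for \<tau>
    using crossing_number_eq_cross_count[OF that assms] by simp
  have None_below: "(None, y) \<in> order_hat n \<longleftrightarrow> y \<in> P_hat n"
    and not_below: "(Some \<sigma>, None) \<notin> order_hat n" for y \<sigma>
    by (auto simp: order_hat_def P_hat_def)
  have Some_iff: "(Some \<sigma>, Some \<tau>) \<in> order_hat n \<longleftrightarrow> perfect_matching ?S \<tau> \<and> uncross_le \<sigma> \<tau>" for \<sigma> \<tau>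
    using uncrossing_le_iff[OF _ assms] uncross_le_perfect_matching[of \<sigma> \<tau> ?S]
    by (auto simp: order_hat_def P_hat_def matchings_iff)
  have P_iff: "Some \<tau> \<in> P_hat n \<longleftrightarrow> perfect_matching ?S \<tau>" "None \<in> P_hat n" for \<tau>
    by (auto simp: P_hat_def matchings_iff)
  have "matchings n = {\<tau>. perfect_matching ?S \<tau>}" using matchings_iff by blast
  then have finite_P: "finite (P_hat n)" using finite_perfect_matchings by (simp add: P_hat_def)
  have order: "partial_order_on (P_hat n) (order_hat n)"
  proof -
    have "order_hat n \<subseteq> P_hat n \<times> P_hat n" by (auto simp: order_hat_def)
    moreover have "(x, x) \<in> order_hat n" if "x \<in> P_hat n" for x
      using that by (cases x) (simp_all add: None_below Some_iff P_iff)
    moreover have "(x, z) \<in> order_hat n" if xy: "(x, y) \<in> order_hat n" "(y, z) \<in> order_hat n" for x y z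
    proof (cases x)
      case None
      then show ?thesis using xy by (simp add: None_below order_hat_def)
    next
      case (Some \<rho>)
      then obtain \<sigma> where \<sigma>: "y = Some \<sigma>" using xy(1) not_below by (cases y) auto
      then obtain \<tau> where \<tau>: "z = Some \<tau>" using xy(2) not_below by (cases z) auto
      show ?thesis using xy unfolding Some \<sigma> \<tau> Some_iff by (meson uncross_le_trans)
    qed
    moreover have "x = y" if xy: "(x, y) \<in> order_hat n" "(y, x) \<in> order_hat n" for x y
    proof (cases x)
      case None
      then show ?thesis using xy not_below by (cases y) auto
    next
      case (Some \<rho>)
      then obtain \<sigma> where \<sigma>: "y = Some \<sigma>" using xy(1) not_below by (cases y) auto
      show ?thesis using xy unfolding Some \<sigma> Some_iff by (metis uncross_le_antisym)
    qed
    ultimately show ?thesis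
      unfolding partial_order_on_def preorder_on_def refl_on_def antisym_def trans_def by blast
  qed
  have bottom: "\<exists>b\<in>P_hat n. \<forall>x\<in>P_hat n. (b, x) \<in> order_hat n"
    using None_below P_iff(2) by blast
  have top: "\<exists>t\<in>P_hat n. \<forall>x\<in>P_hat n. (x, t) \<in> order_hat n"
  proof (intro bexI ballI)
    show t: "Some (crossing_matching n) \<in> P_hat n"
      using P_iff(1) perfect_matching_crossing_matching by blast
    show "(x, Some (crossing_matching n)) \<in> order_hat n" if x: "x \<in> P_hat n" for x
    proof (cases x)
      case None
      then show ?thesis using None_below t by simp
    next
      case (Some \<tau>)
      then have "perfect_matching ?S \<tau>" using x P_iff(1) by blast
      then show ?thesis
        unfolding Some Some_iff using perfect_matching_crossing_matching uncross_le_crossing_matching by blast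
    qed
  qed
  have graded: "rank_hat n y = rank_hat n x + 1" if cov: "covers (order_hat n) x y" for x y
  proof -
    have xy: "(x, y) \<in> order_hat n" "x \<noteq> y"
      and between: "\<And>z. (x, z) \<in> order_hat n \<Longrightarrow> (z, y) \<in> order_hat n \<Longrightarrow> z = x \<or> z = y"
      using cov unfolding covers_def by blast+
    obtain \<tau> where \<tau>: "y = Some \<tau>" using xy not_below by (cases x; cases y) auto
    have pm: "perfect_matching ?S \<tau>" using xy(1) P_iff \<tau> by (auto simp: order_hat_def)
    show ?thesis
    proof (cases x)
      case None
      \<comment> \<open>Only matchings of rank 0 cover the adjoined minimum of rank -1: resolving a
        crossing would give a matching in between.\<close>
      have "cross_count \<tau> = 0"
      proof (rule ccontr)
        assume "cross_count \<tau> \<noteq> 0"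
        then obtain \<sigma> where \<sigma>: "uncross_le \<sigma> \<tau>" "\<sigma> \<noteq> \<tau>" by (rule crossing_imp_uncross_less[OF pm])
        then have "(Some \<sigma>, y) \<in> order_hat n" using pm \<tau> Some_iff by simp
        moreover have "(x, Some \<sigma>) \<in> order_hat n"
          using None uncross_le_perfect_matching[OF \<sigma>(1)] pm by (simp add: None_below P_iff)
        ultimately show False using between[of "Some \<sigma>"] None \<tau> \<sigma>(2) by simp
      qed
      then show ?thesis using rank[OF pm] None \<tau> by simp
    next
      case (Some \<sigma>)
      have le: "uncross_le \<sigma> \<tau>" "\<sigma> \<noteq> \<tau>" using xy Some \<tau> Some_iff by auto
      then obtain \<rho> where \<rho>: "uncross_le \<sigma> \<rho>" "uncross_cover \<rho> \<tau>" by (rule uncross_le_cases)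
      have pm\<rho>: "perfect_matching ?S \<rho>" using uncross_cover_perfect_matching[OF \<rho>(2)] pm by blast
      have "(x, Some \<rho>) \<in> order_hat n" "(Some \<rho>, y) \<in> order_hat n"
        using \<rho> pm\<rho> pm Some \<tau> uncross_cover_imp_le by (simp_all add: Some_iff)
      then have "\<rho> = \<sigma> \<or> \<rho> = \<tau>" using between[of "Some \<rho>"] Some \<tau> by simp
      moreover have "\<rho> \<noteq> \<tau>" using \<rho>(2) by (auto simp: uncross_cover_def)
      ultimately have "uncross_cover \<sigma> \<tau>" using \<rho>(2) by simp
      then show ?thesis
        using rank[OF pm] rank[of \<sigma>] uncross_cover_perfect_matching[of \<sigma> \<tau> ?S] pm Some \<tau>
        by (simp add: uncross_cover_def)
    qed
  qed
  have balanced: "card {z \<in> interval (order_hat n) x y. odd (rank_hat n z)} =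
      card {z \<in> interval (order_hat n) x y. even (rank_hat n z)}"
    if xy: "(x, y) \<in> order_hat n" "x \<noteq> y" for x y
  proof -
    obtain \<tau> where \<tau>: "y = Some \<tau>" using xy not_below by (cases x; cases y) auto
    have pm: "perfect_matching ?S \<tau>" using xy(1) P_iff \<tau> by (auto simp: order_hat_def)
    have fin: "finite {z. uncross_le z \<tau>}"
      using finite_subset[OF _ finite_perfect_matchings[of ?S]] uncross_le_perfect_matching pm
      by (metis (mono_tags, lifting) mem_Collect_eq subsetI)
    have card_Some: "card {w \<in> Some ` Z. Q (rank_hat n w)} = card {z \<in> Z. Q (int (cross_count z))}"
      if "Z \<subseteq> {z. uncross_le z \<tau>}" for Z Q
    proof -
      have "rank_hat n (Some z) = int (cross_count z)" if "z \<in> Z" for z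
        using rank uncross_le_perfect_matching pm that \<open>Z \<subseteq> {z. uncross_le z \<tau>}\<close> by blast
      then have "{w \<in> Some ` Z. Q (rank_hat n w)} = Some ` {z \<in> Z. Q (int (cross_count z))}" by auto
      then show ?thesis by (simp add: card_image)
    qed
    show ?thesis
    proof (cases x)
      case None
      let ?Z = "{z. uncross_le z \<tau>}"
      have int: "interval (order_hat n) x y = insert None (Some ` ?Z)"
      proof (intro set_eqI)
        fix w show "w \<in> interval (order_hat n) x y \<longleftrightarrow> w \<in> insert None (Some ` ?Z)"
          using pm uncross_le_perfect_matching[of _ \<tau> ?S] None \<tau>
          by (cases w) (auto simp: interval_def None_below Some_iff P_iff)
      qed
      \<comment> \<open>The adjoined minimum has the odd rank -1 and supplies the one element by
        which the even matchings outnumber the odd ones.\<close>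
      have "{z \<in> insert None (Some ` ?Z). odd (rank_hat n z)} = insert None {z \<in> Some ` ?Z. odd (rank_hat n z)}"
        "{z \<in> insert None (Some ` ?Z). even (rank_hat n z)} = {z \<in> Some ` ?Z. even (rank_hat n z)}"
        by auto
      moreover have "card (insert None {z \<in> Some ` ?Z. odd (rank_hat n z)}) =
          Suc (card {z \<in> Some ` ?Z. odd (rank_hat n z)})"
        using fin by (subst card_insert_disjoint) auto
      moreover have "int (card {z \<in> ?Z. even (cross_count z)}) - int (card {z \<in> ?Z. odd (cross_count z)}) = 1"
        using sign_sum_below[OF pm] sign_sum_card[OF fin] by simp
      ultimately show ?thesis
        unfolding int using card_Some[of ?Z odd] card_Some[of ?Z even] by simp
    next
      case (Some \<sigma>)
      let ?Z = "closed_interval \<sigma> \<tau>"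
      have sub: "?Z \<subseteq> {z. uncross_le z \<tau>}" by (auto simp: closed_interval_def)
      have int: "interval (order_hat n) x y = Some ` ?Z"
      proof (intro set_eqI)
        fix w show "w \<in> interval (order_hat n) x y \<longleftrightarrow> w \<in> Some ` ?Z"
          using pm uncross_le_perfect_matching[of _ \<tau> ?S] Some \<tau> not_below
          by (cases w) (auto simp: interval_def closed_interval_def Some_iff)
      qed
      have "uncross_le \<sigma> \<tau>" "\<sigma> \<noteq> \<tau>" using xy Some \<tau> Some_iff by auto
      then have "sign_sum ?Z = 0" by (rule sign_sum_closed_interval[OF pm])
      then have "card {z \<in> ?Z. even (cross_count z)} = card {z \<in> ?Z. odd (cross_count z)}"
        using sign_sum_card[OF finite_closed_interval[OF pm]] by simp
      then show ?thesis
        unfolding int using card_Some[OF sub, of odd] card_Some[OF sub, of even] by simp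
    qed
  qed
  show ?thesis
    unfolding eulerian_poset_def bounded_graded_poset_def
    using finite_P order bottom top graded balanced by blast
qed

end
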